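(* The set $$E:=\{L>0:\ \exists\,\tilde z\in\mathbb R \text{ such that } f(L,\tilde z)=0 \text{ and } \partial_{\tilde z}f(L,\tilde z)=0\}$$ is discrete (in particular, of measure zero).
   Context: $c_0\in\mathbb R$ is a fixed constant and $\zeta$ is a fixed (independent of $L$) real-analytic function with values in $(-1,0)$ on an open interval containing $[0,\infty)$. For $L>0$ and $\tilde z\in\mathbb R$, $\tilde v(\cdot;L,\tilde z)$ denotes the solution on $[0,1]$ of the initial value problem $$-\tilde v_{yy}(y)+L^2\big(\tilde v(y)^3-\tilde v(y)+\zeta(Ly)\big)=0\ \ (y\in(0,1)),\qquad \tilde v(0)=c_0,\quad \tilde v_y(0)=\tilde z,$$ and $f(L,\tilde z):=\tilde v_y(1;L,\tilde z)$ (for those $(L,\tilde z)$ for which the solution exists on all of $[0,1]$). A pair $(L,\tilde z)$ with $f(L,\tilde z)=0$ is called a branch point if $\partial_{\tilde z}f(L,\tilde z)=0$; thus $E$ is the set of those $L$ for which some zero of $f(L,\cdot)$ gives a branch point. *)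

theory Defs
  imports "HOL-Analysis.Analysis"
begin

definition real_analytic_on :: "(real \<Rightarrow> real) \<Rightarrow> real set \<Rightarrow> bool" where
  "real_analytic_on g S \<longleftrightarrow>
     (\<forall>x\<in>S. \<exists>r>0. \<exists>a :: nat \<Rightarrow> real.
        \<forall>y. \<bar>y - x\<bar> < r \<longrightarrow> (\<lambda>n. a n * (y - x) ^ n) sums g y)"

(* v is a classical solution on [0,1], i.e. of class C^1 on [0,1] (one-sided derivatives at
   the end points) and twice differentiable in (0,1); u is the derivative v_y. *)
definition ivp_solution_pair ::
    "real \<Rightarrow> (real \<Rightarrow> real) \<Rightarrow> real \<Rightarrow> real \<Rightarrow> (real \<Rightarrow> real) \<Rightarrow> (real \<Rightarrow> real) \<Rightarrow> bool" where
  "ivp_solution_pair c0 \<zeta> L z v u \<longleftrightarrow>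
     (\<forall>y\<in>{0..1}. (v has_real_derivative u y) (at y within {0..1})) \<and>
     continuous_on {0..1} u \<and>
     (\<forall>y\<in>{0<..<1}. \<exists>w. (u has_real_derivative w) (at y) \<and>
        - w + L\<^sup>2 * (v y ^ 3 - v y + \<zeta> (L * y)) = 0) \<and>
     v 0 = c0 \<and> u 0 = z"

definition shoot_defined :: "real \<Rightarrow> (real \<Rightarrow> real) \<Rightarrow> real \<Rightarrow> real \<Rightarrow> bool" where
  "shoot_defined c0 \<zeta> L z \<longleftrightarrow> (\<exists>v u. ivp_solution_pair c0 \<zeta> L z v u)"

(* The map f(L,z) = v_y(1; L, z). The value is meaningful only where shoot_defined holds; there
   the solution is unique on [0,1], so the description picks out a unique number. *)
definition shoot :: "real \<Rightarrow> (real \<Rightarrow> real) \<Rightarrow> real \<Rightarrow> real \<Rightarrow> real" where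
  "shoot c0 \<zeta> L z = (THE m. \<exists>v u. ivp_solution_pair c0 \<zeta> L z v u \<and> m = u 1)"

(* For fixed L the set of z with shoot_defined is open (the vector field is smooth in the state),
   so the derivative at z depends only on meaningful values of shoot. *)
definition branch_point :: "real \<Rightarrow> (real \<Rightarrow> real) \<Rightarrow> real \<Rightarrow> real \<Rightarrow> bool" where
  "branch_point c0 \<zeta> L z \<longleftrightarrow>
     shoot_defined c0 \<zeta> L z \<and> shoot c0 \<zeta> L z = 0 \<and>
     ((\<lambda>z'. shoot c0 \<zeta> L z') has_real_derivative 0) (at z)"

definition branch_lengths :: "real \<Rightarrow> (real \<Rightarrow> real) \<Rightarrow> real set" where
  "branch_lengths c0 \<zeta> = {L. L > 0 \<and> (\<exists>z. branch_point c0 \<zeta> L z)}"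

end

theory Submission
  imports Defs "HOL-Complex_Analysis.Complex_Analysis"
begin

text \<open>
  In the variable \<open>x = L y\<close> the trajectory does not depend on \<open>L\<close>: with \<open>V\<close> the solution of
  \<open>V'' = V^3 - V + \<zeta> x\<close>, \<open>V 0 = c0\<close>, \<open>V' 0 = s\<close> and \<open>F (x, s) = V' (x; s)\<close> one has \<open>f (L, z) = L * F (L, z / L)\<close>,
  and \<open>F\<close> extends holomorphically to complex \<open>(x, s)\<close>. Let branch points \<open>(x_n, s_n)\<close> with \<open>x_n \<noteq> x_0\<close> accumulate at
  \<open>(x_0, s_0)\<close>. The implicit function theorem, or one blow-up where \<open>F_s\<close> has a node, puts infinitely many of them on a
  holomorphic curve in \<open>F_s = 0\<close>; by the identity theorem the curve consists of branch points. Differentiating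
  \<open>F = 0\<close> along it gives \<open>V'' = 0\<close>, so \<open>p = V (x)\<close> is a root of \<open>p^3 - p + \<zeta> x\<close>, and \<open>p\<close> moves with speed
  \<open>W = V_s \<noteq> 0\<close> in \<open>s\<close>.

  A maximum principle bounds \<open>V\<close> at branch points, hence the set of accumulation points is closed and has a point of least
  length \<open>a\<close>. There \<open>x\<close> is stationary along the curve, which forces \<open>3 p^2 = 1\<close>, that is \<open>p = - 1 / sqrt 3\<close>: a fold, from
  which the root \<open>-1 / sqrt 3 < p < 0\<close> continues to all lengths beyond \<open>a\<close>, \<open>\<zeta>\<close> being strictly increasing there.
  The polar angle of \<open>(W', W)\<close> at the end point \<open>L\<close> is an odd multiple of \<open>pi / 2\<close>, so it is constant along this branch. But
  \<open>p\<close> is a centre of the frozen equation and \<open>\<zeta>\<close> varies little far out, so the angle tends to infinity with \<open>L\<close>.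
\<close>

section \<open>Holomorphic functions of two variables\<close>

text \<open>Branch points are real, yet two real equations \<open>F = F_s = 0\<close> in two
  unknowns yield no curve by themselves; only analyticity turns a sequence of common zeros into a
  common component. Hence the complex setting. All nondegeneracy comes from
  \<open>W \<noteq> 0\<close>: the pair \<open>(W, W')\<close> solves a linear equation with nonzero
  data, and \<open>W' = F_s\<close> vanishes at a branch point. So
  \<open>F_sx = (3 p^2 - 1) W\<close> can vanish only if \<open>3 p^2 = 1\<close>; there
  \<open>F_sxx = 0\<close> and \<open>F_ssx = 6 p W^2 \<noteq> 0\<close>, so a singular zero of
  \<open>F_s\<close> has a nondegenerate Hessian. Taking the least length disposes of all other
  local pictures: a curve that near its point is a graph over the length reaches smaller lengths.
  The monotonicity of \<zeta> is not assumed but forced: the differentiated root equation excludes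
  \<open>\<zeta>' = 0\<close> along the branch, and a root strictly between
  \<open>-1 / sqrt 3\<close> and \<open>0\<close> requires a value of \<zeta> above
  \<open>\<zeta> a\<close>. The same two facts keep the branch from ending: a limiting root could
  leave the interval only at \<open>-1 / sqrt 3\<close>, where \<zeta> would have to return to
  \<open>\<zeta> a\<close>, or at \<open>0\<close>, where \<zeta> would have to vanish.\<close>

text \<open>Cauchy's formula with the contour written out over \<open>{0..1}\<close>: a derivative
  becomes an ordinary integral of values, to which the theorems on parameter integrals
  apply.\<close>

lemma deriv_eq_circle_mean:
  assumes "r > 0" and "continuous_on (cball z r) f" and "f holomorphic_on ball z r"
  shows "deriv f z = integral {0..1} (\<lambda>t. f (z + of_real r * exp (2 * of_real pi * \<i> * of_real t)) / (of_real r * exp (2 * of_real pi * \<i> * of_real t)))"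
proof -
  have "(f has_field_derivative (1 / (2 * of_real pi * \<i>) * contour_integral(circlepath z r) (\<lambda>u. f u / (u-z)^2))) (at z)"
    using Cauchy_derivative_integral_circlepath(2)[OF assms(2,3)] \<open>r > 0\<close> by simp
  then have "deriv f z = 1 / (2 * of_real pi * \<i>) * contour_integral(circlepath z r) (\<lambda>u. f u / (u-z)^2)"
    by (rule DERIV_imp_deriv)
  also have "\<dots> = 1 / (2 * of_real pi * \<i>) * integral {0..1} (\<lambda>t. f (circlepath z r t) / (circlepath z r t - z)^2 * vector_derivative (circlepath z r) (at t))"
    by (simp add: contour_integral_integral)
  also have "\<dots> = integral {0..1} (\<lambda>t. 1 / (2 * of_real pi * \<i>) * (f (circlepath z r t) / (circlepath z r t - z)^2 * vector_derivative (circlepath z r) (at t)))"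
    by (rule integral_mult_right[symmetric])
  also have "\<dots> = integral {0..1} (\<lambda>t. f (z + of_real r * exp (2 * of_real pi * \<i> * of_real t)) / (of_real r * exp (2 * of_real pi * \<i> * of_real t)))"
  proof (rule integral_cong)
    fix t :: real
    show "1 / (2 * of_real pi * \<i>) * (f (circlepath z r t) / (circlepath z r t - z)^2 * vector_derivative (circlepath z r) (at t))
      = f (z + of_real r * exp (2 * of_real pi * \<i> * of_real t)) / (of_real r * exp (2 * of_real pi * \<i> * of_real t))"
      unfolding vector_derivative_circlepath using \<open>r > 0\<close>
      by (simp add: circlepath field_simps power2_eq_square)
  qed
  finally show ?thesis .
qed

text \<open>Leibniz' rule asks for a jointly continuous derivative in \<open>w\<close>. Cauchy's
  formula expresses this derivative as the circle mean \<open>g\<close> of \<open>f\<close>, so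
  joint continuity of \<open>f\<close> is enough.\<close>

lemma holomorphic_on_param_integral:
  fixes f :: "complex \<Rightarrow> real \<Rightarrow> complex"
  assumes "open U" and cont: "continuous_on (U \<times> {a..b}) (\<lambda>(w,t). f w t)"
    and hol: "\<And>t. t \<in> {a..b} \<Longrightarrow> (\<lambda>w. f w t) holomorphic_on U"
  shows "(\<lambda>w. integral {a..b} (f w)) holomorphic_on U"
proof -
  have "(\<lambda>w. integral {a..b} (f w)) field_differentiable at w0" if w0: "w0 \<in> U" for w0
  proof -
    obtain r where r: "r > 0" "cball w0 (2*r) \<subseteq> U"
    proof -
      obtain r where "r > 0" "cball w0 r \<subseteq> U" using \<open>open U\<close> w0 open_contains_cball_eq by blast
      then show ?thesis using that[of "r/2"] by auto
    qed
    define e where "e t = of_real r * exp (2 * of_real pi * \<i> * of_real t)" for t :: real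
    have ne: "norm (e t) = r" for t
      unfolding e_def using r by (simp add: norm_mult)
    have e0: "e t \<noteq> 0" for t using ne[of t] r by auto
    have econt: "continuous_on A e" for A
      unfolding e_def by (intro continuous_intros)
    have sub: "w \<in> ball w0 r \<Longrightarrow> cball w r \<subseteq> U" for w
    proof
      fix x assume "w \<in> ball w0 r" "x \<in> cball w r"
      then have "dist w0 x \<le> 2 * r" using dist_triangle[of w0 x w] by simp
      then show "x \<in> U" using r by auto
    qed
    define g where "g w t = integral {0..1} (\<lambda>u. f (w + e u) t / e u)" for w t
    have dg: "((\<lambda>w. f w t) has_field_derivative g w t) (at w within ball w0 r)" if "w \<in> ball w0 r" "t \<in> cbox a b" for w t
    proof -
      have "deriv (\<lambda>w. f w t) w = g w t"
        unfolding g_def e_def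
      proof (rule deriv_eq_circle_mean[OF r(1)])
        have h: "(\<lambda>w. f w t) holomorphic_on U" using hol[of t] that(2) by simp
        show "continuous_on (cball w r) (\<lambda>w. f w t)"
          by (rule holomorphic_on_imp_continuous_on[OF holomorphic_on_subset[OF h sub[OF that(1)]]])
        show "(\<lambda>w. f w t) holomorphic_on ball w r"
          by (rule holomorphic_on_subset[OF h]) (use sub[OF that(1)] in auto)
      qed
      moreover have "w \<in> U" using sub[OF that(1)] r by auto
      ultimately show ?thesis
        using hol[of t] that \<open>open U\<close> by (metis holomorphic_derivI cbox_interval)
    qed
    have "continuous_on ((ball w0 r \<times> cbox a b) \<times> cbox 0 1) (\<lambda>(q,u). f (fst q + e u) (snd q) / e u)"
    proof -
      have "(fst q + e u, snd q) \<in> U \<times> {a..b}" if "q \<in> ball w0 r \<times> cbox a b" for q u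
        using sub[of "fst q"] that ne[of u] by (auto simp: subset_iff dist_norm)
      then have "continuous_on ((ball w0 r \<times> cbox a b) \<times> cbox 0 1)
          (\<lambda>x. case (fst (fst x) + e (snd x), snd (fst x)) of (w, t) \<Rightarrow> f w t)"
        by (intro continuous_on_compose2[OF cont] continuous_intros continuous_on_compose2[OF econt]) auto
      moreover have "continuous_on ((ball w0 r \<times> cbox a b) \<times> cbox 0 1) (\<lambda>x. e (snd x))"
        by (intro continuous_on_compose2[OF econt] continuous_intros) auto
      ultimately show ?thesis
        unfolding split_beta using e0 by (simp add: continuous_on_divide)
    qed
    then have cg: "continuous_on (ball w0 r \<times> cbox a b) (\<lambda>(w,t). g w t)"
      unfolding g_def split_beta
      using integral_continuous_on_param[of "ball w0 r \<times> cbox a b" 0 1 "\<lambda>q u. f (fst q + e u) (snd q) / e u", unfolded split_beta cbox_interval]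
      by (simp add: split_beta)
    have "(\<lambda>x. integral (cbox a b) (f x)) holomorphic_on ball w0 r"
    proof (rule leibniz_rule_holomorphic[OF dg _ cg])
      fix w assume w: "w \<in> ball w0 r"
      have "w \<in> U" using sub[OF w] r by auto
      then have "continuous_on {a..b} (f w)"
        by (intro continuous_on_compose2[OF cont, of _ "\<lambda>t. (w, t)", simplified] continuous_intros) auto
      then show "f w integrable_on cbox a b" by (simp add: integrable_continuous_interval)
    qed auto
    then show ?thesis using r by (simp add: holomorphic_on_imp_differentiable_at)
  qed
  then show ?thesis by (simp add: field_differentiable_at_within holomorphic_on_def)
qed

text \<open>Holomorphy is tested along holomorphic curves: this property passes to compositions, integrals and uniform
  limits without Hartogs' theorem.\<close>

definition hol2 :: "(complex \<times> complex) set \<Rightarrow> (complex \<times> complex \<Rightarrow> complex) \<Rightarrow> bool" where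
  "hol2 S H \<longleftrightarrow> continuous_on S H \<and>
     (\<forall>D l p. open D \<longrightarrow> l holomorphic_on D \<longrightarrow> p holomorphic_on D \<longrightarrow> (\<forall>w\<in>D. (l w, p w) \<in> S) \<longrightarrow>
        (\<lambda>w. H (l w, p w)) holomorphic_on D)"

definition pd1 :: "(complex \<times> complex \<Rightarrow> complex) \<Rightarrow> complex \<times> complex \<Rightarrow> complex" where
  "pd1 H q = deriv (\<lambda>u. H (u, snd q)) (fst q)"

definition pd2 :: "(complex \<times> complex \<Rightarrow> complex) \<Rightarrow> complex \<times> complex \<Rightarrow> complex" where
  "pd2 H q = deriv (\<lambda>u. H (fst q, u)) (snd q)"

lemma hol2_cont: "hol2 S H \<Longrightarrow> continuous_on S H"
  by (simp add: hol2_def)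

lemma hol2_curve:
  "hol2 S H \<Longrightarrow> open D \<Longrightarrow> l holomorphic_on D \<Longrightarrow> p holomorphic_on D \<Longrightarrow> (\<And>w. w \<in> D \<Longrightarrow> (l w, p w) \<in> S)
    \<Longrightarrow> (\<lambda>w. H (l w, p w)) holomorphic_on D"
  by (simp add: hol2_def)

lemma hol2_subset: "hol2 S H \<Longrightarrow> T \<subseteq> S \<Longrightarrow> hol2 T H"
  unfolding hol2_def by (meson continuous_on_subset subsetD)

lemma hol2_cong: "hol2 S H \<Longrightarrow> (\<And>q. q \<in> S \<Longrightarrow> H q = G q) \<Longrightarrow> hol2 S G"
  unfolding hol2_def
  by (smt (verit, ccfv_SIG) continuous_on_cong holomorphic_cong)

lemma hol2_const: "hol2 S (\<lambda>_. c)"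
  and hol2_fst: "hol2 S fst"
  and hol2_snd: "hol2 S snd"
  by (auto simp: hol2_def intro!: continuous_intros)

lemma hol2I:
  "continuous_on S H \<Longrightarrow> (\<And>D l p. open D \<Longrightarrow> l holomorphic_on D \<Longrightarrow> p holomorphic_on D \<Longrightarrow> \<forall>w\<in>D. (l w, p w) \<in> S
    \<Longrightarrow> (\<lambda>w. H (l w, p w)) holomorphic_on D) \<Longrightarrow> hol2 S H"
  by (simp add: hol2_def)

lemma
  assumes "hol2 S f" "hol2 S g"
  shows hol2_add: "hol2 S (\<lambda>q. f q + g q)"
    and hol2_diff: "hol2 S (\<lambda>q. f q - g q)"
    and hol2_mult: "hol2 S (\<lambda>q. f q * g q)"
proof -
  note c = hol2_cont[OF assms(1)] hol2_cont[OF assms(2)]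
  note h = hol2_curve[OF assms(1)] hol2_curve[OF assms(2)]
  show "hol2 S (\<lambda>q. f q + g q)"
    by (rule hol2I) (simp_all add: c h continuous_on_add holomorphic_on_add)
  show "hol2 S (\<lambda>q. f q - g q)"
    by (rule hol2I) (simp_all add: c h continuous_on_diff holomorphic_on_diff)
  show "hol2 S (\<lambda>q. f q * g q)"
    by (rule hol2I) (simp_all add: c h continuous_on_mult holomorphic_on_mult)
qed

lemma hol2_power: "hol2 S f \<Longrightarrow> hol2 S (\<lambda>q. f q ^ n)"
  by (induction n) (auto intro: hol2_const hol2_mult)

lemma hol2_compose1:
  assumes "hol2 S f" "g holomorphic_on N" "\<And>q. q \<in> S \<Longrightarrow> f q \<in> N"
  shows "hol2 S (\<lambda>q. g (f q))"
  unfolding hol2_def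
proof (intro conjI allI impI)
  show "continuous_on S (\<lambda>q. g (f q))"
    using assms by (intro continuous_on_compose2[OF holomorphic_on_imp_continuous_on[OF assms(2)] hol2_cont]) auto
next
  fix D l p assume *: "open D" "l holomorphic_on D" "p holomorphic_on D" "\<forall>w\<in>D. (l w, p w) \<in> S"
  have "(\<lambda>w. f (l w, p w)) holomorphic_on D" using * assms(1) by (auto intro!: hol2_curve)
  then have "(g \<circ> (\<lambda>w. f (l w, p w))) holomorphic_on D"
    by (rule holomorphic_on_compose_gen[OF _ assms(2)]) (use * assms in auto)
  then show "(\<lambda>w. g (f (l w, p w))) holomorphic_on D" by (simp add: o_def)
qed

lemma hol2_compose2:
  assumes "hol2 S H" "hol2 T f" "hol2 T g" "\<And>q. q \<in> T \<Longrightarrow> (f q, g q) \<in> S"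
  shows "hol2 T (\<lambda>q. H (f q, g q))"
  unfolding hol2_def
proof (intro conjI allI impI)
  show "continuous_on T (\<lambda>q. H (f q, g q))"
    using assms by (intro continuous_on_compose2[OF hol2_cont[OF assms(1)]] continuous_on_Pair hol2_cont) auto
next
  fix D l p assume *: "open D" "l holomorphic_on D" "p holomorphic_on D" "\<forall>w\<in>D. (l w, p w) \<in> T"
  show "(\<lambda>w. H (f (l w, p w), g (l w, p w))) holomorphic_on D"
    by (rule hol2_curve[OF assms(1)]) (use * assms in \<open>auto intro!: hol2_curve\<close>)
qed

lemma hol2_local:
  assumes "\<And>q. q \<in> S \<Longrightarrow> \<exists>T. open T \<and> q \<in> T \<and> hol2 (T \<inter> S) H"
  shows "hol2 S H"
  unfolding hol2_def
proof (intro conjI allI impI)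
  show "continuous_on S H"
    unfolding continuous_on_eq_continuous_within
  proof
    fix q assume "q \<in> S"
    then obtain T where T: "open T" "q \<in> T" "hol2 (T \<inter> S) H" using assms by blast
    then have "continuous (at q within S \<inter> T) H" using hol2_cont[OF T(3)] \<open>q \<in> S\<close>
      by (auto simp: continuous_on_eq_continuous_within Int_commute)
    then show "continuous (at q within S) H"
      using at_within_nhd[OF T(2,1), of S "S \<inter> T"] by (simp add: Int_assoc)
  qed
next
  fix D l p assume *: "open D" "l holomorphic_on D" "p holomorphic_on D" "\<forall>w\<in>D. (l w, p w) \<in> S"
  show "(\<lambda>w. H (l w, p w)) holomorphic_on D"
    unfolding holomorphic_on_def
  proof
    fix w assume w: "w \<in> D"
    then obtain T where T: "open T" "(l w, p w) \<in> T" "hol2 (T \<inter> S) H" using assms * by blast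
    define D' where "D' = D \<inter> (\<lambda>w. (l w, p w)) -` T"
    have "continuous_on D (\<lambda>w. (l w, p w))"
      using * by (auto intro!: continuous_on_Pair holomorphic_on_imp_continuous_on)
    then have "open D'" unfolding D'_def using *(1) T(1) by (simp add: continuous_on_open_vimage Int_commute)
    moreover have "(\<lambda>w. H (l w, p w)) holomorphic_on D'"
      by (rule hol2_curve[OF T(3)]) (use * \<open>open D'\<close> in \<open>auto simp: D'_def intro: holomorphic_on_subset\<close>)
    moreover have "w \<in> D'" using w T by (auto simp: D'_def)
    ultimately show "(\<lambda>w. H (l w, p w)) field_differentiable at w within D"
      by (meson field_differentiable_at_within holomorphic_on_imp_differentiable_at)
  qed
qed

lemma hol2_uniform_limit:
  assumes "\<And>n. hol2 S (f n)" and "uniform_limit S f g sequentially"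
  shows "hol2 S g"
  unfolding hol2_def
proof (intro conjI allI impI)
  show "continuous_on S g"
    by (rule uniform_limit_theorem[OF _ assms(2)]) (use assms(1) hol2_cont in auto)
next
  fix D l p assume *: "open D" "l holomorphic_on D" "p holomorphic_on D" "\<forall>w\<in>D. (l w, p w) \<in> S"
  show "(\<lambda>w. g (l w, p w)) holomorphic_on D"
  proof (rule holomorphic_uniform_sequence[OF *(1), of "\<lambda>n w. f n (l w, p w)"])
    show "(\<lambda>w. f n (l w, p w)) holomorphic_on D" for n
      using * assms(1) by (auto intro!: hol2_curve)
    fix x assume "x \<in> D"
    then obtain d where d: "d > 0" "cball x d \<subseteq> D" using *(1) open_contains_cball_eq by blast
    have "uniform_limit (cball x d) (\<lambda>n w. f n (l w, p w)) (\<lambda>w. g (l w, p w)) sequentially"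
      using assms(2) unfolding uniform_limit_iff
      by (smt (verit, best) "*"(4) d(2) eventually_mono subsetD)
    then show "\<exists>d>0. cball x d \<subseteq> D \<and> uniform_limit (cball x d) (\<lambda>n w. f n (l w, p w)) (\<lambda>w. g (l w, p w)) sequentially"
      using d by blast
  qed
qed

lemma hol2_integral:
  fixes f :: "complex \<times> complex \<Rightarrow> real \<Rightarrow> complex"
  assumes cont: "continuous_on (S \<times> {a..b}) (\<lambda>(q,t). f q t)"
    and hol: "\<And>t. t \<in> {a..b} \<Longrightarrow> hol2 S (\<lambda>q. f q t)"
  shows "hol2 S (\<lambda>q. integral {a..b} (f q))"
  unfolding hol2_def
proof (intro conjI allI impI)
  show "continuous_on S (\<lambda>q. integral {a..b} (f q))"
    by (rule integral_continuous_on_param[where a = a and b = b and f = f, unfolded cbox_interval, OF cont])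
next
  fix D l p assume *: "open D" "l holomorphic_on D" "p holomorphic_on D" "\<forall>w\<in>D. (l w, p w) \<in> S"
  have lp: "continuous_on D l" "continuous_on D p"
    using * by (auto intro!: holomorphic_on_imp_continuous_on)
  show "(\<lambda>w. integral {a..b} (f (l w, p w))) holomorphic_on D"
  proof (rule holomorphic_on_param_integral[OF *(1)])
    show "continuous_on (D \<times> {a..b}) (\<lambda>(w, t). f (l w, p w) t)"
      unfolding split_beta
      by (rule continuous_on_compose2[OF cont, of _ "\<lambda>x. ((l (fst x), p (fst x)), snd x)", simplified])
         (use * lp in \<open>auto intro!: continuous_intros intro: continuous_on_compose2[OF lp(1)] continuous_on_compose2[OF lp(2)]\<close>)
    show "(\<lambda>w. f (l w, p w) t) holomorphic_on D" if "t \<in> {a..b}" for t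
      using hol2_curve[OF hol[OF that]] * by blast
  qed
qed


section \<open>Partial derivatives and the chain rule\<close>

lemma hol2_D1: "hol2 S H \<Longrightarrow> open S \<Longrightarrow> (x,s) \<in> S \<Longrightarrow> ((\<lambda>u. H (u,s)) has_field_derivative pd1 H (x,s)) (at x)"
proof -
  assume a: "hol2 S H" "open S" "(x,s) \<in> S"
  have o: "open ((\<lambda>u. (u,s)) -` S)" by (intro open_vimage a continuous_intros)
  have "(\<lambda>u. H (u,s)) holomorphic_on ((\<lambda>u. (u,s)) -` S)"
    by (rule hol2_curve[OF a(1) o]) (auto intro: holomorphic_intros)
  then show ?thesis unfolding pd1_def using a o by (auto intro: holomorphic_derivI)
qed

lemma hol2_D2: "hol2 S H \<Longrightarrow> open S \<Longrightarrow> (x,s) \<in> S \<Longrightarrow> ((\<lambda>u. H (x,u)) has_field_derivative pd2 H (x,s)) (at s)"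
proof -
  assume a: "hol2 S H" "open S" "(x,s) \<in> S"
  have o: "open ((\<lambda>u. (x,u)) -` S)" by (intro open_vimage a continuous_intros)
  have "(\<lambda>u. H (x,u)) holomorphic_on ((\<lambda>u. (x,u)) -` S)"
    by (rule hol2_curve[OF a(1) o]) (auto intro: holomorphic_intros)
  then show ?thesis unfolding pd2_def using a o by (auto intro: holomorphic_derivI)
qed

lemma pd1_cong: "open S \<Longrightarrow> q \<in> S \<Longrightarrow> (\<And>q. q \<in> S \<Longrightarrow> H q = G q) \<Longrightarrow> pd1 H q = pd1 G q"
proof -
  assume a: "open S" "q \<in> S" "\<And>q. q \<in> S \<Longrightarrow> H q = G q"
  have "open ((\<lambda>u. (u, snd q)) -` S)" by (intro open_vimage a continuous_intros)
  then have "\<forall>\<^sub>F u in nhds (fst q). u \<in> (\<lambda>u. (u, snd q)) -` S"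
    by (rule eventually_nhds_in_open) (use a in auto)
  then show ?thesis unfolding pd1_def by (intro deriv_cong_ev refl) (auto elim!: eventually_mono simp: a(3))
qed

lemma pd2_cong: "open S \<Longrightarrow> q \<in> S \<Longrightarrow> (\<And>q. q \<in> S \<Longrightarrow> H q = G q) \<Longrightarrow> pd2 H q = pd2 G q"
proof -
  assume a: "open S" "q \<in> S" "\<And>q. q \<in> S \<Longrightarrow> H q = G q"
  have "open ((\<lambda>u. (fst q, u)) -` S)" by (intro open_vimage a continuous_intros)
  then have "\<forall>\<^sub>F u in nhds (snd q). u \<in> (\<lambda>u. (fst q, u)) -` S"
    by (rule eventually_nhds_in_open) (use a in auto)
  then show ?thesis unfolding pd2_def by (intro deriv_cong_ev refl) (auto elim!: eventually_mono simp: a(3))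
qed

lemma polydisc_in_open:
  fixes x s :: complex
  assumes "open S" "(x,s) \<in> S"
  obtains r where "r > 0" "cball x r \<times> cball s r \<subseteq> S"
proof -
  obtain A B where AB: "open A" "open B" "x \<in> A" "s \<in> B" "A \<times> B \<subseteq> S"
    using assms by (metis open_prod_elim mem_Sigma_iff prod.sel)
  obtain r1 r2 where "r1 > 0" "cball x r1 \<subseteq> A" "r2 > 0" "cball s r2 \<subseteq> B"
    using AB open_contains_cball_eq by metis
  then show ?thesis using AB(5) by (intro that[of "min r1 r2"]) (force simp: subset_iff)+
qed

lemma hol2_pd2_circle_mean:
  assumes "hol2 S H" "cball x r \<times> cball s (2*r) \<subseteq> S" "r > 0" "open S" "(x', s') \<in> ball x r \<times> ball s r"
  shows "pd2 H (x',s') = integral {0..1} (\<lambda>t. H (x', s' + of_real r * exp (2 * of_real pi * \<i> * of_real t)) / (of_real r * exp (2 * of_real pi * \<i> * of_real t)))"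
proof -
  let ?D = "(\<lambda>u. (x',u)) -` S"
  have o: "open ?D" by (intro open_vimage assms continuous_intros)
  have h: "(\<lambda>u. H (x',u)) holomorphic_on ?D"
    by (rule hol2_curve[OF assms(1) o]) (auto intro: holomorphic_intros)
  have sub: "cball s' r \<subseteq> ?D"
  proof
    fix u assume "u \<in> cball s' r"
    then have "dist s u \<le> 2 * r" using assms(5) dist_triangle[of s u s'] by auto
    then show "u \<in> ?D" using assms(2,5) by auto
  qed
  show ?thesis unfolding pd2_def fst_conv snd_conv
  proof (rule deriv_eq_circle_mean[OF assms(3)])
    show "continuous_on (cball s' r) (\<lambda>u. H (x', u))"
      by (rule holomorphic_on_imp_continuous_on[OF holomorphic_on_subset[OF h sub]])
    show "(\<lambda>u. H (x', u)) holomorphic_on ball s' r"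
      by (rule holomorphic_on_subset[OF h]) (use sub in auto)
  qed
qed

lemma circle_shift_facts:
  assumes "hol2 S H" "cball x r \<times> cball s (2*r) \<subseteq> S" "r > 0"
  defines "e \<equiv> (\<lambda>t. complex_of_real r * exp (2 * of_real pi * \<i> * of_real t))"
  shows "continuous_on ((ball x r \<times> ball s r) \<times> {0..1}) (\<lambda>(q,t). H (fst q, snd q + e t) / e t)" (is ?c)
    and "hol2 (ball x r \<times> ball s r) (\<lambda>q. H (fst q, snd q + e t) / e t)" (is ?h)
proof -
  have ne: "norm (e t) = r" for t
    unfolding e_def using assms(3) by (simp add: norm_mult)
  have e0: "e t \<noteq> 0" for t using ne[of t] assms(3) by auto
  have mem: "(fst q, snd q + e t) \<in> S" if "q \<in> ball x r \<times> ball s r" for q t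
  proof -
    have "dist s (snd q + e t) \<le> 2 * r"
      using that dist_triangle[of s "snd q + e t" "snd q"] ne[of t] by (auto simp: dist_norm)
    then show ?thesis using that assms(2) by (auto simp: subset_iff)
  qed
  have c: "continuous_on A e" for A
    unfolding e_def by (intro continuous_intros)
  have "continuous_on ((ball x r \<times> ball s r) \<times> {0..1}) (\<lambda>y. H (fst (fst y), snd (fst y) + e (snd y)))"
    by (rule continuous_on_compose2[OF hol2_cont[OF assms(1)]])
       (use mem in \<open>auto intro!: continuous_intros continuous_on_compose2[OF c]\<close>)
  moreover have "continuous_on ((ball x r \<times> ball s r) \<times> {0..1}) (\<lambda>y. e (snd y))"
    by (intro continuous_on_compose2[OF c] continuous_intros) auto
  ultimately show ?c
    unfolding split_beta using e0 by (simp add: continuous_on_divide)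
  have "hol2 (ball x r \<times> ball s r) (\<lambda>q. H (fst q, snd q + e t))"
    by (rule hol2_compose2[OF assms(1)]) (use mem in \<open>auto intro!: hol2_fst hol2_snd hol2_add hol2_const\<close>)
  then have "hol2 (ball x r \<times> ball s r) (\<lambda>q. H (fst q, snd q + e t) * (1 / e t))"
    by (intro hol2_mult hol2_const)
  then show ?h by simp
qed

text \<open>Locally the partial derivative is an integral over shifts of \<open>H\<close>, and
  \<open>hol2\<close> survives both shifting and integration.\<close>

lemma hol2_pd2:
  assumes "hol2 S H" "open S"
  shows "hol2 S (pd2 H)"
proof (rule hol2_local)
  fix q assume "q \<in> S"
  obtain x s where q: "q = (x,s)" by (cases q)
  obtain r0 where r0: "r0 > 0" "cball x r0 \<times> cball s r0 \<subseteq> S"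
    using polydisc_in_open[OF assms(2)] \<open>q \<in> S\<close> q by blast
  define r where "r = r0 / 2"
  have r: "r > 0" "cball x r \<times> cball s (2*r) \<subseteq> S"
    using r0 by (auto simp: r_def)
  let ?T = "ball x r \<times> ball s r"
  have "hol2 ?T (\<lambda>q. integral {0..1} (\<lambda>t. H (fst q, snd q + of_real r * exp (2 * of_real pi * \<i> * of_real t)) / (of_real r * exp (2 * of_real pi * \<i> * of_real t))))"
    by (rule hol2_integral) (use circle_shift_facts[OF assms(1) r(2,1)] in auto)
  then have "hol2 ?T (pd2 H)"
  proof (rule hol2_cong)
    fix p assume "p \<in> ?T"
    then show "integral {0..1} (\<lambda>t. H (fst p, snd p + of_real r * exp (2 * of_real pi * \<i> * of_real t)) / (of_real r * exp (2 * of_real pi * \<i> * of_real t))) = pd2 H p"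
      using hol2_pd2_circle_mean[OF assms(1) r(2,1) assms(2), of "fst p" "snd p"] by simp
  qed
  then have "hol2 (?T \<inter> S) (pd2 H)" by (rule hol2_subset) auto
  then show "\<exists>T. open T \<and> q \<in> T \<and> hol2 (T \<inter> S) (pd2 H)"
    using r q by (intro exI[of _ ?T]) (auto intro: open_Times)
qed

lemma hol2_swap: "hol2 S H \<Longrightarrow> hol2 (prod.swap -` S) (\<lambda>q. H (snd q, fst q))"
  by (rule hol2_compose2[where S = S]) (auto intro: hol2_fst hol2_snd simp: prod.swap_def)

lemma open_swap_vimage: "open S \<Longrightarrow> open (prod.swap -` (S :: (complex \<times> complex) set))"
  by (intro open_vimage) (auto simp: prod.swap_def intro!: continuous_intros)

lemma hol2_pd1:
  assumes "hol2 S H" "open S"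
  shows "hol2 S (pd1 H)"
proof -
  have "hol2 (prod.swap -` S) (pd2 (\<lambda>q. H (snd q, fst q)))"
    by (intro hol2_pd2 hol2_swap open_swap_vimage assms)
  from hol2_swap[OF this] show ?thesis
    by (simp add: vimage_def pd2_def pd1_def[abs_def])
qed

text \<open>Differentiating Cauchy's formula for \<open>pd2 H\<close> under the integral sign in the
  first variable gives Cauchy's formula for \<open>pd2 (pd1 H)\<close>.\<close>

lemma pd_commute:
  assumes "hol2 S H" "open S" "q \<in> S"
  shows "pd1 (pd2 H) q = pd2 (pd1 H) q"
proof -
  obtain x s where q: "q = (x,s)" by (cases q)
  obtain r0 where r0: "r0 > 0" "cball x r0 \<times> cball s r0 \<subseteq> S"
    using polydisc_in_open[OF assms(2)] \<open>q \<in> S\<close> q by blast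
  define r where "r = r0 / 2"
  have r: "r > 0" "cball x r \<times> cball s (2*r) \<subseteq> S"
    using r0 by (auto simp: r_def)
  have p1: "hol2 S (pd1 H)" by (intro hol2_pd1 assms)
  define e where "e t = of_real r * exp (2 * of_real pi * \<i> * of_real t)" for t :: real
  have ne: "norm (e t) = r" for t
    unfolding e_def using r by (simp add: norm_mult)
  note c1 = circle_shift_facts(1)[OF p1 r(2,1), folded e_def]
  note c0 = circle_shift_facts(1)[OF assms(1) r(2,1), folded e_def]
  have "((\<lambda>u. integral (cbox 0 1) (\<lambda>t. H (u, s + e t) / e t)) has_field_derivative
      integral (cbox 0 1) (\<lambda>t. pd1 H (x, s + e t) / e t)) (at x within ball x r)"
  proof (rule leibniz_rule_field_derivative[where fx = "\<lambda>u t. pd1 H (u, s + e t) / e t"])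
    fix u t assume u: "u \<in> ball x r"
    have "(u, s + e t) \<in> S" using u r ne[of t] by (auto simp: subset_iff dist_norm)
    from hol2_D1[OF assms(1,2) this] have "((\<lambda>u. H (u, s + e t)) has_field_derivative pd1 H (u, s + e t)) (at u within ball x r)"
      by (rule has_field_derivative_at_within)
    then show "((\<lambda>u. H (u, s + e t) / e t) has_field_derivative pd1 H (u, s + e t) / e t) (at u within ball x r)"
      by (rule DERIV_cdivide)
  next
    fix u assume u: "u \<in> ball x r"
    have "continuous_on {0..1} (\<lambda>t. H (u, s + e t) / e t)"
      using continuous_on_compose2[OF c0, of "{0..1}" "\<lambda>t. ((u, s), t)"] u r
      by (simp add: image_subset_iff continuous_on_Pair)
    then show "(\<lambda>t. H (u, s + e t) / e t) integrable_on cbox 0 1"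
      by (simp add: integrable_continuous_interval)
  next
    show "continuous_on (ball x r \<times> cbox 0 1) (\<lambda>(u, t). pd1 H (u, s + e t) / e t)"
      using continuous_on_compose2[OF c1, of "ball x r \<times> {0..1}" "\<lambda>y. ((fst y, s), snd y)"] r
      by (simp add: image_subset_iff continuous_on_Pair continuous_on_fst continuous_on_snd split_beta)
  qed (use r in auto)
  then have "((\<lambda>u. integral {0..1} (\<lambda>t. H (u, s + e t) / e t)) has_field_derivative
      integral {0..1} (\<lambda>t. pd1 H (x, s + e t) / e t)) (at x)"
    using r by (simp add: at_within_open[of x "ball x r"])
  moreover have "integral {0..1} (\<lambda>t. pd1 H (x, s + e t) / e t) = pd2 (pd1 H) (x,s)"
    using hol2_pd2_circle_mean[OF p1 r(2,1) assms(2), of x s] r by (simp add: e_def)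
  moreover have "\<forall>\<^sub>F u in nhds x. integral {0..1} (\<lambda>t. H (u, s + e t) / e t) = pd2 H (u, s)"
  proof -
    have "\<forall>\<^sub>F u in nhds x. u \<in> ball x r" by (rule eventually_nhds_in_open) (use r in auto)
    then show ?thesis
      by eventually_elim (use hol2_pd2_circle_mean[OF assms(1) r(2,1) assms(2), of _ s] r in \<open>simp add: e_def\<close>)
  qed
  ultimately have "((\<lambda>u. pd2 H (u, s)) has_field_derivative pd2 (pd1 H) (x,s)) (at x)"
    using DERIV_cong_ev[OF refl _ refl, of "\<lambda>u. integral {0..1} (\<lambda>t. H (u, s + e t) / e t)" "\<lambda>u. pd2 H (u, s)" x] by simp
  then show ?thesis unfolding q pd1_def[of "pd2 H"] fst_conv snd_conv by (rule DERIV_imp_deriv)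
qed

text \<open>That the composition is holomorphic is part of \<open>hol2\<close>; its derivative needs
  the total derivative of \<open>H\<close>, which exists because one partial derivative exists and
  the other is continuous.\<close>

lemma hol2_chain:
  assumes "hol2 S H" "open S" "(l w, p w) \<in> S"
    and l: "(l has_field_derivative l') (at w)" and p: "(p has_field_derivative p') (at w)"
  shows "((\<lambda>w. H (l w, p w)) has_field_derivative pd1 H (l w, p w) * l' + pd2 H (l w, p w) * p') (at w)"
proof -
  obtain r where r: "r > 0" "cball (l w) r \<times> cball (p w) r \<subseteq> S"
    using polydisc_in_open[OF assms(2,3)] by blast
  let ?X = "ball (l w) r" and ?Y = "ball (p w) r"
  have sub: "(x,y) \<in> S" if "x \<in> ?X" "y \<in> ?Y" for x y using that r by auto
  have "((\<lambda>(x, y). H (x,y)) has_derivative (\<lambda>(tx, ty). pd1 H (l w, p w) * tx + blinfun_apply (blinfun_mult_right (pd2 H (l w, p w))) ty))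
     (at (l w, p w) within ?X \<times> ?Y)"
  proof (rule has_derivative_partialsI[where f = "\<lambda>x y. H (x,y)" and fy = "\<lambda>x y. blinfun_mult_right (pd2 H (x,y))"])
    show "((\<lambda>x. H (x, p w)) has_derivative (*) (pd1 H (l w, p w))) (at (l w) within ?X)"
      using hol2_D1[OF assms(1-3)] has_field_derivative_at_within has_field_derivative_def by blast
    show "((\<lambda>y. H (x, y)) has_derivative blinfun_apply (blinfun_mult_right (pd2 H (x, y)))) (at y within ?Y)" if "x \<in> ?X" "y \<in> ?Y" for x y
      using hol2_D2[OF assms(1,2) sub[OF that]] has_field_derivative_at_within has_field_derivative_def
      by (metis blinfun_mult_right.rep_eq)
    have "continuous_on S (pd2 H)" by (intro hol2_cont hol2_pd2 assms)
    then have "continuous (at (l w, p w)) (pd2 H)" using assms(2,3) continuous_on_eq_continuous_at by blast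
    then have "continuous (at (l w, p w) within ?X \<times> ?Y) (pd2 H)" by (rule continuous_at_imp_continuous_within)
    then show "continuous (at (l w, p w) within ?X \<times> ?Y) (\<lambda>(x, y). blinfun_mult_right (pd2 H (x, y)))"
      unfolding split_beta prod.collapse
      by (rule bounded_linear.continuous[OF bounded_linear_blinfun_mult_right])
  qed (use r in auto)
  moreover have "at (l w, p w) within ?X \<times> ?Y = at (l w, p w)"
    by (rule at_within_open) (use r in \<open>auto intro: open_Times\<close>)
  ultimately have H: "(H has_derivative (\<lambda>(tx, ty). pd1 H (l w, p w) * tx + pd2 H (l w, p w) * ty)) (at (l w, p w))"
    by (simp add: blinfun_mult_right.rep_eq)
  have "((\<lambda>w. (l w, p w)) has_derivative (\<lambda>h. (l' * h, p' * h))) (at w)"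
    using l p unfolding has_field_derivative_def by (rule has_derivative_Pair)
  from has_derivative_compose[OF this H] show ?thesis
    unfolding has_field_derivative_def
    by (rule has_derivative_eq_rhs) (simp add: fun_eq_iff algebra_simps)
qed

section \<open>Identity theorem and reflection\<close>

lemma holomorphic_zero_sequence:
  assumes hol: "f holomorphic_on ball z r" and "r > 0" and X: "X \<longlonglongrightarrow> z" and ne: "\<And>n::nat. X n \<noteq> z"
    and zero: "\<And>n. X n \<in> ball z r \<Longrightarrow> f (X n) = 0" and w: "w \<in> ball z r"
  shows "f w = 0"
proof (rule analytic_continuation[OF hol _ _ _ _ _ _ w, of "range X \<inter> ball z r" z])
  have "\<forall>\<^sub>F n in sequentially. X n \<in> ball z r"
    by (rule topological_tendstoD[OF X]) (use \<open>r > 0\<close> in auto)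
  then obtain N where N: "\<And>n. n \<ge> N \<Longrightarrow> X n \<in> ball z r" by (auto simp: eventually_sequentially)
  show "z islimpt range X \<inter> ball z r"
    unfolding islimpt_sequential
    by (rule exI[of _ "\<lambda>n. X (n + N)"]) (use N ne LIMSEQ_ignore_initial_segment[OF X, of N] in auto)
qed (use \<open>r > 0\<close> zero in auto)

text \<open>\<open>f\<close> and its reflection \<open>cnj \<circ> f \<circ> cnj\<close> agree along
  the real sequence, hence on the whole disc. This makes a complex curve real once it passes through
  infinitely many real points near its centre.\<close>

lemma holomorphic_real_sequence:
  assumes hol: "f holomorphic_on ball (of_real a) r" and "r > 0" and X: "X \<longlonglongrightarrow> a" and ne: "\<And>n::nat. X n \<noteq> a"
    and re: "\<And>n. complex_of_real (X n) \<in> ball (of_real a) r \<Longrightarrow> f (of_real (X n)) \<in> \<real>"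
    and x: "\<bar>x - a\<bar> < r"
  shows "f (of_real x) \<in> \<real>"
proof -
  let ?B = "ball (of_real a :: complex) r"
  have cB: "cnj ` ?B = ?B"
  proof -
    have "cnj w \<in> ?B" if "w \<in> ?B" for w
      using that complex_mod_cnj[of "of_real a - w"] by (simp add: dist_norm del: complex_mod_cnj)
    then show ?thesis by (auto simp: image_iff intro!: bexI[of _ "cnj _"])
  qed
  have "cnj \<circ> f \<circ> cnj holomorphic_on ?B"
    by (rule holomorphic_on_compose_cnj_cnj) (use hol cB in auto)
  then have "(\<lambda>w. f w - (cnj \<circ> f \<circ> cnj) w) holomorphic_on ?B"
    by (intro holomorphic_on_diff hol)
  then have "f (of_real x) - (cnj \<circ> f \<circ> cnj) (of_real x) = 0"
  proof (rule holomorphic_zero_sequence)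
    show "(\<lambda>n. of_real (X n)) \<longlonglongrightarrow> (of_real a :: complex)" by (intro tendsto_of_real X)
    show "f (of_real (X n)) - (cnj \<circ> f \<circ> cnj) (of_real (X n)) = 0" if "complex_of_real (X n) \<in> ?B" for n
      using re[OF that] by (simp add: Reals_cnj_iff)
    show "of_real x \<in> ?B" using x by (simp add: dist_of_real dist_real_def abs_minus_commute)
  qed (use ne \<open>r > 0\<close> in auto)
  then show ?thesis by (simp add: Reals_cnj_iff)
qed

section \<open>Implicit functions\<close>

text \<open>Newton's map with the derivative frozen at its value \<open>c\<close> in the centre is a
  contraction with factor 1/2, uniformly in \<open>s\<close>; its fixed point is the implicit
  function.\<close>

lemma hol2_implicit1:
  assumes K: "hol2 S K" "open S" "(x0,s0) \<in> S" "K (x0,s0) = 0" "pd1 K (x0,s0) \<noteq> 0"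
  obtains d e l where "d > 0" "e > 0" "l holomorphic_on ball s0 d" "l s0 = x0"
    "\<forall>s\<in>ball s0 d. l s \<in> ball x0 e" "ball x0 e \<times> ball s0 d \<subseteq> S"
    "\<forall>s\<in>ball s0 d. \<forall>x\<in>ball x0 e. K (x,s) = 0 \<longleftrightarrow> x = l s"
proof -
  define c where "c = pd1 K (x0,s0)"
  have c: "c \<noteq> 0" using K c_def by simp
  obtain r where r: "r > 0" "cball x0 r \<times> cball s0 r \<subseteq> S"
    using polydisc_in_open[OF K(2,3)] by blast
  have "continuous_on S (pd1 K)" by (intro hol2_cont hol2_pd1 K)
  then have "isCont (pd1 K) (x0,s0)" using K(2,3) continuous_on_eq_continuous_at by blast
  then obtain e1 where e1: "e1 > 0" "\<And>q. dist q (x0,s0) < e1 \<Longrightarrow> dist (pd1 K q) c < norm c / 2"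
    using c unfolding continuous_at_eps_delta c_def by (metis zero_less_norm_iff half_gt_zero)
  define e where "e = min r (e1/3)"
  have e: "e > 0" "e \<le> r" "e \<le> e1/3" using r e1 by (auto simp: e_def)
  have "isCont (\<lambda>s. K (x0,s)) s0"
    using hol2_D2[OF K(1-3)] by (rule DERIV_isCont)
  then obtain d1 where d1: "d1 > 0" "\<And>s. dist s s0 < d1 \<Longrightarrow> dist (K (x0,s)) (K (x0,s0)) < norm c * e / 4"
    using c e(1) unfolding continuous_at_eps_delta by (metis zero_less_norm_iff mult_pos_pos zero_less_divide_iff zero_less_numeral)
  define d where "d = min d1 e"
  have d: "d > 0" "d \<le> e" "d \<le> d1" using e d1 by (auto simp: d_def)
  have inS: "(x,s) \<in> S" if "x \<in> cball x0 e" "s \<in> ball s0 d" for x s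
    using that r e d by (auto simp: subset_iff)
  define N where "N s x = x - K (x,s) / c" for s x
  have lip: "norm (N s x - N s y) \<le> 1/2 * norm (x - y)" if s: "s \<in> ball s0 d" and xy: "x \<in> cball x0 e" "y \<in> cball x0 e" for s x y
  proof (rule field_differentiable_bound[OF _ _ _ xy, where f' = "\<lambda>x. 1 - pd1 K (x,s) / c"])
    fix z assume z: "z \<in> cball x0 e"
    have "(N s has_field_derivative 1 - pd1 K (z,s) / c) (at z)"
      unfolding N_def[abs_def] by (intro derivative_intros DERIV_cdivide hol2_D1[OF K(1,2)] inS z s)
    then show "(N s has_field_derivative 1 - pd1 K (z,s) / c) (at z within cball x0 e)"
      by (rule has_field_derivative_at_within)
    have "dist (z,s) (x0,s0) \<le> dist z x0 + dist s s0"
      unfolding dist_Pair_Pair using sqrt_sum_squares_le_sum[of "dist z x0" "dist s s0"] by simp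
    also have "\<dots> < e1" using z s e d by (auto simp: dist_commute)
    finally have "norm (pd1 K (z,s) - c) < norm c / 2" using e1(2)[of "(z,s)"] by (simp add: dist_norm)
    moreover have "norm (1 - pd1 K (z,s) / c) = norm (pd1 K (z,s) - c) / norm c"
    proof -
      have "1 - pd1 K (z,s) / c = (c - pd1 K (z,s)) / c" using c by (simp add: diff_divide_distrib)
      then show ?thesis by (simp add: norm_divide norm_minus_commute)
    qed
    ultimately show "norm (1 - pd1 K (z,s) / c) \<le> 1/2" using c by (simp add: divide_le_eq del: norm_divide)
  qed simp
  have N0: "norm (N s x0 - x0) < e / 4" if "s \<in> ball s0 d" for s
  proof -
    have "norm (K (x0,s)) < norm c * e / 4" using d1(2)[of s] that d K(4) by (simp add: dist_commute)
    then show ?thesis using c by (simp add: N_def norm_divide field_simps)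
  qed
  \<comment> \<open>Half of the radius comes from the contraction and a quarter from
    \<open>N0\<close>; the strict bound puts the fixed point inside the open ball.\<close>
  have Nball: "norm (N s x - x0) < 3/4 * e" if "s \<in> ball s0 d" "x \<in> cball x0 e" for s x
  proof -
    have "norm (N s x - x0) \<le> norm (N s x - N s x0) + norm (N s x0 - x0)"
      using norm_triangle_ineq[of "N s x - N s x0" "N s x0 - x0"] by simp
    then show ?thesis using lip[OF that(1,2), of x0] N0[OF that(1)] that(2) e(1) by (simp add: dist_norm norm_minus_commute)
  qed
  have "\<exists>!x. x \<in> cball x0 e \<and> N s x = x" if s: "s \<in> ball s0 d" for s
  proof -
    have "\<exists>!x\<in>cball x0 e. N s x = x"
    proof (rule Banach_fix[of _ "1/2"])
      show "complete (cball x0 e)" by (simp add: complete_eq_closed)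
      show "cball x0 e \<noteq> {}" using e by simp
      show "N s ` cball x0 e \<subseteq> cball x0 e"
      proof safe
        fix x assume "x \<in> cball x0 e"
        then have "norm (N s x - x0) < 3/4 * e" using Nball[OF s] by blast
        then show "N s x \<in> cball x0 e" using e(1) by (simp add: dist_norm norm_minus_commute)
      qed
      show "dist (N s x) (N s y) \<le> 1/2 * dist x y" if "x \<in> cball x0 e" "y \<in> cball x0 e" for x y
        using lip[OF s that] by (simp add: dist_norm)
    qed auto
    then show ?thesis by blast
  qed
  then obtain l where l: "\<And>s. s \<in> ball s0 d \<Longrightarrow> l s \<in> cball x0 e \<and> N s (l s) = l s"
    and uniq: "\<And>s x. s \<in> ball s0 d \<Longrightarrow> x \<in> cball x0 e \<Longrightarrow> N s x = x \<Longrightarrow> x = l s"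
    by metis
  have fix_iff: "N s x = x \<longleftrightarrow> K (x,s) = 0" for s x using c by (simp add: N_def)
  have l_ball: "l s \<in> ball x0 e" if "s \<in> ball s0 d" for s
  proof -
    have "norm (l s - x0) < 3/4 * e" using Nball[OF that, of "l s"] l[OF that] by simp
    then show ?thesis using e(1) by (simp add: dist_norm norm_minus_commute)
  qed
  \<comment> \<open>Existence of the fixed point says nothing about its dependence on
    \<open>s\<close>. The iterates start at the constant \<open>x0\<close> and are holomorphic in
    \<open>s\<close>, and they converge uniformly.\<close>
  define F where "F n s = ((N s) ^^ n) x0" for n s
  have F_mem: "F n s \<in> cball x0 e" if s: "s \<in> ball s0 d" for n s
  proof (induction n)
    case (Suc n)
    then have "norm (N s (F n s) - x0) < 3/4 * e" by (rule Nball[OF s])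
    then show ?case using e(1) by (simp add: F_def dist_norm norm_minus_commute)
  qed (use e in \<open>simp add: F_def\<close>)
  have F_hol: "F n holomorphic_on ball s0 d" for n
  proof (induction n)
    case (Suc n)
    have "(\<lambda>s. K (F n s, s)) holomorphic_on ball s0 d"
      by (rule hol2_curve[OF K(1)]) (use Suc inS F_mem in \<open>auto intro: holomorphic_intros\<close>)
    then have "(\<lambda>s. F n s - K (F n s, s) / c) holomorphic_on ball s0 d"
      using Suc c by (intro holomorphic_intros) auto
    then show ?case by (simp add: F_def[abs_def] N_def)
  qed (simp add: F_def[abs_def])
  have F_conv: "norm (F n s - l s) \<le> (1/2)^n * e" if s: "s \<in> ball s0 d" for n s
  proof (induction n)
    case 0 then show ?case using l[OF s] by (simp add: F_def dist_norm)
  next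
    case (Suc n)
    have "norm (F (Suc n) s - l s) = norm (N s (F n s) - N s (l s))"
      using l[OF s] by (simp add: F_def)
    also have "\<dots> \<le> 1/2 * norm (F n s - l s)" using lip[OF s F_mem[OF s]] l[OF s] by blast
    finally show ?case using Suc by simp
  qed
  have ul: "uniform_limit (ball s0 d) F l sequentially"
  proof (rule uniform_limitI)
    fix \<epsilon> :: real assume "\<epsilon> > 0"
    have "(\<lambda>n. (1/2)^n * e) \<longlonglongrightarrow> 0 * e"
      by (intro tendsto_mult LIMSEQ_realpow_zero tendsto_const) auto
    then have "\<forall>\<^sub>F n in sequentially. (1/2)^n * e < \<epsilon>"
      using order_tendstoD(2) \<open>\<epsilon> > 0\<close> by fastforce
    then show "\<forall>\<^sub>F n in sequentially. \<forall>x\<in>ball s0 d. dist (F n x) (l x) < \<epsilon>"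
    proof eventually_elim
      case (elim n)
      then show ?case using F_conv[of _ n] unfolding dist_norm by (blast intro: le_less_trans)
    qed
  qed
  have "l holomorphic_on ball s0 d"
  proof (rule holomorphic_uniform_sequence[OF open_ball F_hol])
    fix x assume "x \<in> ball s0 d"
    then obtain \<delta> where "\<delta> > 0" "cball x \<delta> \<subseteq> ball s0 d" using open_contains_cball_eq[OF open_ball] by blast
    then show "\<exists>\<delta>>0. cball x \<delta> \<subseteq> ball s0 d \<and> uniform_limit (cball x \<delta>) F l sequentially"
      using uniform_limit_on_subset[OF ul] by blast
  qed
  moreover have "l s0 = x0"
    using uniq[of s0 x0] fix_iff K(4) d e by simp
  moreover have "ball x0 e \<times> ball s0 d \<subseteq> S" using inS by auto
  ultimately show ?thesis
  proof (intro that[of d e l])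
    have "K (x,s) = 0 \<longleftrightarrow> x = l s" if "s \<in> ball s0 d" "x \<in> ball x0 e" for x s
      using uniq[OF that(1), of x] l[OF that(1)] fix_iff that(2) by (metis ball_subset_cball subsetD)
    then show "\<forall>s\<in>ball s0 d. \<forall>x\<in>ball x0 e. K (x,s) = 0 \<longleftrightarrow> x = l s" by blast
    show "\<forall>s\<in>ball s0 d. l s \<in> ball x0 e" using l_ball by blast
  qed (use d e in auto)
qed

lemma pd_swap:
  "pd1 (\<lambda>q. H (snd q, fst q)) = (\<lambda>q. pd2 H (snd q, fst q))"
  "pd2 (\<lambda>q. H (snd q, fst q)) = (\<lambda>q. pd1 H (snd q, fst q))"
  by (auto simp: pd1_def pd2_def fun_eq_iff)

lemma hol2_implicit2:
  assumes K: "hol2 S K" "open S" "(x0,s0) \<in> S" "K (x0,s0) = 0" "pd2 K (x0,s0) \<noteq> 0"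
  obtains d e l where "d > 0" "e > 0" "l holomorphic_on ball x0 d" "l x0 = s0"
    "\<forall>x\<in>ball x0 d. l x \<in> ball s0 e" "ball x0 d \<times> ball s0 e \<subseteq> S"
    "\<forall>x\<in>ball x0 d. \<forall>s\<in>ball s0 e. K (x,s) = 0 \<longleftrightarrow> s = l x"
proof -
  obtain d e l where *: "d > 0" "e > 0" "l holomorphic_on ball x0 d" "l x0 = s0"
    "\<forall>x\<in>ball x0 d. l x \<in> ball s0 e" "ball s0 e \<times> ball x0 d \<subseteq> prod.swap -` S"
    "\<forall>x\<in>ball x0 d. \<forall>s\<in>ball s0 e. K (snd (s,x), fst (s,x)) = 0 \<longleftrightarrow> s = l x"
    by (rule hol2_implicit1[OF hol2_swap[OF K(1)] open_swap_vimage[OF K(2)], of s0 x0])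
      (use K(3-5) in \<open>auto simp: pd_swap\<close>)
  show ?thesis
    by (rule that[OF *(1-5)]) (use *(6,7) in auto)
qed

section \<open>Division by a variable and the blow-up of a node\<close>

lemma
  assumes "hol2 S f" "hol2 S g" "open S" "q \<in> S"
  shows pd1_add: "pd1 (\<lambda>q. f q + g q) q = pd1 f q + pd1 g q"
    and pd1_mult: "pd1 (\<lambda>q. f q * g q) q = pd1 f q * g q + f q * pd1 g q"
    and pd2_add: "pd2 (\<lambda>q. f q + g q) q = pd2 f q + pd2 g q"
    and pd2_mult: "pd2 (\<lambda>q. f q * g q) q = pd2 f q * g q + f q * pd2 g q"
    and pd1_diff: "pd1 (\<lambda>q. f q - g q) q = pd1 f q - pd1 g q"
    and pd2_diff: "pd2 (\<lambda>q. f q - g q) q = pd2 f q - pd2 g q"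
proof -
  note a = hol2_D1[OF assms(1,3), of "fst q" "snd q", simplified, OF assms(4)]
    hol2_D1[OF assms(2,3), of "fst q" "snd q", simplified, OF assms(4)]
  note b = hol2_D2[OF assms(1,3), of "fst q" "snd q", simplified, OF assms(4)]
    hol2_D2[OF assms(2,3), of "fst q" "snd q", simplified, OF assms(4)]
  show "pd1 (\<lambda>q. f q + g q) q = pd1 f q + pd1 g q"
    by (subst pd1_def) (rule DERIV_imp_deriv[OF DERIV_add[OF a]])
  show "pd2 (\<lambda>q. f q + g q) q = pd2 f q + pd2 g q"
    by (subst pd2_def) (rule DERIV_imp_deriv[OF DERIV_add[OF b]])
  show "pd1 (\<lambda>q. f q - g q) q = pd1 f q - pd1 g q"
    by (subst pd1_def) (rule DERIV_imp_deriv[OF DERIV_diff[OF a]])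
  show "pd2 (\<lambda>q. f q - g q) q = pd2 f q - pd2 g q"
    by (subst pd2_def) (rule DERIV_imp_deriv[OF DERIV_diff[OF b]])
  show "pd1 (\<lambda>q. f q * g q) q = pd1 f q * g q + f q * pd1 g q"
    using DERIV_imp_deriv[OF DERIV_mult[OF a]] by (subst pd1_def) (simp add: algebra_simps)
  show "pd2 (\<lambda>q. f q * g q) q = pd2 f q * g q + f q * pd2 g q"
    using DERIV_imp_deriv[OF DERIV_mult[OF b]] by (subst pd2_def) (simp add: algebra_simps)
qed

lemma pd_fst_snd [simp]:
  "pd1 fst q = 1" "pd2 fst q = 0" "pd1 snd q = 0" "pd2 snd q = 1"
  by (auto simp: pd1_def pd2_def)

text \<open>Hadamard's lemma: the quotient is \<open>\<integral> pd1 k (u * \<sigma>, T) du\<close>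
  over \<open>{0..1}\<close>, the disc being star-shaped about 0. The values at
  \<open>\<sigma> = 0\<close> are recorded up to first order because the blow-up divides
  twice.\<close>

lemma hol2_divide_fst:
  assumes k: "hol2 (ball 0 a \<times> B) k" and "open B" "a > 0" and k0: "\<And>T. T \<in> B \<Longrightarrow> k (0,T) = 0"
  obtains Q where "hol2 (ball 0 a \<times> B) Q" "\<And>q. q \<in> ball 0 a \<times> B \<Longrightarrow> k q = fst q * Q q"
    "\<And>T. T \<in> B \<Longrightarrow> Q (0,T) = pd1 k (0,T)" "\<And>T. T \<in> B \<Longrightarrow> pd1 Q (0,T) = pd1 (pd1 k) (0,T) / 2"
proof -
  let ?D = "ball (0::complex) a \<times> B"
  have oD: "open ?D" using \<open>open B\<close> by (auto intro: open_Times)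
  have p1: "hol2 ?D (pd1 k)" by (intro hol2_pd1 k oD)
  have star: "(of_real u * \<sigma>, T) \<in> ?D" if "(\<sigma>,T) \<in> ?D" "u \<in> {0..1}" for u :: real and \<sigma> T :: complex
  proof -
    have "norm (of_real u * \<sigma>) \<le> 1 * norm \<sigma>"
      unfolding norm_mult using that(2) by (intro mult_right_mono) auto
    then show ?thesis using that by auto
  qed
  define Q where "Q q = integral {0..1} (\<lambda>u. pd1 k (of_real u * fst q, snd q))" for q
  have Q: "hol2 ?D Q" unfolding Q_def
  proof (rule hol2_integral)
    show "continuous_on (?D \<times> {0..1}) (\<lambda>(q, u). pd1 k (of_real u * fst q, snd q))"
      unfolding split_beta
      by (rule continuous_on_compose2[OF hol2_cont[OF p1]]) (use star in \<open>auto intro!: continuous_intros\<close>)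
    show "hol2 ?D (\<lambda>q. pd1 k (of_real u * fst q, snd q))" if "u \<in> {0..1}" for u
      by (rule hol2_compose2[OF p1]) (use star that in \<open>auto intro!: hol2_fst hol2_snd hol2_mult hol2_const\<close>)
  qed
  have kQ: "k (\<sigma>,T) = \<sigma> * Q (\<sigma>,T)" if m: "(\<sigma>,T) \<in> ?D" for \<sigma> T
  proof -
    have "((\<lambda>u. \<sigma> * pd1 k (of_real u * \<sigma>, T)) has_integral k (of_real 1 * \<sigma>, T) - k (of_real 0 * \<sigma>, T)) {0..1}"
    proof (rule fundamental_theorem_of_calculus)
      fix u :: real assume "u \<in> {0..1}"
      have "((\<lambda>w. k (w * \<sigma>, T)) has_field_derivative pd1 k (of_real u * \<sigma>, T) * (1 * \<sigma>)) (at (of_real u))"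
        by (rule DERIV_chain2[where f = "\<lambda>w. k (w, T)" and g = "\<lambda>w. w * \<sigma>", OF hol2_D1[OF k oD star[OF m \<open>u \<in> {0..1}\<close>]]]) (auto intro!: derivative_eq_intros)
      then have "((\<lambda>u. k (of_real u * \<sigma>, T)) has_vector_derivative pd1 k (of_real u * \<sigma>, T) * (1 * \<sigma>)) (at u within {0..1})"
        by (rule has_vector_derivative_real_field)
      then show "((\<lambda>u. k (of_real u * \<sigma>, T)) has_vector_derivative \<sigma> * pd1 k (of_real u * \<sigma>, T)) (at u within {0..1})"
        by (simp add: mult.commute)
    qed auto
    then have "integral {0..1} (\<lambda>u. \<sigma> * pd1 k (of_real u * \<sigma>, T)) = k (\<sigma>, T)"
      using k0[of T] m by (auto dest: integral_unique)
    then show ?thesis by (simp add: Q_def)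
  qed
  have Q1: "hol2 ?D (pd1 Q)" by (intro hol2_pd1 Q oD)
  have p1k: "pd1 k q = Q q + fst q * pd1 Q q" if "q \<in> ?D" for q
  proof -
    have "pd1 k q = pd1 (\<lambda>q. fst q * Q q) q"
      by (rule pd1_cong[OF oD that]) (use kQ in auto)
    then show ?thesis using pd1_mult[OF hol2_fst Q oD that] by simp
  qed
  have p11k: "pd1 (pd1 k) q = pd1 Q q + (pd1 Q q + fst q * pd1 (pd1 Q) q)" if "q \<in> ?D" for q
  proof -
    have "pd1 (pd1 k) q = pd1 (\<lambda>q. Q q + fst q * pd1 Q q) q"
      by (rule pd1_cong[OF oD that]) (use p1k in auto)
    then show ?thesis
      using pd1_add[OF Q hol2_mult[OF hol2_fst Q1] oD that] pd1_mult[OF hol2_fst Q1 oD that] by simp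
  qed
  show ?thesis
  proof (rule that[OF Q])
    show "k q = fst q * Q q" if "q \<in> ?D" for q using kQ[of "fst q" "snd q"] that by simp
    show "Q (0,T) = pd1 k (0,T)" if "T \<in> B" for T using p1k[of "(0,T)"] that \<open>a > 0\<close> by simp
    show "pd1 Q (0,T) = pd1 (pd1 k) (0,T) / 2" if "T \<in> B" for T using p11k[of "(0,T)"] that \<open>a > 0\<close> by simp
  qed
qed


text \<open>Blowing up \<open>X = x0 + \<sigma> T\<close>, \<open>Y = s0 + \<sigma>\<close> turns the zeros of \<open>K\<close> into those of \<open>K / \<sigma>\<^sup>2\<close>, which
  at \<open>\<sigma> = 0\<close> is a quadratic polynomial in \<open>T\<close> with simple roots.\<close>

lemma hol2_node:
  assumes K: "hol2 S K" "open S" "(x0,s0) \<in> S" "K (x0,s0) = 0" "pd1 K (x0,s0) = 0" "pd2 K (x0,s0) = 0"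
    and disc: "(pd1 (pd2 K) (x0,s0))\<^sup>2 \<noteq> pd1 (pd1 K) (x0,s0) * pd2 (pd2 K) (x0,s0)"
    and X: "X \<longlonglongrightarrow> x0" and Y: "Y \<longlonglongrightarrow> s0" and ne: "\<And>n::nat. Y n \<noteq> s0"
    and le: "\<And>n. norm (X n - x0) \<le> norm (Y n - s0)" and zero: "\<And>n. K (X n, Y n) = 0"
  obtains r l k where "r > 0" "l holomorphic_on ball s0 r" "l s0 = x0" "strict_mono (k :: nat \<Rightarrow> nat)"
    "\<forall>n. Y (k n) \<in> ball s0 r \<and> X (k n) = l (Y (k n))"
    "\<forall>s\<in>ball s0 r. (l s, s) \<in> S \<and> K (l s, s) = 0"
proof -
  obtain \<rho> where \<rho>: "\<rho> > 0" "cball x0 \<rho> \<times> cball s0 \<rho> \<subseteq> S"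
    using polydisc_in_open[OF K(2,3)] by blast
  define a where "a = \<rho> / 2"
  have a: "a > 0" using \<rho> by (simp add: a_def)
  \<comment> \<open>The quotients \<open>T n\<close> below lie in the closed unit disc, so a limit
    of them is interior to \<open>B\<close>. The radius 2 together with
    \<open>a = \<rho> / 2\<close> keeps \<open>\<sigma> * T\<close> within
    \<open>\<rho>\<close>.\<close>
  define B where "B = ball (0::complex) 2"
  let ?D = "ball (0::complex) a \<times> B"
  have oB: "open B" and oD: "open ?D" by (auto simp: B_def intro: open_Times)
  have inS: "(x0 + \<sigma> * T, s0 + \<sigma>) \<in> S" if "(\<sigma>,T) \<in> ?D" for \<sigma> T
  proof -
    have "norm (\<sigma> * T) \<le> a * 2" unfolding norm_mult
      by (rule mult_mono) (use that a in \<open>auto simp: B_def\<close>)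
    then have "x0 + \<sigma> * T \<in> cball x0 \<rho>" by (simp add: dist_norm a_def)
    moreover have "s0 + \<sigma> \<in> cball s0 \<rho>" using that a by (auto simp: dist_norm a_def)
    ultimately show ?thesis using \<rho> by blast
  qed
  have blow: "hol2 ?D (\<lambda>q. H (x0 + fst q * snd q, s0 + fst q))" if "hol2 S H" for H
    by (rule hol2_compose2[OF that]) (use inS in \<open>auto intro!: hol2_fst hol2_snd hol2_add hol2_mult hol2_const\<close>)
  have chain: "pd1 (\<lambda>q. H (x0 + fst q * snd q, s0 + fst q)) q
      = snd q * pd1 H (x0 + fst q * snd q, s0 + fst q) + pd2 H (x0 + fst q * snd q, s0 + fst q)"
    if "hol2 S H" "q \<in> ?D" for H q
  proof -
    have "((\<lambda>w. H (x0 + w * snd q, s0 + w)) has_field_derivative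
        pd1 H (x0 + fst q * snd q, s0 + fst q) * snd q + pd2 H (x0 + fst q * snd q, s0 + fst q) * 1) (at (fst q))"
      by (rule hol2_chain[OF that(1) K(2)]) (use inS[of "fst q" "snd q"] that(2) in \<open>auto intro!: derivative_eq_intros\<close>)
    then show ?thesis by (subst pd1_def) (simp add: DERIV_imp_deriv algebra_simps)
  qed
  define k where "k q = K (x0 + fst q * snd q, s0 + fst q)" for q
  have k: "hol2 ?D k" unfolding k_def[abs_def] by (rule blow[OF K(1)])
  have K1: "hol2 S (pd1 K)" and K2: "hol2 S (pd2 K)" by (intro hol2_pd1 hol2_pd2 K)+
  have p1k: "pd1 k q = snd q * pd1 K (x0 + fst q * snd q, s0 + fst q) + pd2 K (x0 + fst q * snd q, s0 + fst q)"
    if "q \<in> ?D" for q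
    unfolding k_def[abs_def] by (rule chain[OF K(1) that])
  define q11 q12 q22 where "q11 = pd1 (pd1 K) (x0,s0)" and "q12 = pd1 (pd2 K) (x0,s0)" and "q22 = pd2 (pd2 K) (x0,s0)"
  have p11k: "pd1 (pd1 k) (0,T) = q11 * T\<^sup>2 + 2 * q12 * T + q22" if "T \<in> B" for T
  proof -
    have m: "(0,T) \<in> ?D" using that a by simp
    have "pd1 (pd1 k) (0,T) = pd1 (\<lambda>q. snd q * pd1 K (x0 + fst q * snd q, s0 + fst q) + pd2 K (x0 + fst q * snd q, s0 + fst q)) (0,T)"
      by (rule pd1_cong[OF oD m]) (use p1k in auto)
    also have "\<dots> = T * (T * pd1 (pd1 K) (x0, s0) + pd2 (pd1 K) (x0, s0)) + (T * pd1 (pd2 K) (x0, s0) + pd2 (pd2 K) (x0, s0))"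
      using pd1_add[OF hol2_mult[OF hol2_snd blow[OF K1]] blow[OF K2] oD m]
        pd1_mult[OF hol2_snd blow[OF K1] oD m] chain[OF K1 m] chain[OF K2 m] by simp
    also have "\<dots> = q11 * T\<^sup>2 + 2 * q12 * T + q22"
      using pd_commute[OF K(1-3)] by (simp add: q11_def q12_def q22_def power2_eq_square algebra_simps)
    finally show ?thesis .
  qed
  obtain Q1 where Q1: "hol2 ?D Q1" "\<And>q. q \<in> ?D \<Longrightarrow> k q = fst q * Q1 q"
    "\<And>T. T \<in> B \<Longrightarrow> Q1 (0,T) = pd1 k (0,T)" "\<And>T. T \<in> B \<Longrightarrow> pd1 Q1 (0,T) = pd1 (pd1 k) (0,T) / 2"
    by (rule hol2_divide_fst[OF k oB a]) (use K(4) in \<open>auto simp: k_def\<close>)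
  have Q10: "Q1 (0,T) = 0" if "T \<in> B" for T
    using Q1(3)[OF that] p1k[of "(0,T)"] that a K(5,6) by simp
  obtain Q where Q: "hol2 ?D Q" "\<And>q. q \<in> ?D \<Longrightarrow> Q1 q = fst q * Q q" "\<And>T. T \<in> B \<Longrightarrow> Q (0,T) = pd1 Q1 (0,T)"
    "\<And>T. T \<in> B \<Longrightarrow> pd1 Q (0,T) = pd1 (pd1 Q1) (0,T) / 2"
    using hol2_divide_fst[OF Q1(1) oB a Q10] by (metis (no_types, lifting))
  have kQ: "k q = (fst q)\<^sup>2 * Q q" if "q \<in> ?D" for q
    using Q1(2)[OF that] Q(2)[OF that] by (simp add: power2_eq_square)
  have Q0: "Q (0,T) = (q11 * T\<^sup>2 + 2 * q12 * T + q22) / 2" if "T \<in> B" for T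
    using Q(3)[OF that] Q1(4)[OF that] p11k[OF that] by simp
  have p2Q: "pd2 Q (0,T) = q11 * T + q12" if "T \<in> B" for T
  proof -
    have "((\<lambda>T. (q11 * T\<^sup>2 + 2 * q12 * T + q22) / 2) has_field_derivative (q11 * T + q12)) (at T)"
      by (auto intro!: derivative_eq_intros simp: power2_eq_square)
    moreover have "((\<lambda>T. (q11 * T\<^sup>2 + 2 * q12 * T + q22) / 2) has_field_derivative (q11 * T + q12)) (at T)
        \<longleftrightarrow> ((\<lambda>T. Q (0,T)) has_field_derivative (q11 * T + q12)) (at T)"
    proof (rule DERIV_cong_ev[OF refl _ refl])
      have "\<forall>\<^sub>F T in nhds T. T \<in> B" by (rule eventually_nhds_in_open[OF oB that])
      then show "\<forall>\<^sub>F T in nhds T. (q11 * T\<^sup>2 + 2 * q12 * T + q22) / 2 = Q (0,T)"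
        by eventually_elim (simp add: Q0)
    qed
    ultimately have "((\<lambda>T. Q (0,T)) has_field_derivative (q11 * T + q12)) (at T)" by simp
    then show ?thesis by (simp add: pd2_def DERIV_imp_deriv)
  qed
  \<comment> \<open>The slope of the chord from the centre; hypothesis \<open>le\<close> bounds it
    by 1, so a subsequence converges to a tangent direction \<open>T0\<close>.\<close>
  define T where "T n = (X n - x0) / (Y n - s0)" for n
  have TX: "X n = x0 + (Y n - s0) * T n" for n using ne[of n] by (simp add: T_def)
  have Tb: "T n \<in> cball 0 1" for n
    using le[of n] ne[of n] by (simp add: T_def norm_divide divide_le_eq)
  obtain T0 k1 where T0: "T0 \<in> cball 0 1" "strict_mono k1" "(T \<circ> k1) \<longlonglongrightarrow> T0"
    using compact_imp_seq_compact[OF compact_cball, of 0 1] Tb unfolding seq_compact_def by blast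
  have T0B: "T0 \<in> B" using T0(1) by (simp add: B_def)
  have Yk: "(\<lambda>n. Y (k1 n) - s0) \<longlonglongrightarrow> 0"
    using tendsto_diff[OF LIMSEQ_subseq_LIMSEQ[OF Y T0(2)] tendsto_const[of s0]] by (simp add: o_def)
  have YT: "(\<lambda>n. (Y (k1 n) - s0, T (k1 n))) \<longlonglongrightarrow> (0,T0)"
    using T0(3) by (intro tendsto_Pair Yk) (simp add: o_def)
  have TBn: "T n \<in> B" for n using Tb[of n] by (simp add: B_def)
  have evD: "\<forall>\<^sub>F n in sequentially. (Y (k1 n) - s0, T (k1 n)) \<in> ?D"
    by (rule topological_tendstoD[OF YT oD]) (use a T0B in auto)
  have Qz: "Q (Y n - s0, T n) = 0" if "(Y n - s0, T n) \<in> ?D" for n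
    using kQ[OF that] zero[of n] ne[of n] TX[of n] by (simp add: k_def algebra_simps)
  have "isCont Q (0,T0)"
    using hol2_cont[OF Q(1), unfolded continuous_on_eq_continuous_at[OF oD]] a T0B by auto
  then have "(\<lambda>n. Q (Y (k1 n) - s0, T (k1 n))) \<longlonglongrightarrow> Q (0,T0)"
    by (rule isCont_tendsto_compose[OF _ YT])
  moreover have "(\<lambda>n. Q (Y (k1 n) - s0, T (k1 n))) \<longlonglongrightarrow> 0"
    by (rule tendsto_eventually) (use evD in \<open>eventually_elim, use Qz in blast\<close>)
  ultimately have QT0: "Q (0,T0) = 0" using LIMSEQ_unique by blast
  have "q11 * T0\<^sup>2 + 2 * q12 * T0 + q22 = 0" using QT0 Q0[OF T0B] by simp
  \<comment> \<open>Completing the square: at a root of the quadratic the squared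
    \<open>T\<close>-derivative of \<open>Q\<close> is the discriminant, so \<open>disc\<close>
    makes the root simple.\<close>
  then have "(q11 * T0 + q12)\<^sup>2 = q12\<^sup>2 - q11 * q22" by algebra
  then have p2n: "pd2 Q (0,T0) \<noteq> 0" using p2Q[OF T0B] disc by (auto simp: q11_def q12_def q22_def)
  have 0: "(0,T0) \<in> ?D" using a T0B by simp
  obtain d e \<theta> where \<theta>: "d > 0" "e > 0" "\<theta> holomorphic_on ball 0 d" "\<theta> 0 = T0"
    "\<forall>x\<in>ball 0 d. \<theta> x \<in> ball T0 e" "ball 0 d \<times> ball T0 e \<subseteq> ?D"
    "\<forall>x\<in>ball 0 d. \<forall>s\<in>ball T0 e. Q (x,s) = 0 \<longleftrightarrow> s = \<theta> x"
    by (rule hol2_implicit2[OF Q(1) oD 0 QT0 p2n]) (rule that; assumption)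
  define l where "l s = x0 + (s - s0) * \<theta> (s - s0)" for s
  have sh: "s - s0 \<in> ball 0 d \<longleftrightarrow> s \<in> ball s0 d" for s by (simp add: dist_norm norm_minus_commute)
  have "\<forall>\<^sub>F n in sequentially. (Y (k1 n) - s0, T (k1 n)) \<in> ball 0 d \<times> ball T0 e"
    by (rule topological_tendstoD[OF YT]) (use \<theta> in \<open>auto intro: open_Times\<close>)
  then obtain N where N: "\<And>n. n \<ge> N \<Longrightarrow> (Y (k1 n) - s0, T (k1 n)) \<in> ball 0 d \<times> ball T0 e"
    by (auto simp: eventually_sequentially)
  show ?thesis
  proof (rule that[of d l "\<lambda>n. k1 (n + N)"])
    have "(\<theta> \<circ> (\<lambda>s. s - s0)) holomorphic_on ball s0 d"
      by (rule holomorphic_on_compose_gen[OF _ \<theta>(3)]) (use sh in \<open>auto intro!: holomorphic_intros\<close>)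
    then show "l holomorphic_on ball s0 d"
      unfolding l_def[abs_def] by (auto intro!: holomorphic_intros simp: o_def)
    show "strict_mono (\<lambda>n. k1 (n + N))" using T0(2) by (auto simp: strict_mono_def)
    show "\<forall>n. Y (k1 (n + N)) \<in> ball s0 d \<and> X (k1 (n + N)) = l (Y (k1 (n + N)))"
    proof
      fix n
      have m: "Y (k1 (n + N)) - s0 \<in> ball 0 d" "T (k1 (n + N)) \<in> ball T0 e" using N[of "n + N"] by auto
      then have "Q (Y (k1 (n + N)) - s0, T (k1 (n + N))) = 0" using \<theta>(6) by (intro Qz) blast
      then have "T (k1 (n + N)) = \<theta> (Y (k1 (n + N)) - s0)" using \<theta>(7) m by blast
      then show "Y (k1 (n + N)) \<in> ball s0 d \<and> X (k1 (n + N)) = l (Y (k1 (n + N)))"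
        using TX[of "k1 (n + N)"] m(1) sh by (simp add: l_def)
    qed
    show "\<forall>s\<in>ball s0 d. (l s, s) \<in> S \<and> K (l s, s) = 0"
    proof
      fix s assume s: "s \<in> ball s0 d"
      then have s': "s - s0 \<in> ball 0 d" using sh by simp
      then have D: "(s - s0, \<theta> (s - s0)) \<in> ?D" using \<theta>(5,6) by blast
      have "Q (s - s0, \<theta> (s - s0)) = 0" using \<theta>(5,7) s' by blast
      then have "k (s - s0, \<theta> (s - s0)) = 0" using kQ[OF D] by simp
      then show "(l s, s) \<in> S \<and> K (l s, s) = 0" using inS[OF D] by (simp add: k_def l_def)
    qed
  qed (use \<theta> in \<open>auto simp: l_def\<close>)
qed

section \<open>The complexified initial value problem\<close>

text \<open>The local power series glue: a disc with real centre contains the real parts of its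
  points, so two overlapping discs share a real interval on which both series equal
  \<open>g\<close>, and their intersection is convex.\<close>

lemma real_analytic_on_holomorphic_extension:
  assumes "real_analytic_on g I"
  obtains N h where "open N" "h holomorphic_on N" "\<forall>x\<in>I. complex_of_real x \<in> N \<and> h (of_real x) = of_real (g x)"
proof -
  have "\<forall>x\<in>I. \<exists>r a. r > 0 \<and> (\<forall>y. \<bar>y - x\<bar> < r \<longrightarrow> (\<lambda>n. a n * (y - x) ^ n) sums g y)"
    using assms unfolding real_analytic_on_def by blast
  then obtain r a where ra: "\<And>x. x \<in> I \<Longrightarrow> r x > (0::real)"
    "\<And>x y. x \<in> I \<Longrightarrow> \<bar>y - x\<bar> < r x \<Longrightarrow> (\<lambda>n. a x n * (y - x) ^ n) sums g y"
    by metis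
  define P where "P x w = (\<Sum>n. complex_of_real (a x n) * (w - of_real x) ^ n)" for x w
  let ?B = "\<lambda>x. ball (complex_of_real x) (r x)"
  have P_sums: "(\<lambda>n. complex_of_real (a x n) * (w - of_real x) ^ n) sums P x w" if x: "x \<in> I" and w: "w \<in> ?B x" for x w
  proof -
    obtain \<rho> where \<rho>: "norm (w - of_real x) < \<rho>" "\<rho> < r x"
      using w dense by (auto simp: dist_norm norm_minus_commute)
    have "0 < \<rho>" using \<rho>(1) norm_ge_zero le_less_trans by blast
    then have "(\<lambda>n. a x n * \<rho> ^ n) sums g (x + \<rho>)" using ra(2)[OF x, of "x + \<rho>"] \<rho> by simp
    then have "summable (\<lambda>n. complex_of_real (a x n * \<rho> ^ n))"
      using summable_of_real sums_summable by blast
    then have "summable (\<lambda>n. complex_of_real (a x n) * (of_real \<rho>) ^ n)" by simp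
    from powser_inside[OF this, of "w - of_real x"] show ?thesis
      using \<rho> \<open>0 < \<rho>\<close> by (simp add: P_def summable_sums)
  qed
  have P_hol: "P x holomorphic_on ?B x" if "x \<in> I" for x
    using P_sums[OF that] by (rule power_series_holomorphic)
  have P_real: "P x (of_real y) = of_real (g y)" if x: "x \<in> I" and y: "\<bar>y - x\<bar> < r x" for x y
  proof -
    have "(\<lambda>n. complex_of_real (a x n * (y - x) ^ n)) sums of_real (g y)"
      using ra(2)[OF x y] sums_of_real by blast
    moreover have "of_real y \<in> ?B x" using y by (simp add: dist_of_real dist_real_def abs_minus_commute)
    ultimately show ?thesis using P_sums[OF x, of "of_real y"] sums_unique2 by fastforce
  qed
  have P_eq: "P x w = P x' w" if x: "x \<in> I" "x' \<in> I" and w: "w \<in> ?B x" "w \<in> ?B x'" for x x' w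
  proof -
    let ?S = "?B x \<inter> ?B x'"
    have Re_in: "complex_of_real (Re w) \<in> ?B y" if "w \<in> ?B y" for y
      using that abs_Re_le_cmod[of "of_real y - w"] by (simp add: dist_norm of_real_diff[symmetric] del: of_real_diff)
    have "P x w - P x' w = 0"
    proof (rule analytic_continuation[of "\<lambda>w. P x w - P x' w" ?S "of_real ` {t. complex_of_real t \<in> ?S}" "of_real (Re w)"])
      show "(\<lambda>w. P x w - P x' w) holomorphic_on ?S"
        by (intro holomorphic_on_diff holomorphic_on_subset[OF P_hol[OF x(1)]] holomorphic_on_subset[OF P_hol[OF x(2)]]) auto
      show "open ?S" by auto
      show "connected ?S" by (intro convex_connected convex_Int convex_ball)
      show "of_real (Re w) \<in> ?S" using Re_in w by blast
      then obtain e where e: "e > 0" "ball (of_real (Re w)) e \<subseteq> ?S"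
        using \<open>open ?S\<close> open_contains_ball by metis
      show "complex_of_real (Re w) islimpt of_real ` {t. complex_of_real t \<in> ?S}"
        unfolding islimpt_approachable
      proof (intro allI impI)
        fix d :: real assume "d > 0"
        define t where "t = Re w + min d e / 2"
        have "complex_of_real t \<in> ball (of_real (Re w)) e"
          unfolding mem_ball dist_of_real dist_real_def t_def using e \<open>d > 0\<close> by simp
        moreover have "dist (complex_of_real t) (of_real (Re w)) < d"
          unfolding dist_of_real dist_real_def t_def using e \<open>d > 0\<close> by simp
        moreover have "t \<noteq> Re w" using e \<open>d > 0\<close> by (simp add: t_def)
        ultimately have t: "complex_of_real t \<in> ?S" "complex_of_real t \<noteq> of_real (Re w)"
            "dist (complex_of_real t) (of_real (Re w)) < d"
          using e(2) by (auto simp only: subset_iff of_real_eq_iff)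
        show "\<exists>x'\<in>of_real ` {t. complex_of_real t \<in> ?S}. x' \<noteq> of_real (Re w) \<and> dist x' (complex_of_real (Re w)) < d"
          by (rule bexI[of _ "of_real t"], intro conjI t(2,3), intro imageI CollectI t(1))
      qed
      show "P x z - P x' z = 0" if "z \<in> of_real ` {t. complex_of_real t \<in> ?S}" for z
        using that P_real x by (auto simp: dist_of_real dist_real_def abs_minus_commute)
    qed (use w in auto)
    then show ?thesis by simp
  qed
  define N where "N = (\<Union>x\<in>I. ?B x)"
  define h where "h w = P (SOME x. x \<in> I \<and> w \<in> ?B x) w" for w
  have h: "h w = P x w" if "x \<in> I" "w \<in> ?B x" for x w
  proof -
    have "(SOME x. x \<in> I \<and> w \<in> ?B x) \<in> I \<and> w \<in> ?B (SOME x. x \<in> I \<and> w \<in> ?B x)"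
      by (rule someI[of _ x]) (use that in auto)
    then show ?thesis unfolding h_def using P_eq that by blast
  qed
  show ?thesis
  proof (rule that[of N h])
    show "open N" by (auto simp: N_def)
    show "h holomorphic_on N"
      unfolding N_def
    proof (rule holomorphic_on_UN_open)
      show "h holomorphic_on ?B x" if "x \<in> I" for x
        using P_hol[OF that] h[OF that] by (metis (no_types, lifting) holomorphic_cong)
    qed auto
    show "\<forall>x\<in>I. complex_of_real x \<in> N \<and> h (of_real x) = of_real (g x)"
    proof
      fix x assume x: "x \<in> I"
      then have "of_real x \<in> ?B x" using ra(1) by simp
      then show "complex_of_real x \<in> N \<and> h (of_real x) = of_real (g x)"
        using x h[OF x] P_real[OF x, of x] ra(1)[OF x] unfolding N_def by (auto intro!: bexI[of _ x])
    qed
  qed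
qed

text \<open>Moves a variable end point into the integrand. This serves both the continuity in the
  end point and the passage between trajectories of different length.\<close>

lemma integral_rescale:
  fixes f :: "real \<Rightarrow> complex"
  assumes f: "continuous_on {0..1} f" and "\<tau> \<in> {0..1}" "y \<in> {0..1}"
  shows "integral {0..\<tau> * y} f = of_real \<tau> * integral {0..y} (\<lambda>t. f (\<tau> * t))"
proof (cases "\<tau> = 0")
  case False
  then have \<tau>: "\<tau> > 0" using assms by auto
  have "\<tau> * y \<le> 1" using assms by (simp add: mult_le_one)
  then have "continuous_on {0..\<tau> * y} f" by (intro continuous_on_subset[OF f]) auto
  then have "(f has_integral integral {0..\<tau> * y} f) {0..\<tau> * y}"
    using integrable_continuous_interval integrable_integral by blast
  from has_integral_stretch_real[OF this False]
  have "((\<lambda>x. f (\<tau> * x)) has_integral (1 / \<bar>\<tau>\<bar>) *\<^sub>R integral {0..\<tau> * y} f) ((\<lambda>x. x / \<tau>) ` {0..\<tau> * y})" .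
  moreover have "(\<lambda>x. x / \<tau>) ` {0..\<tau> * y} = {0..y}"
    using \<tau> assms by (auto simp: image_iff field_simps intro!: bexI[of _ "\<tau> * _"])
  ultimately have "((\<lambda>x. f (\<tau> * x)) has_integral (1 / \<bar>\<tau>\<bar>) *\<^sub>R integral {0..\<tau> * y} f) {0..y}" by simp
  then have "integral {0..y} (\<lambda>t. f (\<tau> * t)) = (1 / \<tau>) *\<^sub>R integral {0..\<tau> * y} f"
    using \<tau> by (simp add: integral_unique)
  then show ?thesis using \<tau> by (simp add: scaleR_conv_of_real)
qed simp

text \<open>\<open>G\<close> starts at 0 and has nonpositive derivative, so the integral of the
  nonnegative \<open>g\<close> is at most 0.\<close>

lemma gronwall_zero:
  fixes g :: "real \<Rightarrow> real"
  assumes g: "continuous_on {0..1} g" "\<And>y. y \<in> {0..1} \<Longrightarrow> 0 \<le> g y"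
    and le: "\<And>y. y \<in> {0..1} \<Longrightarrow> g y \<le> C * integral {0..y} g" and y: "y \<in> {0..1}"
  shows "g y = 0"
proof -
  define G where "G u = exp (- C * u) * integral {0..u} g" for u
  have "G u \<le> G 0" if u: "u \<in> {0..1}" for u
  proof (cases "u = 0")
    case False
    then have u0: "0 < u" using u by simp
    have der: "(G has_real_derivative (exp (- C * x) * (g x - C * integral {0..x} g))) (at x within {0..u})" if x: "x \<in> {0..u}" for x
    proof -
      have "((\<lambda>x. integral {0..x} g) has_real_derivative g x) (at x within {0..u})"
        by (rule integral_has_real_derivative) (use g u x in \<open>auto intro: continuous_on_subset\<close>)
      then show ?thesis unfolding G_def[abs_def]
        by (auto intro!: derivative_eq_intros simp: algebra_simps)
    qed
    have "\<exists>x\<in>{0..u}. G u - G 0 = (exp (- C * x) * (g x - C * integral {0..x} g)) * (u - 0)"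
      by (rule mvt_very_simple) (use u0 der in \<open>auto simp: has_field_derivative_def\<close>)
    then obtain x where x: "x \<in> {0..u}" "G u - G 0 = (exp (- C * x) * (g x - C * integral {0..x} g)) * u" by auto
    have "exp (- C * x) * (g x - C * integral {0..x} g) \<le> 0"
      using le[of x] x(1) u by (intro mult_nonneg_nonpos) auto
    then have "(exp (- C * x) * (g x - C * integral {0..x} g)) * u \<le> 0"
      using u0 by (simp add: mult_nonpos_nonneg)
    then show ?thesis using x by simp
  qed simp
  then have "G y \<le> 0" using y by (simp add: G_def)
  then have "integral {0..y} g \<le> 0" by (simp add: G_def mult_le_0_iff)
  moreover have "integral {0..y} g \<ge> 0"
    by (rule integral_nonneg) (use g y in \<open>auto intro!: integrable_continuous_interval intro: continuous_on_subset\<close>)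
  ultimately show ?thesis using le[OF y] g(2)[OF y] by simp
qed

text \<open>The analyticity of the forcing enters only through one holomorphic extension
  \<open>zc\<close> to an open set \<open>N\<close> around the half-line; no power series occurs
  from here on.\<close>

locale ivp =
  fixes c0 :: real and \<zeta> :: "real \<Rightarrow> real" and N :: "complex set" and zc :: "complex \<Rightarrow> complex"
  assumes open_N: "open N" and zc_hol: "zc holomorphic_on N"
    and zc_real: "x \<ge> 0 \<Longrightarrow> complex_of_real x \<in> N \<and> zc (of_real x) = of_real (\<zeta> x)"
    and zeta_bounds: "x \<ge> 0 \<Longrightarrow> -1 < \<zeta> x \<and> \<zeta> x < 0"
begin

text \<open>The scaling \<open>x = L y\<close> makes the length a parameter of an equation on the real interval \<open>[0,1]\<close>, so complex
  lengths need no complex time. With \<open>s = z / L\<close>, the position \<open>v\<close> satisfies \<open>v' = L w\<close>, where \<open>w\<close> is \<open>vel\<close> and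
  \<open>w' = L * rhs\<close>.\<close>

definition rhs :: "complex \<Rightarrow> (real \<Rightarrow> complex) \<Rightarrow> real \<Rightarrow> complex" where
  "rhs L v t = v t ^ 3 - v t + zc (L * of_real t)"

definition vel :: "complex \<Rightarrow> complex \<Rightarrow> (real \<Rightarrow> complex) \<Rightarrow> real \<Rightarrow> complex" where
  "vel L s v y = s + L * integral {0..y} (rhs L v)"

definition pos :: "complex \<Rightarrow> complex \<Rightarrow> (real \<Rightarrow> complex) \<Rightarrow> real \<Rightarrow> complex" where
  "pos L s v y = of_real c0 + L * integral {0..y} (vel L s v)"

text \<open>For a complex length the forcing is evaluated along the segment from 0 to
  \<open>L\<close>, which must stay where \<open>zc\<close> is holomorphic.\<close>

definition seg :: "complex \<Rightarrow> bool" where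
  "seg L \<longleftrightarrow> (\<forall>t\<in>{0..1}. L * of_real t \<in> N)"

definition sol :: "complex \<Rightarrow> complex \<Rightarrow> (real \<Rightarrow> complex) \<Rightarrow> bool" where
  "sol L s v \<longleftrightarrow> seg L \<and> continuous_on {0..1} v \<and> (\<forall>y\<in>{0..1}. v y = pos L s v y)"

lemma continuous_rhs:
  assumes "seg L" "continuous_on {0..1} v"
  shows "continuous_on {0..1} (rhs L v)"
proof -
  have "continuous_on {0..1} (\<lambda>t. zc (L * of_real t))"
    by (rule continuous_on_compose2[OF holomorphic_on_imp_continuous_on[OF zc_hol]])
       (use assms in \<open>auto simp: seg_def intro!: continuous_intros\<close>)
  then show ?thesis unfolding rhs_def[abs_def] using assms by (intro continuous_intros)
qed

lemma vel_has_derivative: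
  assumes "seg L" "continuous_on {0..1} v" "y \<in> {0..1}"
  shows "(vel L s v has_vector_derivative L * rhs L v y) (at y within {0..1})"
  unfolding vel_def[abs_def]
  using integral_has_vector_derivative[OF continuous_rhs[OF assms(1,2)] assms(3)]
  by (auto intro!: derivative_eq_intros)

lemma continuous_vel: "seg L \<Longrightarrow> continuous_on {0..1} v \<Longrightarrow> continuous_on {0..1} (vel L s v)"
  by (rule continuous_on_vector_derivative[OF vel_has_derivative])

lemma pos_has_derivative:
  assumes "seg L" "continuous_on {0..1} v" "y \<in> {0..1}"
  shows "(pos L s v has_vector_derivative L * vel L s v y) (at y within {0..1})"
  unfolding pos_def[abs_def]
  using integral_has_vector_derivative[OF continuous_vel[OF assms(1,2)] assms(3)]
  by (auto intro!: derivative_eq_intros)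

lemma continuous_pos: "seg L \<Longrightarrow> continuous_on {0..1} v \<Longrightarrow> continuous_on {0..1} (pos L s v)"
  by (rule continuous_on_vector_derivative[OF pos_has_derivative])

lemma cubic_lipschitz:
  fixes a b :: complex
  assumes "norm a \<le> R" "norm b \<le> R"
  shows "norm ((a ^ 3 - a) - (b ^ 3 - b)) \<le> (3 * R\<^sup>2 + 1) * norm (a - b)"
proof -
  have R: "0 \<le> R" using assms(1) norm_ge_zero order_trans by blast
  have "(a ^ 3 - a) - (b ^ 3 - b) = (a\<^sup>2 + a * b + b\<^sup>2 - 1) * (a - b)"
    by (simp add: power2_eq_square power3_eq_cube algebra_simps)
  moreover have "norm (a\<^sup>2 + a * b + b\<^sup>2 - 1) \<le> 3 * R\<^sup>2 + 1"
  proof -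
    have "norm (a\<^sup>2 + a * b + b\<^sup>2 - 1) \<le> norm (a\<^sup>2) + norm (a * b) + norm (b\<^sup>2) + norm (1::complex)"
      by (intro norm_triangle_le_diff add_mono norm_triangle_mono order_refl)
    also have "\<dots> \<le> R\<^sup>2 + R\<^sup>2 + R\<^sup>2 + 1"
      unfolding norm_mult norm_power power2_eq_square
      by (intro add_mono mult_mono assms R) (auto simp: R)
    finally show ?thesis by simp
  qed
  ultimately show ?thesis by (simp add: norm_mult mult_right_mono)
qed

text \<open>The inner integrals are bounded by their value at \<open>y\<close> and the outer one by
  the length of \<open>{0..y}\<close>, so a single integral remains; this is the form needed by
  Gronwall's argument and by the weighted Picard estimate.\<close>

lemma pos_lipschitz:
  assumes "seg L" and v: "continuous_on {0..1} v" "continuous_on {0..1} v'"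
    and R: "\<And>t. t \<in> {0..1} \<Longrightarrow> norm (v t) \<le> R" "\<And>t. t \<in> {0..1} \<Longrightarrow> norm (v' t) \<le> R" and y: "y \<in> {0..1}"
  shows "norm (pos L s v y - pos L s v' y) \<le> (norm L)\<^sup>2 * (3 * R\<^sup>2 + 1) * integral {0..y} (\<lambda>t. norm (v t - v' t))"
proof -
  define g where "g t = norm (v t - v' t)" for t
  define M where "M = 3 * R\<^sup>2 + 1"
  have M: "M \<ge> 0" by (simp add: M_def)
  have gc: "continuous_on {0..1} g" unfolding g_def[abs_def] using v by (intro continuous_intros)
  have gi: "g integrable_on {0..u}" if "u \<in> {0..1}" for u
    using that by (intro integrable_continuous_interval continuous_on_subset[OF gc]) auto
  have ri: "rhs L w integrable_on {0..u}" if "u \<in> {0..1}" "continuous_on {0..1} w" for u w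
    using that by (intro integrable_continuous_interval continuous_on_subset[OF continuous_rhs[OF assms(1) that(2)]]) auto
  have wi: "vel L s w integrable_on {0..u}" if "u \<in> {0..1}" "continuous_on {0..1} w" for u w
    using that by (intro integrable_continuous_interval continuous_on_subset[OF continuous_vel[OF assms(1) that(2)]]) auto
  have g0: "integral {0..u} g \<le> integral {0..y} g" if "u \<in> {0..y}" for u
    by (rule integral_subset_le) (use that y gi g_def in auto)
  have vel_le: "norm (vel L s v u - vel L s v' u) \<le> norm L * (M * integral {0..y} g)" if u: "u \<in> {0..y}" for u
  proof -
    have u1: "u \<in> {0..1}" using u y by auto
    have "vel L s v u - vel L s v' u = L * integral {0..u} (\<lambda>t. rhs L v t - rhs L v' t)"
      unfolding vel_def using integral_diff[OF ri[OF u1 v(1)] ri[OF u1 v(2)]] by (simp add: right_diff_distrib)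
    moreover have "norm (integral {0..u} (\<lambda>t. rhs L v t - rhs L v' t)) \<le> integral {0..u} (\<lambda>t. M * g t)"
    proof (rule integral_norm_bound_integral)
      fix t assume "t \<in> {0..u}"
      then have t: "t \<in> {0..1}" using u1 by auto
      show "norm (rhs L v t - rhs L v' t) \<le> M * g t"
        using cubic_lipschitz[OF R(1)[OF t] R(2)[OF t]] by (simp add: rhs_def M_def g_def)
    qed (use ri u1 v gi in \<open>auto intro: integrable_diff integrable_on_mult_right\<close>)
    ultimately have "norm (vel L s v u - vel L s v' u) \<le> norm L * (M * integral {0..u} g)"
      by (simp add: norm_mult mult_left_mono)
    also have "\<dots> \<le> norm L * (M * integral {0..y} g)"
      using g0[OF u] M by (intro mult_left_mono) auto
    finally show ?thesis .
  qed
  have "pos L s v y - pos L s v' y = L * integral {0..y} (\<lambda>u. vel L s v u - vel L s v' u)"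
    unfolding pos_def using integral_diff[OF wi[OF y v(1)] wi[OF y v(2)]] by (simp add: right_diff_distrib)
  then have "norm (pos L s v y - pos L s v' y) = norm L * norm (integral {0..y} (\<lambda>u. vel L s v u - vel L s v' u))"
    by (simp only: norm_mult)
  also have "\<dots> \<le> norm L * integral {0..y} (\<lambda>u. norm L * (M * integral {0..y} g))"
    by (intro mult_left_mono integral_norm_bound_integral)
       (use vel_le wi y v in \<open>auto intro: integrable_diff\<close>)
  also have "integral {0..y} (\<lambda>u. norm L * (M * integral {0..y} g)) = y * (norm L * (M * integral {0..y} g))"
    using y by simp
  also have "norm L * (y * (norm L * (M * integral {0..y} g))) \<le> norm L * (1 * (norm L * (M * integral {0..y} g)))"
  proof (intro mult_left_mono mult_right_mono)
    have "integral {0..y} g \<ge> 0" by (rule integral_nonneg) (use gi y g_def in auto)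
    then show "0 \<le> norm L * (M * integral {0..y} g)" using M by simp
  qed (use y in auto)
  finally show ?thesis by (simp add: power2_eq_square M_def g_def[abs_def] algebra_simps)
qed

lemma continuous_bounded:
  assumes "continuous_on {0..1::real} (v :: real \<Rightarrow> complex)"
  obtains R where "R > 0" "\<forall>t\<in>{0..1}. norm (v t) \<le> R"
proof -
  have "bounded (v ` {0..1})" by (intro compact_imp_bounded compact_continuous_image assms) auto
  then show ?thesis using that unfolding bounded_pos by auto
qed

lemma sol_unique:
  assumes "sol L s v" "sol L s v'" "y \<in> {0..1}"
  shows "v y = v' y"
proof -
  have v: "seg L" "continuous_on {0..1} v" "continuous_on {0..1} v'" using assms by (auto simp: sol_def)
  obtain R1 where R1: "R1 > 0" "\<forall>t\<in>{0..1}. norm (v t) \<le> R1" using continuous_bounded[OF v(2)] .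
  obtain R2 where R2: "R2 > 0" "\<forall>t\<in>{0..1}. norm (v' t) \<le> R2" using continuous_bounded[OF v(3)] .
  define R where "R = max R1 R2"
  have "norm (v y - v' y) = 0"
  proof (rule gronwall_zero[of "\<lambda>y. norm (v y - v' y)" "(norm L)\<^sup>2 * (3 * R\<^sup>2 + 1)"])
    show "norm (v u - v' u) \<le> (norm L)\<^sup>2 * (3 * R\<^sup>2 + 1) * integral {0..u} (\<lambda>t. norm (v t - v' t))" if u: "u \<in> {0..1}" for u
    proof -
      have "v u = pos L s v u" "v' u = pos L s v' u" using assms u by (auto simp: sol_def)
      then show ?thesis
        using pos_lipschitz[OF v, of R u s] R1 R2 u by (simp add: R_def le_max_iff_disj)
    qed
  qed (use v assms in \<open>auto intro!: continuous_intros\<close>)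
  then show ?thesis by simp
qed

section \<open>Picard iteration with complex parameters\<close>

text \<open>The class of time-dependent functions preserved by the Picard map: holomorphic in the
  parameters at each time, and jointly continuous so that integration in time stays inside the
  class.\<close>

definition fam :: "(complex \<times> complex) set \<Rightarrow> (complex \<times> complex \<Rightarrow> real \<Rightarrow> complex) \<Rightarrow> bool" where
  "fam A u \<longleftrightarrow> continuous_on (A \<times> {0..1}) (\<lambda>(q,t). u q t) \<and> (\<forall>t\<in>{0..1}. hol2 A (\<lambda>q. u q t))"

lemma fam_add: "fam A u \<Longrightarrow> fam A w \<Longrightarrow> fam A (\<lambda>q t. u q t + w q t)"
  and fam_diff: "fam A u \<Longrightarrow> fam A w \<Longrightarrow> fam A (\<lambda>q t. u q t - w q t)"
  and fam_mult: "fam A u \<Longrightarrow> fam A w \<Longrightarrow> fam A (\<lambda>q t. u q t * w q t)"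
  unfolding fam_def split_beta
  by (simp_all add: continuous_on_add continuous_on_diff continuous_on_mult hol2_add hol2_diff hol2_mult)

lemma fam_const: "hol2 A f \<Longrightarrow> fam A (\<lambda>q t. f q)"
  unfolding fam_def split_beta
  by (auto intro!: continuous_on_compose2[OF hol2_cont, of A f _ fst] continuous_intros)

lemma fam_time: "continuous_on {0..1} f \<Longrightarrow> fam A (\<lambda>q t. f t)"
  unfolding fam_def split_beta
  by (auto intro!: continuous_on_compose2[of "{0..1}" f _ snd] continuous_intros hol2_const)

text \<open>Rescaled to \<open>{0..1}\<close>, the moving end point becomes a parameter of the
  integrand, which yields joint continuity.\<close>

lemma fam_integral:
  assumes "fam A u"
  shows "fam A (\<lambda>q y. integral {0..y} (u q))"
proof -
  have c: "continuous_on (A \<times> {0..1}) (\<lambda>(q,t). u q t)" using assms by (simp add: fam_def)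
  have ct: "continuous_on {0..1} (u q)" if "q \<in> A" for q
    using continuous_on_compose2[OF c, of "{0..1}" "\<lambda>t. (q,t)"] that
    by (simp add: image_subset_iff continuous_on_Pair)
  have "continuous_on ((A \<times> {0..1}) \<times> {0..1}) (\<lambda>(p,t). u (fst p) (snd p * t))"
    unfolding split_beta
    by (rule continuous_on_compose2[OF c, of _ "\<lambda>p. (fst (fst p), snd (fst p) * snd p)", simplified])
       (auto intro!: continuous_intros simp: mult_le_one)
  then have "continuous_on (A \<times> {0..1}) (\<lambda>p. integral {0..1} (\<lambda>t. u (fst p) (snd p * t)))"
    by (rule integral_continuous_on_param[where a = 0 and b = "1::real" and f = "\<lambda>p t. u (fst p) (snd p * t)", unfolded cbox_interval])
  then have c1: "continuous_on (A \<times> {0..1}) (\<lambda>p. of_real (snd p) * integral {0..1} (\<lambda>t. u (fst p) (snd p * t)))"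
    by (intro continuous_intros)
  have eq: "of_real y * integral {0..1} (\<lambda>t. u q (y * t)) = integral {0..y} (u q)" if "q \<in> A" "y \<in> {0..1}" for q y
    using integral_rescale[OF ct[OF that(1)] that(2), of 1] by simp
  have "continuous_on (A \<times> {0..1}) (\<lambda>(q,y). integral {0..y} (u q))"
    by (rule continuous_on_eq[OF c1]) (use eq in auto)
  moreover have "hol2 A (\<lambda>q. integral {0..y} (u q))" if "y \<in> {0..1}" for y
    by (rule hol2_integral) (use assms that in \<open>auto simp: fam_def intro: continuous_on_subset[OF c]\<close>)
  ultimately show ?thesis by (simp add: fam_def)
qed

lemma fam_rhs:
  assumes "\<And>q. q \<in> A \<Longrightarrow> seg (fst q)" "fam A u"
  shows "fam A (\<lambda>q. rhs (fst q) (u q))"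
proof -
  have m: "fst q * of_real t \<in> N" if "q \<in> A" "t \<in> {0..1}" for q t
    using assms(1)[OF that(1)] that(2) by (simp add: seg_def)
  have "fam A (\<lambda>q t. zc (fst q * of_real t))"
    unfolding fam_def split_beta
  proof (intro conjI ballI)
    show "continuous_on (A \<times> {0..1}) (\<lambda>p. zc (fst (fst p) * of_real (snd p)))"
      by (rule continuous_on_compose2[OF holomorphic_on_imp_continuous_on[OF zc_hol]])
         (use m in \<open>auto intro!: continuous_intros\<close>)
    show "hol2 A (\<lambda>q. zc (fst q * of_real t))" if "t \<in> {0..1}" for t
      by (rule hol2_compose1[OF hol2_mult[OF hol2_fst hol2_const] zc_hol]) (use m that in auto)
  qed
  then show ?thesis
    unfolding rhs_def[abs_def] power3_eq_cube
    by (intro fam_add fam_diff fam_mult assms(2))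
qed

lemma fam_vel:
  assumes "\<And>q. q \<in> A \<Longrightarrow> seg (fst q)" "fam A u"
  shows "fam A (\<lambda>q. vel (fst q) (snd q) (u q))"
  unfolding vel_def[abs_def]
  by (intro fam_add fam_mult fam_const hol2_fst hol2_snd fam_integral fam_rhs assms)

lemma fam_pos:
  assumes "\<And>q. q \<in> A \<Longrightarrow> seg (fst q)" "fam A u"
  shows "fam A (\<lambda>q. pos (fst q) (snd q) (u q))"
  unfolding pos_def[abs_def]
  by (intro fam_add fam_mult fam_const hol2_fst hol2_const fam_integral fam_vel assms)

lemma integral_exp_le:
  fixes K y E :: real
  assumes "K > 0" "y \<ge> 0" "E \<ge> 0"
  shows "integral {0..y} (\<lambda>t. E * exp (K * t)) \<le> E * exp (K * y) / K"
proof -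
  have "((\<lambda>t. E * exp (K * t)) has_integral (E * exp (K * y) / K - E * exp (K * 0) / K)) {0..y}"
    by (rule fundamental_theorem_of_calculus[where f = "\<lambda>t. E * exp (K * t) / K"])
       (use assms in \<open>auto intro!: derivative_eq_intros simp: has_real_derivative_iff_has_vector_derivative[symmetric]\<close>)
  then have "integral {0..y} (\<lambda>t. E * exp (K * t)) = E * exp (K * y) / K - E / K"
    by (simp only: integral_unique mult_zero_right exp_zero mult_1_right)
  then show ?thesis using assms by (simp only: diff_le_eq) simp
qed

lemma seg_open:
  assumes "seg L0"
  obtains d where "d > 0" "\<forall>L\<in>ball L0 d. seg L"
proof -
  have "compact ((\<lambda>t. L0 * complex_of_real t) ` {0..1})"
    by (intro compact_continuous_image continuous_intros) auto
  moreover have "(\<lambda>t. L0 * complex_of_real t) ` {0..1} \<subseteq> N"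
    using assms by (auto simp: seg_def)
  ultimately obtain d where d: "d > 0" "(\<Union>x\<in>(\<lambda>t. L0 * complex_of_real t) ` {0..1}. ball x d) \<subseteq> N"
    by (rule compact_subset_open_imp_ball_epsilon_subset[OF _ open_N])
  have "seg L" if "L \<in> ball L0 d" for L
    unfolding seg_def
  proof
    fix t :: real assume t: "t \<in> {0..1}"
    have "dist (L0 * of_real t) (L * of_real t) = norm (L0 - L) * t"
      using t by (simp add: dist_norm left_diff_distrib[symmetric] norm_mult)
    also have "\<dots> \<le> norm (L0 - L) * 1" using t by (intro mult_left_mono) auto
    also have "\<dots> < d" using that by (simp add: dist_norm)
    finally have "L * of_real t \<in> ball (L0 * of_real t) d" by simp
    then show "L * of_real t \<in> N" using d(2) t by blast
  qed
  then show ?thesis using that d(1) by blast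
qed

text \<open>The iteration starts from the given solution \<open>v0\<close> rather than from a
  constant. With the weight \<open>exp (K * y)\<close> it contracts on all of \<open>{0..1}\<close>
  at once, so no continuation over small time steps is needed, and the iterates stay within distance
  1 of \<open>v0\<close>.\<close>

lemma sol_perturb:
  assumes v0: "sol L0 s0 v0"
  obtains A u where "open A" "(L0,s0) \<in> A" "fam A u" "\<forall>q\<in>A. sol (fst q) (snd q) (u q)"
proof -
  have seg0: "seg L0" and cv0: "continuous_on {0..1} v0" using v0 by (auto simp: sol_def)
  obtain R0 where R0: "R0 > 0" "\<forall>t\<in>{0..1}. norm (v0 t) \<le> R0" using continuous_bounded[OF cv0] .
  define R where "R = R0 + 1"
  \<comment> \<open>On the ball of radius \<open>R\<close> the Lipschitz constant of the Picard map
    is at most \<open>K / 2\<close>, and integrating \<open>exp (K * t)\<close> gains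
    \<open>1 / K\<close>: each step halves the weighted distance.\<close>
  define K where "K = 2 * (norm L0 + 1)\<^sup>2 * (3 * R\<^sup>2 + 1)"
  have K: "K > 0" unfolding K_def
    by (intro mult_pos_pos zero_less_power add_nonneg_pos mult_nonneg_nonneg) auto
  \<comment> \<open>The increments are at most \<open>\<epsilon> * (1/2)^n * exp K\<close>, with sum
    \<open>2 * \<epsilon> * exp K = 1\<close>, which is exactly the margin between \<open>R0\<close>
    and \<open>R\<close>.\<close>
  define \<epsilon> where "\<epsilon> = 1 / (2 * exp K)"
  have \<epsilon>: "\<epsilon> > 0" "2 * \<epsilon> * exp K = 1" by (auto simp: \<epsilon>_def)
  obtain d where d: "d > 0" "\<forall>L\<in>ball L0 d. seg L" using seg_open[OF seg0] .
  define d1 where "d1 = min (d/2) 1"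
  have d1: "d1 > 0" "d1 \<le> 1" "cball L0 d1 \<subseteq> ball L0 d" using d by (auto simp: d1_def)
  let ?C = "cball L0 d1 \<times> cball s0 d1"
  have segC: "seg (fst q)" if "q \<in> ?C" for q using that d d1 by auto
  have "fam ?C (\<lambda>q. pos (fst q) (snd q) v0)" by (intro fam_pos segC fam_time cv0)
  then have "continuous_on (?C \<times> {0..1}) (\<lambda>(q,t). pos (fst q) (snd q) v0 t)" by (simp add: fam_def)
  then have "uniformly_continuous_on (?C \<times> {0..1}) (\<lambda>(q,t). pos (fst q) (snd q) v0 t)"
    by (rule compact_uniformly_continuous) (intro compact_Times compact_cball compact_Icc)
  then obtain d2 where d2: "d2 > 0"
    "\<And>p p'. p \<in> ?C \<times> {0..1} \<Longrightarrow> p' \<in> ?C \<times> {0..1} \<Longrightarrow> dist p' p < d2 \<Longrightarrow>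
      dist ((\<lambda>(q,t). pos (fst q) (snd q) v0 t) p') ((\<lambda>(q,t). pos (fst q) (snd q) v0 t) p) < \<epsilon>"
    unfolding uniformly_continuous_on_def using \<epsilon>(1) by meson
  define A where "A = (ball L0 d1 \<times> ball s0 d1) \<inter> ball (L0,s0) d2"
  have AC: "A \<subseteq> ?C" by (auto simp: A_def)
  have segA: "seg (fst q)" if "q \<in> A" for q using segC AC that by blast
  have oA: "open A" by (auto simp: A_def intro!: open_Int open_Times)
  have mA: "(L0,s0) \<in> A" using d1 d2 by (simp add: A_def)
  have base: "norm (pos (fst q) (snd q) v0 y - v0 y) \<le> \<epsilon>" if q: "q \<in> A" and y: "y \<in> {0..1}" for q y
  proof -
    have "dist (q,y) ((L0,s0),y) = dist q (L0,s0)" by (simp add: dist_prod_def)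
    then have "dist (q,y) ((L0,s0),y) < d2" using q by (simp add: A_def dist_commute)
    then have "dist (pos (fst q) (snd q) v0 y) (pos L0 s0 v0 y) < \<epsilon>"
      using d2(2)[of "((L0,s0),y)" "(q,y)"] subsetD[OF AC q] subsetD[OF AC mA] y
      unfolding mem_Times_iff by simp
    then show ?thesis using v0 y by (simp add: sol_def dist_norm)
  qed
  define u where "u n q = ((pos (fst q) (snd q)) ^^ n) v0" for n q
  have uS: "u (Suc n) q = pos (fst q) (snd q) (u n q)" for n q by (simp add: u_def)
  have famu: "fam A (u n)" for n
  proof (induction n)
    case 0 then show ?case using fam_time[OF cv0] by (simp add: u_def)
  next
    case (Suc n) then show ?case unfolding uS by (intro fam_pos segA)
  qed
  have cu: "continuous_on {0..1} (u n q)" if "q \<in> A" for n q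
  proof (induction n)
    case 0 then show ?case using cv0 by (simp add: u_def)
  next
    case (Suc n) then show ?case unfolding uS using segA[OF that] by (intro continuous_pos)
  qed
  have L2: "(norm (fst q))\<^sup>2 * (3 * R\<^sup>2 + 1) \<le> K / 2" if "q \<in> A" for q
  proof -
    have "dist L0 (fst q) < d1" using that by (auto simp: A_def)
    then have "norm (fst q) \<le> norm L0 + 1"
      using d1(2) norm_triangle_sub[of "fst q" L0] by (simp add: dist_norm norm_minus_commute)
    then have "(norm (fst q))\<^sup>2 \<le> (norm L0 + 1)\<^sup>2" by (intro power_mono) auto
    then show ?thesis by (simp add: K_def mult_right_mono)
  qed
  \<comment> \<open>One induction for both claims: the closeness to \<open>v0\<close> validates the
    Lipschitz bound for the next increment, and the increments give the closeness.\<close>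
  have step: "(\<forall>y\<in>{0..1}. norm (u n q y - v0 y) \<le> 2 * \<epsilon> * exp K * (1 - (1/2)^n)) \<and>
      (\<forall>y\<in>{0..1}. norm (u (Suc n) q y - u n q y) \<le> \<epsilon> * (1/2)^n * exp (K * y))" if q: "q \<in> A" for n q
  proof (induction n)
    case 0
    have "norm (u (Suc 0) q y - u 0 q y) \<le> \<epsilon> * exp (K * y)" if "y \<in> {0..1}" for y
    proof -
      have "\<epsilon> * 1 \<le> \<epsilon> * exp (K * y)" using \<epsilon> K that by (intro mult_left_mono) auto
      then show ?thesis using base[OF q that] by (simp add: u_def)
    qed
    then show ?case by (simp add: u_def)
  next
    case (Suc n)
    have 1: "norm (u (Suc n) q y - v0 y) \<le> 2 * \<epsilon> * exp K * (1 - (1/2)^(Suc n))" if y: "y \<in> {0..1}" for y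
    proof -
      have "exp (K * y) \<le> exp K" using K y by (simp add: mult_left_le)
      then have "\<epsilon> * (1/2)^n * exp (K * y) \<le> \<epsilon> * (1/2)^n * exp K" using \<epsilon> by (intro mult_left_mono) auto
      then have "norm (u (Suc n) q y - u n q y) + norm (u n q y - v0 y) \<le> \<epsilon> * (1/2)^n * exp K + 2 * \<epsilon> * exp K * (1 - (1/2)^n)"
        using Suc y by (intro add_mono) force+
      moreover have "norm (u (Suc n) q y - v0 y) \<le> norm (u (Suc n) q y - u n q y) + norm (u n q y - v0 y)"
        using norm_triangle_ineq[of "u (Suc n) q y - u n q y" "u n q y - v0 y"] by simp
      ultimately show ?thesis by (simp add: algebra_simps)
    qed
    have near: "norm w \<le> R" if "norm (w - v0 y) \<le> 2 * \<epsilon> * exp K * (1 - (1/2)^m)" "y \<in> {0..1}" for w y m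
    proof -
      have "norm (w - v0 y) \<le> 1" using that(1) \<epsilon>(2) by (simp add: order_trans)
      then show ?thesis using norm_triangle_sub[of w "v0 y"] R0 that(2) by (force simp: R_def)
    qed
    have 2: "norm (u (Suc (Suc n)) q y - u (Suc n) q y) \<le> \<epsilon> * (1/2)^(Suc n) * exp (K * y)" if y: "y \<in> {0..1}" for y
    proof -
      define I where "I = integral {0..y} (\<lambda>t. norm (u (Suc n) q t - u n q t))"
      have "norm (u (Suc (Suc n)) q y - u (Suc n) q y) \<le> (norm (fst q))\<^sup>2 * (3 * R\<^sup>2 + 1) * I"
        unfolding uS[of "Suc n"] I_def
        by (subst (2) uS) (rule pos_lipschitz[OF segA[OF q] cu[OF q] cu[OF q] _ _ y]; use 1 near Suc in blast)
      also have "\<dots> \<le> K / 2 * I"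
        unfolding I_def using L2[OF q] by (intro mult_right_mono integral_nonneg)
          (use y in \<open>auto intro!: integrable_continuous_interval continuous_intros continuous_on_subset[OF cu[OF q]]\<close>)
      also have "I \<le> integral {0..y} (\<lambda>t. \<epsilon> * (1/2)^n * exp (K * t))"
        unfolding I_def
      proof (rule integral_le)
        show "(\<lambda>t. norm (u (Suc n) q t - u n q t)) integrable_on {0..y}"
          using cu[OF q] y by (intro integrable_continuous_interval continuous_intros continuous_on_subset[OF cu[OF q]]) auto
        show "(\<lambda>t. \<epsilon> * (1/2)^n * exp (K * t)) integrable_on {0..y}"
          by (intro integrable_continuous_interval continuous_intros)
      qed (use Suc y in auto)
      also have "\<dots> \<le> \<epsilon> * (1/2)^n * exp (K * y) / K"
        by (rule integral_exp_le) (use K y \<epsilon> in auto)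
      finally show ?thesis using K by simp
    qed
    show ?case using 1 2 by blast
  qed
  \<comment> \<open>The limit of the iterates as a telescoping series, to which the M-test applies
    uniformly in parameters and time.\<close>
  define U where "U p = v0 (snd p) + (\<Sum>n. u (Suc n) (fst p) (snd p) - u n (fst p) (snd p))" for p
  have tel: "v0 t + (\<Sum>i<n. u (Suc i) q t - u i q t) = u n q t" for n q t
    using sum_lessThan_telescope[of "\<lambda>i. u i q t" n] u_def[of 0 q] by simp
  have "uniform_limit (A \<times> {0..1}) (\<lambda>n p. \<Sum>i<n. u (Suc i) (fst p) (snd p) - u i (fst p) (snd p))
      (\<lambda>p. \<Sum>n. u (Suc n) (fst p) (snd p) - u n (fst p) (snd p)) sequentially"
  proof (rule Weierstrass_m_test)
    show "summable (\<lambda>n. \<epsilon> * exp K * (1/2)^n)" by (intro summable_mult summable_geometric) auto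
    fix n p assume p: "p \<in> A \<times> {0..1::real}"
    have "norm (u (Suc n) (fst p) (snd p) - u n (fst p) (snd p)) \<le> \<epsilon> * (1/2)^n * exp (K * snd p)"
      using step[of "fst p" n] p by auto
    also have "\<dots> \<le> \<epsilon> * (1/2)^n * exp K"
      using p \<epsilon> K by (intro mult_left_mono) (auto simp: mult_left_le)
    finally show "norm (u (Suc n) (fst p) (snd p) - u n (fst p) (snd p)) \<le> \<epsilon> * exp K * (1/2)^n" by (simp add: mult_ac)
  qed
  then have "uniform_limit (A \<times> {0..1}) (\<lambda>n p. v0 (snd p) + (\<Sum>i<n. u (Suc i) (fst p) (snd p) - u i (fst p) (snd p))) U sequentially"
    unfolding U_def[abs_def] by (intro uniform_limit_add uniform_limit_const)
  then have ul: "uniform_limit (A \<times> {0..1}) (\<lambda>n p. u n (fst p) (snd p)) U sequentially"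
    unfolding tel .
  define w where "w q t = U (q,t)" for q t
  have ulq: "uniform_limit {0..1} (\<lambda>n. u n q) (w q) sequentially" if "q \<in> A" for q
    using ul that unfolding uniform_limit_iff w_def by (fastforce elim!: eventually_mono)
  have famw: "fam A w"
    unfolding fam_def
  proof (intro conjI ballI)
    have "continuous_on (A \<times> {0..1}) U"
      by (rule uniform_limit_theorem[OF _ ul]) (use famu in \<open>auto simp: fam_def split_beta\<close>)
    then show "continuous_on (A \<times> {0..1}) (\<lambda>(q, t). w q t)" by (simp add: w_def split_beta)
    fix t :: real assume t: "t \<in> {0..1}"
    show "hol2 A (\<lambda>q. w q t)"
    proof (rule hol2_uniform_limit[where f = "\<lambda>n q. u n q t"])
      show "hol2 A (\<lambda>q. u n q t)" for n using famu t by (simp add: fam_def)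
      show "uniform_limit A (\<lambda>n q. u n q t) (\<lambda>q. w q t) sequentially"
        using ul t unfolding uniform_limit_iff w_def by (fastforce elim!: eventually_mono)
    qed
  qed
  have "sol (fst q) (snd q) (w q)" if q: "q \<in> A" for q
  proof -
    have cw: "continuous_on {0..1} (w q)"
      by (rule uniform_limit_theorem[OF _ ulq[OF q]]) (use cu[OF q] in auto)
    have ptw: "(\<lambda>n. u n q t) \<longlonglongrightarrow> w q t" if "t \<in> {0..1}" for t
      by (rule tendsto_uniform_limitI[OF ulq[OF q] that])
    have bd: "norm (u n q t) \<le> R" if t: "t \<in> {0..1}" for n t
    proof -
      have "norm (u n q t - v0 t) \<le> 2 * \<epsilon> * exp K * (1 - (1/2)^n)" using step[OF q] t by blast
      also have "\<dots> \<le> 1" using \<epsilon> by simp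
      finally show ?thesis using norm_triangle_sub[of "u n q t" "v0 t"] R0 t by (force simp: R_def)
    qed
    have bdw: "norm (w q t) \<le> R" if "t \<in> {0..1}" for t
      by (rule LIMSEQ_le_const2[OF tendsto_norm[OF ptw[OF that]]]) (use bd that in auto)
    have "w q y = pos (fst q) (snd q) (w q) y" if y: "y \<in> {0..1}" for y
    proof -
      have "(\<lambda>n. pos (fst q) (snd q) (u n q) y - pos (fst q) (snd q) (w q) y) \<longlonglongrightarrow> 0"
      proof (rule Lim_null_comparison[OF always_eventually])
        show "\<forall>n. norm (pos (fst q) (snd q) (u n q) y - pos (fst q) (snd q) (w q) y)
            \<le> (norm (fst q))\<^sup>2 * (3 * R\<^sup>2 + 1) * integral {0..y} (\<lambda>t. norm (u n q t - w q t))"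
          using pos_lipschitz[OF segA[OF q] cu[OF q] cw bd bdw y] by blast
        have ul0: "uniform_limit {0..y} (\<lambda>n t. norm (u n q t - w q t)) (\<lambda>t. 0) sequentially"
          using ulq[OF q] y unfolding uniform_limit_iff dist_norm
          by (fastforce elim!: eventually_mono)
        have cl0: "continuous_on {0..y} (\<lambda>t. norm (u n q t - w q t))" for n
          using y by (intro continuous_intros continuous_on_subset[OF cu[OF q]] continuous_on_subset[OF cw]) auto
        have "(\<lambda>n. integral {0..y} (\<lambda>t. norm (u n q t - w q t))) \<longlonglongrightarrow> 0"
        proof (rule uniform_limit_integral[OF ul0 cl0 sequentially_bot])
          fix I and J :: real
          assume IJ: "\<And>n. ((\<lambda>t. norm (u n q t - w q t)) has_integral I n) {0..y}"
            "((\<lambda>t. 0) has_integral J) {0..y}" "I \<longlonglongrightarrow> J"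
          then show "(\<lambda>n. integral {0..y} (\<lambda>t. norm (u n q t - w q t))) \<longlonglongrightarrow> 0"
            using integral_unique[OF IJ(1)] has_integral_unique[OF IJ(2) has_integral_0] by simp
        qed
        then show "(\<lambda>n. (norm (fst q))\<^sup>2 * (3 * R\<^sup>2 + 1) * integral {0..y} (\<lambda>t. norm (u n q t - w q t))) \<longlonglongrightarrow> 0"
          by (auto intro: tendsto_mult_right_zero)
      qed
      then have "(\<lambda>n. u (Suc n) q y) \<longlonglongrightarrow> pos (fst q) (snd q) (w q) y"
        unfolding uS by (rule LIM_zero_cancel)
      moreover have "(\<lambda>n. u (Suc n) q y) \<longlonglongrightarrow> w q y"
        using ptw[OF y] by (rule LIMSEQ_Suc)
      ultimately show ?thesis using LIMSEQ_unique by blast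
    qed
    then show ?thesis using segA[OF q] cw by (simp add: sol_def)
  qed
  then show ?thesis using that[OF oA mA famw] by blast
qed

end

lemma Re_has_real_derivative:
  assumes "(f has_field_derivative d) (at (complex_of_real a))"
  shows "((\<lambda>x. Re (f (of_real x))) has_real_derivative Re d) (at a)"
proof -
  have "((\<lambda>x. f (of_real x)) has_vector_derivative d) (at a)"
    by (rule has_vector_derivative_real_field[OF assms])
  then have "((\<lambda>x. Re (f (of_real x))) has_vector_derivative Re d) (at a)"
    by (rule bounded_linear.has_vector_derivative[OF bounded_linear_Re])
  then show ?thesis by (simp add: has_real_derivative_iff_has_vector_derivative)
qed

lemma real_valued_imp_derivative_real:
  assumes "(f has_field_derivative d) (at (complex_of_real a))"
    and "\<forall>\<^sub>F x in nhds a. f (complex_of_real x) \<in> \<real>"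
  shows "d \<in> \<real>"
proof -
  have "((\<lambda>x. f (of_real x)) has_vector_derivative d) (at a)"
    by (rule has_vector_derivative_real_field[OF assms(1)])
  then have "((\<lambda>x. Im (f (of_real x))) has_vector_derivative Im d) (at a)"
    by (rule bounded_linear.has_vector_derivative[OF bounded_linear_Im])
  then have 1: "((\<lambda>x. Im (f (of_real x))) has_real_derivative Im d) (at a)"
    by (simp add: has_real_derivative_iff_has_vector_derivative)
  have "((\<lambda>x. 0) has_real_derivative Im d) (at a) \<longleftrightarrow> ((\<lambda>x. Im (f (of_real x))) has_real_derivative Im d) (at a)"
    by (rule DERIV_cong_ev[OF refl _ refl]) (use assms(2) in \<open>auto elim!: eventually_mono simp: complex_is_Real_iff\<close>)
  then have "Im d = 0" using 1 DERIV_unique[OF _ DERIV_const] by blast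
  then show ?thesis by (simp add: complex_is_Real_iff)
qed

context ivp
begin

section \<open>The end-point maps and their differential equations\<close>

definition Om :: "(complex \<times> complex) set" where
  "Om = {q. \<exists>v. sol (fst q) (snd q) v}"

text \<open>Determined only for parameters in \<open>Om\<close> and only on \<open>{0..1}\<close>;
  elsewhere the choice is arbitrary.\<close>

definition the_sol :: "complex \<times> complex \<Rightarrow> real \<Rightarrow> complex" where
  "the_sol q = (SOME v. sol (fst q) (snd q) v)"

text \<open>The end value carries the whole trajectory: the value at time \<tau> is the end value
  for the length \<open>L * \<tau>\<close> with the same slope.\<close>

definition V :: "complex \<times> complex \<Rightarrow> complex" where
  "V q = the_sol q 1"

definition F :: "complex \<times> complex \<Rightarrow> complex" where
  "F q = vel (fst q) (snd q) (the_sol q) 1"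

lemma vel_cong:
  assumes "\<And>t. t \<in> {0..1} \<Longrightarrow> v t = v' t" "y \<in> {0..1}"
  shows "vel L s v y = vel L s v' y"
proof -
  have "integral {0..y} (rhs L v) = integral {0..y} (rhs L v')"
    by (rule integral_cong) (use assms in \<open>auto simp: rhs_def\<close>)
  then show ?thesis by (simp add: vel_def)
qed

lemma sol_imp:
  assumes "sol L s v"
  shows "(L,s) \<in> Om" "V (L,s) = v 1" "F (L,s) = vel L s v 1"
proof -
  show "(L,s) \<in> Om" using assms by (auto simp: Om_def)
  have "sol L s (the_sol (L,s))" unfolding the_sol_def fst_conv snd_conv using someI[of "sol L s" v] assms by simp
  then have eq: "t \<in> {0..1} \<Longrightarrow> the_sol (L,s) t = v t" for t using sol_unique assms by blast
  show "V (L,s) = v 1" using eq by (simp add: V_def)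
  show "F (L,s) = vel L s v 1" using vel_cong[of "the_sol (L,s)" v] eq by (simp add: F_def)
qed

lemma Om_imp_sol: "(L,s) \<in> Om \<Longrightarrow> \<exists>v. sol L s v"
  by (simp add: Om_def)

lemma Om_local:
  assumes "q \<in> Om"
  shows "\<exists>A. open A \<and> q \<in> A \<and> A \<subseteq> Om \<and> hol2 A V \<and> hol2 A F"
proof -
  obtain L0 s0 where q: "q = (L0,s0)" by (cases q)
  obtain v0 where "sol L0 s0 v0" using assms Om_imp_sol q by blast
  then obtain A u where A: "open A" "(L0,s0) \<in> A" "fam A u" "\<forall>q\<in>A. sol (fst q) (snd q) (u q)"
    by (rule sol_perturb)
  have S: "q \<in> Om" "V q = u q 1" "F q = vel (fst q) (snd q) (u q) 1" if "q \<in> A" for q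
    using sol_imp[of "fst q" "snd q" "u q"] A(4) that by auto
  have "hol2 A (\<lambda>q. u q 1)" using A(3) by (simp add: fam_def)
  then have "hol2 A V"
    by (rule hol2_cong) (simp add: S)
  moreover have "fam A (\<lambda>q. vel (fst q) (snd q) (u q))"
    by (rule fam_vel) (use A in \<open>auto simp: sol_def\<close>)
  then have "hol2 A (\<lambda>q. vel (fst q) (snd q) (u q) 1)" by (simp add: fam_def)
  then have "hol2 A F"
    by (rule hol2_cong) (simp add: S)
  moreover have "A \<subseteq> Om" using S by blast
  ultimately show ?thesis using A q by blast
qed

lemma open_Om: "open Om"
  using Om_local by (subst open_subopen) blast

lemma hol2_V: "hol2 Om V" and hol2_F: "hol2 Om F"
proof -
  show "hol2 Om V"
    by (rule hol2_local) (metis Om_local hol2_subset Int_lower1)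
  show "hol2 Om F"
    by (rule hol2_local) (metis Om_local hol2_subset Int_lower1)
qed

lemma sol_rescale:
  assumes v: "sol L s v" and \<tau>: "\<tau> \<in> {0..1}"
  shows "sol (L * of_real \<tau>) s (\<lambda>y. v (\<tau> * y))" "vel (L * of_real \<tau>) s (\<lambda>y. v (\<tau> * y)) 1 = vel L s v \<tau>"
proof -
  have seg: "seg L" and c: "continuous_on {0..1} v" using v by (auto simp: sol_def)
  have m: "\<tau> * t \<in> {0..1}" if "t \<in> {0..1}" for t using \<tau> that by (auto simp: mult_le_one)
  have seg': "seg (L * of_real \<tau>)"
    using seg m unfolding seg_def by (metis mult.assoc of_real_mult)
  have c': "continuous_on {0..1} (\<lambda>y. v (\<tau> * y))"
    by (rule continuous_on_compose2[OF c]) (use m in \<open>auto intro!: continuous_intros\<close>)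
  have r: "rhs (L * of_real \<tau>) (\<lambda>y. v (\<tau> * y)) = (\<lambda>t. rhs L v (\<tau> * t))"
    by (simp add: rhs_def fun_eq_iff mult.assoc)
  have w: "vel (L * of_real \<tau>) s (\<lambda>y. v (\<tau> * y)) y = vel L s v (\<tau> * y)" if "y \<in> {0..1}" for y
    using integral_rescale[OF continuous_rhs[OF seg c] \<tau> that] by (simp add: vel_def r)
  have p: "pos (L * of_real \<tau>) s (\<lambda>y. v (\<tau> * y)) y = pos L s v (\<tau> * y)" if y: "y \<in> {0..1}" for y
  proof -
    have "integral {0..y} (vel (L * of_real \<tau>) s (\<lambda>y. v (\<tau> * y))) = integral {0..y} (\<lambda>t. vel L s v (\<tau> * t))"
      by (rule integral_cong) (use w y in auto)
    then show ?thesis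
      using integral_rescale[OF continuous_vel[OF seg c] \<tau> y, of s] by (simp add: pos_def)
  qed
  show "sol (L * of_real \<tau>) s (\<lambda>y. v (\<tau> * y))"
    using seg' c' p v m by (simp add: sol_def)
  show "vel (L * of_real \<tau>) s (\<lambda>y. v (\<tau> * y)) 1 = vel L s v \<tau>"
    using w[of 1] by simp
qed

lemma sol_rescale_values:
  assumes "sol L s v" "\<tau> \<in> {0..1}"
  shows "(L * of_real \<tau>, s) \<in> Om" "V (L * of_real \<tau>, s) = v \<tau>" "F (L * of_real \<tau>, s) = vel L s v \<tau>"
  using sol_imp[OF sol_rescale(1)[OF assms]] sol_rescale(2)[OF assms] by auto

lemma Om_scale: "(L,s) \<in> Om \<Longrightarrow> \<tau> \<in> {0..1} \<Longrightarrow> (L * of_real \<tau>, s) \<in> Om"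
  using Om_imp_sol sol_rescale_values(1) by blast

lemma Om_N: "q \<in> Om \<Longrightarrow> fst q \<in> N"
  by (cases q) (auto simp: Om_def sol_def seg_def dest!: bspec[of _ _ "1::real"])

lemma sol_zero: "sol 0 s (\<lambda>_. of_real c0)"
  using zc_real[of 0] by (auto simp: sol_def seg_def pos_def)

lemma Om_zero: "(0,s) \<in> Om" "V (0,s) = of_real c0" "F (0,s) = s"
  using sol_imp[OF sol_zero[of s]] by (auto simp: vel_def)

text \<open>The complex derivative in the length exists already, so it may be computed along the ray
  \<open>L * \<tau>\<close> from one side at \<open>\<tau> = 1\<close>. There the integral equations
  give it multiplied by \<open>L\<close>, whence \<open>L \<noteq> 0\<close>.\<close>

lemma pd1_nonzero:
  assumes "(L,s) \<in> Om" "L \<noteq> 0"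
  shows "pd1 V (L,s) = F (L,s)" "pd1 F (L,s) = V (L,s) ^ 3 - V (L,s) + zc L"
proof -
  obtain v where v: "sol L s v" using assms Om_imp_sol by blast
  have seg: "seg L" and c: "continuous_on {0..1} v" using v by (auto simp: sol_def)
  have nb: "at (1::real) within {0..1} \<noteq> bot"
    by (simp add: trivial_limit_within islimpt_Icc)
  have D: "((\<lambda>\<tau>. H (L * of_real \<tau>, s)) has_vector_derivative pd1 H (L,s) * L) (at 1 within {0..1})" if "hol2 Om H" for H
  proof -
    have "(L * of_real 1, s) \<in> Om" using assms by simp
    then have "((\<lambda>u. H (u,s)) has_field_derivative pd1 H (L * of_real 1,s)) (at (L * of_real 1))"
      by (rule hol2_D1[OF that open_Om])
    then have "((\<lambda>w. H (L * w, s)) has_field_derivative pd1 H (L * of_real 1,s) * (L * 1)) (at (of_real 1))"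
      by (rule DERIV_chain2[where f = "\<lambda>u. H (u,s)" and g = "\<lambda>w. L * w"]) (auto intro!: derivative_eq_intros)
    then show ?thesis using has_vector_derivative_real_field by force
  qed
  have "(v has_vector_derivative L * vel L s v 1) (at 1 within {0..1})"
    using pos_has_derivative[OF seg c, of 1 s] has_vector_derivative_transform[of 1 "{0..1}" v "pos L s v"] v
    by (simp add: sol_def)
  then have "((\<lambda>\<tau>. V (L * of_real \<tau>, s)) has_vector_derivative L * vel L s v 1) (at 1 within {0..1})"
    using has_vector_derivative_transform[of 1 "{0..1}" "\<lambda>\<tau>. V (L * of_real \<tau>, s)" v] sol_rescale_values(2)[OF v] by simp
  from vector_derivative_unique_within[OF nb this D[OF hol2_V]]
  show "pd1 V (L,s) = F (L,s)" using assms(2) sol_imp(3)[OF v] by simp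
  have "((\<lambda>\<tau>. F (L * of_real \<tau>, s)) has_vector_derivative L * rhs L v 1) (at 1 within {0..1})"
    using has_vector_derivative_transform[of 1 "{0..1}" "\<lambda>\<tau>. F (L * of_real \<tau>, s)" "vel L s v"]
      sol_rescale_values(3)[OF v] vel_has_derivative[OF seg c, of 1 s] by simp
  from vector_derivative_unique_within[OF nb this D[OF hol2_F]]
  show "pd1 F (L,s) = V (L,s) ^ 3 - V (L,s) + zc L"
    using assms(2) sol_imp(2)[OF v] by (simp add: rhs_def)
qed

lemma hol2_zc: "hol2 Om (\<lambda>q. zc (fst q))"
  by (rule hol2_compose1[OF hol2_fst zc_hol]) (use Om_N in auto)

lemma hol2_A: "hol2 Om (\<lambda>q. V q ^ 3 - V q + zc (fst q))"
  by (intro hol2_add hol2_diff hol2_power hol2_V hol2_zc)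

lemma
  assumes "q \<in> Om"
  shows pd1_V: "pd1 V q = F q" and pd1_F: "pd1 F q = V q ^ 3 - V q + zc (fst q)"
proof -
  obtain L s where q: "q = (L,s)" by (cases q)
  have "G1 q = G2 q" if c: "continuous_on Om G1" "continuous_on Om G2"
    and eq: "\<And>L s. (L,s) \<in> Om \<Longrightarrow> L \<noteq> 0 \<Longrightarrow> G1 (L,s) = G2 (L,s)" for G1 G2 :: "complex \<times> complex \<Rightarrow> complex"
  proof (cases "L = 0")
    case True
    \<comment> \<open>Both sides are continuous, and nonzero lengths approach 0.\<close>
    define X where "X n = (complex_of_real (inverse (of_nat (Suc n))), s)" for n
    have X: "X \<longlonglongrightarrow> q" unfolding X_def q True
      by (intro tendsto_Pair tendsto_const) (metis LIMSEQ_inverse_real_of_nat of_real_0 tendsto_of_real)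
    have ev: "\<forall>\<^sub>F n in sequentially. X n \<in> Om"
      by (rule topological_tendstoD[OF X open_Om assms])
    have "isCont G1 q" "isCont G2 q" using c assms open_Om continuous_on_eq_continuous_at by blast+
    then have "(\<lambda>n. G1 (X n)) \<longlonglongrightarrow> G1 q" and G2: "(\<lambda>n. G2 (X n)) \<longlonglongrightarrow> G2 q"
      using X isCont_tendsto_compose by blast+
    moreover have ev2: "\<forall>\<^sub>F n in sequentially. G1 (X n) = G2 (X n)"
      using ev
    proof eventually_elim
      case (elim n)
      have "inverse (real (Suc n)) \<noteq> 0" by simp
      then have "complex_of_real (inverse (of_nat (Suc n))) \<noteq> 0" by (simp only: of_real_eq_0_iff not_False_eq_True)
      then show ?case using elim unfolding X_def by (rule eq[rotated])
    qed
    ultimately have "(\<lambda>n. G2 (X n)) \<longlonglongrightarrow> G1 q" using tendsto_cong[OF ev2] by blast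
    then show ?thesis using LIMSEQ_unique G2 by blast
  qed (use eq assms q in auto)
  note eq = this
  show "pd1 V q = F q"
    by (rule eq[OF hol2_cont[OF hol2_pd1[OF hol2_V open_Om]] hol2_cont[OF hol2_F]]) (rule pd1_nonzero)
  show "pd1 F q = V q ^ 3 - V q + zc (fst q)"
    by (rule eq[OF hol2_cont[OF hol2_pd1[OF hol2_F open_Om]] hol2_cont[OF hol2_A]])
       (simp add: pd1_nonzero(2))
qed

lemma pd1_pd2_V: "q \<in> Om \<Longrightarrow> pd1 (pd2 V) q = pd2 F q"
  using pd_commute[OF hol2_V open_Om] pd2_cong[OF open_Om _ pd1_V, of q] by simp

lemma pd2_power: "hol2 S f \<Longrightarrow> open S \<Longrightarrow> q \<in> S \<Longrightarrow> pd2 (\<lambda>q. f q ^ 3) q = 3 * f q ^ 2 * pd2 f q"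
  unfolding power3_eq_cube
  using pd2_mult[of S f f q] pd2_mult[of S "\<lambda>q. f q * f q" f q] hol2_mult[of S f f]
  by (simp add: power2_eq_square algebra_simps)

lemma pd2_zc: "pd2 (\<lambda>q. zc (fst q)) q = 0"
  by (simp add: pd2_def)

lemma pd2_A: "q \<in> Om \<Longrightarrow> pd2 (\<lambda>q. V q ^ 3 - V q + zc (fst q)) q = (3 * V q ^ 2 - 1) * pd2 V q"
  using pd2_add[OF hol2_diff[OF hol2_power[OF hol2_V, of 3] hol2_V] hol2_zc open_Om, of q]
    pd2_diff[OF hol2_power[OF hol2_V, of 3] hol2_V open_Om, of q] pd2_power[OF hol2_V open_Om, of q] pd2_zc[of q]
  by (simp add: algebra_simps)

lemma pd1_pd2_F: "q \<in> Om \<Longrightarrow> pd1 (pd2 F) q = (3 * V q ^ 2 - 1) * pd2 V q"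
  using pd_commute[OF hol2_F open_Om] pd2_cong[OF open_Om _ pd1_F, of q] pd2_A[of q] by simp

text \<open>For real data the conjugate of a solution solves the same problem, and solutions are
  unique.\<close>

lemma V_F_real:
  assumes "x \<ge> 0" "(complex_of_real x, complex_of_real s) \<in> Om"
  shows "V (of_real x, of_real s) \<in> \<real>" "F (of_real x, of_real s) \<in> \<real>"
proof -
  obtain v where v: "sol (of_real x) (of_real s) v" using assms Om_imp_sol by blast
  have zcr: "cnj (zc (of_real x * of_real t)) = zc (of_real x * of_real t)" if "t \<in> {0..1}" for t :: real
    using zc_real[of "x * t"] assms(1) that by simp
  have r: "rhs (of_real x) (\<lambda>y. cnj (v y)) t = cnj (rhs (of_real x) v t)" if "t \<in> {0..1}" for t
    using zcr[OF that] by (simp add: rhs_def)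
  have w: "vel (of_real x) (of_real s) (\<lambda>y. cnj (v y)) y = cnj (vel (of_real x) (of_real s) v y)" if "y \<in> {0..1}" for y
  proof -
    have "integral {0..y} (rhs (of_real x) (\<lambda>y. cnj (v y))) = cnj (integral {0..y} (rhs (of_real x) v))"
      unfolding integral_cnj by (rule integral_cong) (use r that in auto)
    then show ?thesis by (simp add: vel_def)
  qed
  have p: "pos (of_real x) (of_real s) (\<lambda>y. cnj (v y)) y = cnj (pos (of_real x) (of_real s) v y)" if "y \<in> {0..1}" for y
  proof -
    have "integral {0..y} (vel (of_real x) (of_real s) (\<lambda>y. cnj (v y))) = cnj (integral {0..y} (vel (of_real x) (of_real s) v))"
      unfolding integral_cnj by (rule integral_cong) (use w that in auto)
    then show ?thesis by (simp add: pos_def)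
  qed
  have s: "sol (of_real x) (of_real s) (\<lambda>y. cnj (v y))"
    using v p by (auto simp: sol_def intro!: continuous_intros)
  show "V (of_real x, of_real s) \<in> \<real>"
    using sol_imp(2)[OF v] sol_imp(2)[OF s] by (simp add: Reals_cnj_iff)
  show "F (of_real x, of_real s) \<in> \<real>"
    using sol_imp(3)[OF v] sol_imp(3)[OF s] w[of 1] by (simp add: Reals_cnj_iff)
qed

text \<open>A uniform bound on the trajectories excludes blow-up in the limit. It also bounds
  right-hand sides and velocities, so Arzela-Ascoli provides a limit function, and dominated
  convergence carries both integral equations over to it.\<close>

lemma Om_closure:
  assumes L: "Ls \<longlonglongrightarrow> L" "\<And>n::nat. 0 \<le> Ls n" and s: "ss \<longlonglongrightarrow> s"
    and Om: "\<And>n. (complex_of_real (Ls n), complex_of_real (ss n)) \<in> Om"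
    and bd: "\<And>n t. t \<in> {0..1} \<Longrightarrow> norm (V (of_real (Ls n * t), of_real (ss n))) \<le> C"
  shows "(complex_of_real L, complex_of_real s) \<in> Om"
proof -
  have L0: "0 \<le> L" using L by (metis LIMSEQ_le_const)
  obtain v where v: "\<And>n. sol (of_real (Ls n)) (of_real (ss n)) (v n)" using Om_imp_sol[OF Om] by metis
  have vV: "v n t = V (of_real (Ls n * t), of_real (ss n))" if "t \<in> {0..1}" for n t
    using sol_rescale_values(2)[OF v that] by simp
  have vb: "norm (v n t) \<le> C" if "t \<in> {0..1}" for n t using bd[OF that] vV[OF that] by simp
  have C: "C \<ge> 0" using order_trans[OF norm_ge_zero vb[of 0 0]] by simp
  have seg: "seg (of_real (Ls n))" and cv: "continuous_on {0..1} (v n)" for n using v by (auto simp: sol_def)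
  have vp: "v n y = pos (of_real (Ls n)) (of_real (ss n)) (v n) y" if "y \<in> {0..1}" for n y
    using v that by (auto simp: sol_def)
  obtain BL where BL: "\<And>n. \<bar>Ls n\<bar> \<le> BL" using L(1) convergent_imp_Bseq[of Ls] by (auto simp: convergent_def Bseq_def)
  obtain BS where BS: "\<And>n. \<bar>ss n\<bar> \<le> BS" using s convergent_imp_Bseq[of ss] by (auto simp: convergent_def Bseq_def)
  have BL0: "BL \<ge> 0" using BL[of 0] by linarith
  define R where "R = C ^ 3 + C + 1"
  have R: "R \<ge> 0" using C by (simp add: R_def)
  have rb: "norm (rhs (of_real (Ls n)) (v n) t) \<le> R" if t: "t \<in> {0..1}" for n t
  proof -
    have "norm (zc (of_real (Ls n) * of_real t)) \<le> 1"
      using zc_real[of "Ls n * t"] zeta_bounds[of "Ls n * t"] L(2)[of n] t by simp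
    moreover have "norm (v n t ^ 3) \<le> C ^ 3" unfolding norm_power by (intro power_mono vb t) auto
    ultimately show ?thesis unfolding rhs_def R_def
      using vb[OF t, of n] norm_triangle_ineq[of "v n t ^ 3 - v n t" "zc (of_real (Ls n) * of_real t)"]
        norm_triangle_ineq4[of "v n t ^ 3" "v n t"] by linarith
  qed
  define M where "M = BS + BL * R"
  have M: "M \<ge> 0" using BS[of 0] BL0 R by (simp add: M_def)
  have wb: "norm (vel (of_real (Ls n)) (of_real (ss n)) (v n) y) \<le> M" if y: "y \<in> {0..1}" for n y
  proof -
    have "norm (integral {0..y} (rhs (of_real (Ls n)) (v n))) \<le> R * (y - 0)"
    proof (rule integral_bound)
      show "continuous_on {0..y} (rhs (of_real (Ls n)) (v n))"
        by (rule continuous_on_subset[OF continuous_rhs[OF seg cv]]) (use y in auto)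
    qed (use rb y in auto)
    also have "\<dots> \<le> R * 1" using R y by (intro mult_left_mono) auto
    finally have 1: "norm (integral {0..y} (rhs (of_real (Ls n)) (v n))) \<le> R" by simp
    have "norm (of_real (Ls n) * integral {0..y} (rhs (of_real (Ls n)) (v n))) \<le> BL * R"
      unfolding norm_mult by (rule mult_mono) (use BL[of n] 1 BL0 in auto)
    then show ?thesis unfolding vel_def M_def
      using BS[of n] norm_triangle_ineq[of "of_real (ss n)" "of_real (Ls n) * integral {0..y} (rhs (of_real (Ls n)) (v n))"]
      by simp
  qed
  have lip: "norm (v n x - v n y) \<le> BL * M * norm (x - y)" if "x \<in> {0..1}" "y \<in> {0..1}" for n x y
  proof (rule differentiable_bound[OF _ _ _ that])
    fix z :: real assume z: "z \<in> {0..1}"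
    let ?w = "of_real (Ls n) * vel (of_real (Ls n)) (of_real (ss n)) (v n) z"
    have "(v n has_vector_derivative ?w) (at z within {0..1})"
      using has_vector_derivative_transform[OF z vp pos_has_derivative[OF seg cv z]] by blast
    then show "(v n has_derivative (\<lambda>h. h *\<^sub>R ?w)) (at z within {0..1})"
      by (simp add: has_vector_derivative_def)
    have "norm ?w \<le> BL * M" unfolding norm_mult by (rule mult_mono) (use BL[of n] wb[OF z, of n] BL0 in auto)
    then show "onorm (\<lambda>h. h *\<^sub>R ?w) \<le> BL * M"
      by (intro onorm_bound) (auto intro: order_trans[OF mult_right_mono] simp: mult.commute BL0 M mult_left_mono)
  qed auto
  obtain g k where gk: "continuous_on {0..1} g" "strict_mono (k :: nat \<Rightarrow> nat)"
      "\<And>e. 0 < e \<Longrightarrow> \<exists>N. \<forall>n x. n \<ge> N \<and> x \<in> {0..1} \<longrightarrow> norm (v (k n) x - g x) < e"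
  proof (rule Arzela_Ascoli[of "{0..1::real}" v C])
    fix x e :: real assume x: "x \<in> {0..1}" and e: "0 < e"
    define d where "d = e / (BL * M + 1)"
    have d: "d > 0" using e BL0 M by (simp add: d_def add_nonneg_pos)
    have "norm (v n x - v n y) < e" if "y \<in> {0..1}" "norm (x - y) < d" for n y
    proof -
      have "norm (v n x - v n y) \<le> (BL * M + 1) * norm (x - y)"
        using lip[OF x that(1), of n] by (simp add: algebra_simps add_increasing)
      also have "\<dots> < (BL * M + 1) * d" using that(2) BL0 M by (intro mult_strict_left_mono) (auto simp: add_nonneg_pos)
      also have "\<dots> = e" using BL0 M by (simp add: d_def add_nonneg_eq_0_iff)
      finally show ?thesis .
    qed
    then show "\<exists>d>0. \<forall>n y. y \<in> {0..1} \<and> norm (x - y) < d \<longrightarrow> norm (v n x - v n y) < e"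
      using d by blast
  qed (use vb in auto)
  have kL: "(\<lambda>n. Ls (k n)) \<longlonglongrightarrow> L" and ks: "(\<lambda>n. ss (k n)) \<longlonglongrightarrow> s"
    using LIMSEQ_subseq_LIMSEQ[OF L(1) gk(2)] LIMSEQ_subseq_LIMSEQ[OF s gk(2)] by (auto simp: o_def)
  have vg: "(\<lambda>n. v (k n) x) \<longlonglongrightarrow> g x" if "x \<in> {0..1}" for x
    unfolding LIMSEQ_iff using gk(3) that by blast
  have segL: "seg (of_real L)" using zc_real L0 by (auto simp: seg_def simp flip: of_real_mult)
  have rlim: "(\<lambda>n. rhs (of_real (Ls (k n))) (v (k n)) t) \<longlonglongrightarrow> rhs (of_real L) g t" if t: "t \<in> {0..1}" for t
  proof -
    have "isCont zc (of_real L * of_real t)"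
      using holomorphic_on_imp_continuous_on[OF zc_hol] open_N segL t
      by (auto simp: seg_def continuous_on_eq_continuous_at)
    then have "(\<lambda>n. zc (of_real (Ls (k n)) * of_real t)) \<longlonglongrightarrow> zc (of_real L * of_real t)"
      by (rule isCont_tendsto_compose) (intro tendsto_intros kL)
    then show ?thesis unfolding rhs_def by (intro tendsto_intros vg t)
  qed
  have wlim: "(\<lambda>n. vel (of_real (Ls (k n))) (of_real (ss (k n))) (v (k n)) y) \<longlonglongrightarrow> vel (of_real L) (of_real s) g y" if y: "y \<in> {0..1}" for y
  proof -
    have "(\<lambda>n. integral {0..y} (rhs (of_real (Ls (k n))) (v (k n)))) \<longlonglongrightarrow> integral {0..y} (rhs (of_real L) g)"
    proof (rule dominated_convergence(2)[where h = "\<lambda>_. R"])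
      show "rhs (of_real (Ls (k n))) (v (k n)) integrable_on {0..y}" for n
        by (intro integrable_continuous_interval continuous_on_subset[OF continuous_rhs[OF seg cv]]) (use y in auto)
    qed (use rb rlim y in auto)
    then show ?thesis unfolding vel_def by (intro tendsto_intros kL ks)
  qed
  have plim: "(\<lambda>n. pos (of_real (Ls (k n))) (of_real (ss (k n))) (v (k n)) y) \<longlonglongrightarrow> pos (of_real L) (of_real s) g y" if y: "y \<in> {0..1}" for y
  proof -
    have "(\<lambda>n. integral {0..y} (vel (of_real (Ls (k n))) (of_real (ss (k n))) (v (k n)))) \<longlonglongrightarrow> integral {0..y} (vel (of_real L) (of_real s) g)"
    proof (rule dominated_convergence(2)[where h = "\<lambda>_. M"])
      show "vel (of_real (Ls (k n))) (of_real (ss (k n))) (v (k n)) integrable_on {0..y}" for n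
        by (intro integrable_continuous_interval continuous_on_subset[OF continuous_vel[OF seg cv]]) (use y in auto)
    qed (use wb wlim y in auto)
    then show ?thesis unfolding pos_def by (intro tendsto_intros kL)
  qed
  have "g y = pos (of_real L) (of_real s) g y" if y: "y \<in> {0..1}" for y
    using LIMSEQ_unique[OF vg[OF y]] plim[OF y] vp[OF y] by simp
  then have "sol (of_real L) (of_real s) g" using segL gk(1) by (simp add: sol_def)
  then show ?thesis by (rule sol_imp(1))
qed

end

section \<open>The real solutions and the branch points\<close>

text \<open>A maximum above \<open>C\<close> is not at 0, and \<open>g'\<close> vanishes there, at
  the right end by the hypothesis on \<open>g' L\<close>. Then \<open>g'' > 0\<close> makes
  \<open>g'\<close> negative just to the left, where \<open>g\<close> would be larger still.\<close>

lemma max_principle: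
  fixes g g' :: "real \<Rightarrow> real"
  assumes "0 \<le> L"
    and g: "\<And>x. x \<in> {0..L} \<Longrightarrow> (g has_real_derivative g' x) (at x)"
    and g': "\<And>x. x \<in> {0..L} \<Longrightarrow> (g' has_real_derivative g'' x) (at x)"
    and "g' L = 0" "g 0 \<le> C" and pos: "\<And>x. x \<in> {0..L} \<Longrightarrow> g x > C \<Longrightarrow> g'' x > 0"
    and x: "x \<in> {0..L}"
  shows "g x \<le> C"
proof (rule ccontr)
  assume "\<not> g x \<le> C"
  have "continuous_on {0..L} g"
    using g DERIV_isCont continuous_at_imp_continuous_on by blast
  then obtain x1 where x1: "x1 \<in> {0..L}" "\<And>y. y \<in> {0..L} \<Longrightarrow> g y \<le> g x1"
    using continuous_attains_sup[of "{0..L}" g] x by auto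
  have gC: "g x1 > C" using x1(2)[OF x] \<open>\<not> g x \<le> C\<close> by simp
  have x10: "x1 > 0" using gC \<open>g 0 \<le> C\<close> x1(1) by (cases "x1 = 0") auto
  have crit: "g' x1 = 0"
  proof (cases "x1 = L")
    case False
    define d where "d = min x1 (L - x1)"
    have d: "d > 0" using False x1(1) x10 by (auto simp: d_def)
    show ?thesis
      by (rule DERIV_local_max[OF g[OF x1(1)] d]) (auto simp: d_def intro!: x1(2))
  qed (use assms in simp)
  obtain d where d: "d > 0" "\<And>h. 0 < h \<Longrightarrow> h < d \<Longrightarrow> g' (x1 - h) < g' x1"
    using DERIV_pos_inc_left[OF g'[OF x1(1)] pos[OF x1(1) gC]] by blast
  define h where "h = min x1 (d/2)"
  have h: "0 < h" "h \<le> x1" "h < d" using x10 d by (auto simp: h_def)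
  have "\<exists>z. x1 - h < z \<and> z < x1 \<and> g x1 - g (x1 - h) = (x1 - (x1 - h)) * g' z"
    by (rule MVT2) (use h x1(1) in \<open>auto intro!: g\<close>)
  then obtain z where z: "x1 - h < z" "z < x1" "g x1 - g (x1 - h) = h * g' z" by auto
  have "g' z < 0" using d(2)[of "x1 - z"] z h crit by simp
  then have "g x1 < g (x1 - h)" using z h(1) by (smt (verit) mult_pos_neg)
  moreover have "g (x1 - h) \<le> g x1" by (rule x1(2)) (use h x1(1) in auto)
  ultimately show False by simp
qed

text \<open>Gronwall's argument run backwards: the weight makes \<open>G\<close> nondecreasing, so
  its vanishing at \<open>x0\<close> is inherited by 0.\<close>

lemma linear_system_unique:
  fixes a b h :: "real \<Rightarrow> real"
  assumes a: "\<And>x. x \<in> {0..L} \<Longrightarrow> (a has_real_derivative \<alpha> * b x) (at x within {0..L})"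
    and b: "\<And>x. x \<in> {0..L} \<Longrightarrow> (b has_real_derivative \<alpha> * h x * a x) (at x within {0..L})"
    and h: "\<And>x. x \<in> {0..L} \<Longrightarrow> \<bar>h x\<bar> \<le> M" and x0: "x0 \<in> {0..L}" "a x0 = 0" "b x0 = 0"
  shows "a 0 = 0" "b 0 = 0"
proof -
  define K where "K = \<bar>\<alpha>\<bar> * (1 + M)"
  define G where "G x = exp (K * x) * ((a x)\<^sup>2 + (b x)\<^sup>2)" for x
  have M: "M \<ge> 0" using h[OF x0(1)] by linarith
  have "G 0 \<le> G x0"
  proof (cases "x0 = 0")
    case False
    then have "0 < x0" using x0 by simp
    have der: "(G has_real_derivative exp (K * x) * (K * ((a x)\<^sup>2 + (b x)\<^sup>2) + 2 * \<alpha> * (1 + h x) * a x * b x)) (at x within {0..x0})"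
      if "x \<in> {0..x0}" for x
    proof -
      have sub: "{0..x0} \<subseteq> {0..L}" "x \<in> {0..L}" using that x0 by auto
      show ?thesis unfolding G_def[abs_def]
        by (rule derivative_eq_intros refl has_field_derivative_subset[OF a[OF sub(2)] sub(1)]
             has_field_derivative_subset[OF b[OF sub(2)] sub(1)])+ (simp add: algebra_simps power2_eq_square)
    qed
    have "\<exists>x\<in>{0..x0}. G x0 - G 0 = (exp (K * x) * (K * ((a x)\<^sup>2 + (b x)\<^sup>2) + 2 * \<alpha> * (1 + h x) * a x * b x)) * (x0 - 0)"
      by (rule mvt_very_simple) (use \<open>0 < x0\<close> der in \<open>auto simp: has_field_derivative_def\<close>)
    then obtain x where x: "x \<in> {0..x0}" "G x0 - G 0 = (exp (K * x) * (K * ((a x)\<^sup>2 + (b x)\<^sup>2) + 2 * \<alpha> * (1 + h x) * a x * b x)) * x0"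
      by auto
    have "\<bar>2 * \<alpha> * (1 + h x) * a x * b x\<bar> = (\<bar>\<alpha>\<bar> * \<bar>1 + h x\<bar>) * \<bar>2 * a x * b x\<bar>"
      by (simp add: abs_mult)
    also have "\<dots> \<le> K * ((a x)\<^sup>2 + (b x)\<^sup>2)"
    proof (rule mult_mono)
      show "\<bar>\<alpha>\<bar> * \<bar>1 + h x\<bar> \<le> K" unfolding K_def using h[of x] x x0 by (intro mult_left_mono) auto
      show "\<bar>2 * a x * b x\<bar> \<le> (a x)\<^sup>2 + (b x)\<^sup>2"
        using sum_squares_bound[of "a x" "b x"] sum_squares_bound[of "- a x" "b x"] by (simp add: abs_le_iff)
    qed (use M in \<open>auto simp: K_def\<close>)
    finally have "0 \<le> K * ((a x)\<^sup>2 + (b x)\<^sup>2) + 2 * \<alpha> * (1 + h x) * a x * b x" by linarith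
    then have "0 \<le> G x0 - G 0" using x \<open>0 < x0\<close> by simp
    then show ?thesis by simp
  qed simp
  then have "(a 0)\<^sup>2 + (b 0)\<^sup>2 \<le> 0" using x0 by (simp add: G_def)
  then show "a 0 = 0" "b 0 = 0" by (simp_all add: sum_power2_le_zero_iff)
qed

text \<open>Pruefer's substitution: the angle below is the argument of \<open>Z + \<i> W\<close>.\<close>

lemma pruefer_angle:
  fixes W Z h :: "real \<Rightarrow> real"
  assumes W: "\<And>x. x \<in> {0..1} \<Longrightarrow> (W has_real_derivative \<alpha> * Z x) (at x within {0..1})"
    and Z: "\<And>x. x \<in> {0..1} \<Longrightarrow> (Z has_real_derivative \<alpha> * h x * W x) (at x within {0..1})"
    and h: "continuous_on {0..1} h" and init: "W 0 = 0" and ne: "\<And>x. x \<in> {0..1} \<Longrightarrow> (W x)\<^sup>2 + (Z x)\<^sup>2 \<noteq> 0"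
    and "Z 1 = 0"
  shows "cos (\<alpha> * integral {0..1} (\<lambda>x. ((Z x)\<^sup>2 - h x * (W x)\<^sup>2) / ((W x)\<^sup>2 + (Z x)\<^sup>2))) = 0"
proof -
  define g where "g x = ((Z x)\<^sup>2 - h x * (W x)\<^sup>2) / ((W x)\<^sup>2 + (Z x)\<^sup>2)" for x
  define \<theta> where "\<theta> x = \<alpha> * integral {0..x} g" for x
  have cW: "continuous_on {0..1} W" and cZ: "continuous_on {0..1} Z"
    by (rule DERIV_continuous_on[OF W], assumption) (rule DERIV_continuous_on[OF Z], assumption)
  have "continuous_on {0..1} g" unfolding g_def[abs_def]
    by (intro continuous_intros cW cZ h) (use ne in auto)
  then have d\<theta>: "(\<theta> has_real_derivative \<alpha> * g x) (at x within {0..1})" if "x \<in> {0..1}" for x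
    unfolding \<theta>_def[abs_def] using integral_has_real_derivative[of 0 1 g x] that
    by (auto intro!: derivative_eq_intros)
  define k where "k x = \<alpha> * (W x * Z x * (1 + h x) / ((W x)\<^sup>2 + (Z x)\<^sup>2))" for x
  \<comment> \<open>The cross product of \<open>(Z, W)\<close> with the direction \<theta>. It
    solves the homogeneous equation \<open>y' = k * y\<close> and starts at 0, so it vanishes; thus
    \<theta> is an argument without any lifting being constructed.\<close>
  define y where "y x = W x * cos (\<theta> x) - Z x * sin (\<theta> x)" for x
  have dy: "(y has_real_derivative k x * y x) (at x within {0..1})" if x: "x \<in> {0..1}" for x
  proof -
    have "(y has_real_derivative \<alpha> * (Z x * cos (\<theta> x) - h x * W x * sin (\<theta> x) - g x * (W x * sin (\<theta> x) + Z x * cos (\<theta> x)))) (at x within {0..1})"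
      unfolding y_def[abs_def]
      by (rule derivative_eq_intros refl W[OF x] Z[OF x] d\<theta>[OF x])+ (simp add: algebra_simps)
    moreover have "Z x * cos (\<theta> x) - h x * W x * sin (\<theta> x) - g x * (W x * sin (\<theta> x) + Z x * cos (\<theta> x))
        = W x * Z x * (1 + h x) / ((W x)\<^sup>2 + (Z x)\<^sup>2) * y x"
      using ne[OF x] unfolding g_def y_def by (simp add: field_simps power2_eq_square)
    ultimately show ?thesis by (simp add: k_def mult.assoc)
  qed
  have ck: "continuous_on {0..1} k" unfolding k_def[abs_def]
    by (intro continuous_intros cW cZ h) (use ne in auto)
  obtain K where "\<forall>y\<in>k ` {0..1}. norm y \<le> K"
    using compact_imp_bounded[OF compact_continuous_image[OF ck compact_Icc]] unfolding bounded_iff by blast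
  then have K: "\<bar>k x\<bar> \<le> K" if "x \<in> {0..1}" for x using that by simp
  \<comment> \<open>The weight turns the bound \<open>K\<close> for \<open>k\<close> into
    monotonicity.\<close>
  define G where "G x = exp (- 2 * K * x) * (y x)\<^sup>2" for x
  have dG: "(G has_real_derivative exp (- 2 * K * x) * (2 * (k x - K) * (y x)\<^sup>2)) (at x within {0..1})" if x: "x \<in> {0..1}" for x
    unfolding G_def[abs_def]
    by (rule derivative_eq_intros refl dy[OF x])+ (simp add: algebra_simps power2_eq_square)
  have "\<exists>x\<in>{0..1}. G 1 - G 0 = (exp (- 2 * K * x) * (2 * (k x - K) * (y x)\<^sup>2)) * (1 - 0)"
    by (rule mvt_very_simple) (use dG in \<open>auto simp: has_field_derivative_def\<close>)
  then obtain x where x: "x \<in> {0..1}" "G 1 - G 0 = exp (- 2 * K * x) * (2 * (k x - K) * (y x)\<^sup>2)" by auto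
  have "2 * (k x - K) * (y x)\<^sup>2 \<le> 0" by (rule mult_nonpos_nonneg) (use K[OF x(1)] in auto)
  then have "exp (- 2 * K * x) * (2 * (k x - K) * (y x)\<^sup>2) \<le> 0" by (rule mult_nonneg_nonpos[rotated]) simp
  then have "G 1 \<le> G 0" using x(2) by linarith
  also have "G 0 = 0" by (simp add: G_def y_def \<theta>_def init)
  finally have "y 1 = 0" by (simp add: G_def mult_le_0_iff)
  moreover have "W 1 \<noteq> 0" using ne[of 1] \<open>Z 1 = 0\<close> by auto
  ultimately have "cos (\<theta> 1) = 0" using \<open>Z 1 = 0\<close> by (simp add: y_def)
  then show ?thesis by (simp add: \<theta>_def g_def[abs_def])
qed

context ivp
begin

section \<open>Restriction to real lengths and slopes\<close>

definition cpt :: "real \<Rightarrow> real \<Rightarrow> complex \<times> complex" where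
  "cpt x s = (of_real x, of_real s)"

definition dom :: "real \<Rightarrow> real \<Rightarrow> bool" where
  "dom x s \<longleftrightarrow> x \<ge> 0 \<and> cpt x s \<in> Om"

text \<open>\<open>V\<close>, \<open>V'\<close> and their derivatives in the initial slope; meaningful only on \<open>dom\<close>.\<close>

definition rV where "rV x s = Re (V (cpt x s))"
definition rF where "rF x s = Re (F (cpt x s))"
definition rW where "rW x s = Re (pd2 V (cpt x s))"
definition rZ where "rZ x s = Re (pd2 F (cpt x s))"

lemma dom_mono: "dom X s \<Longrightarrow> 0 \<le> x \<Longrightarrow> x \<le> X \<Longrightarrow> dom x s"
  using Om_scale[of "of_real X" "of_real s" "x / X"]
  by (cases "X = 0") (auto simp: dom_def cpt_def simp flip: of_real_mult of_real_divide)

lemma open_real_Om: "open {p. cpt (fst p) (snd p) \<in> Om}"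
proof -
  have "continuous_on UNIV (\<lambda>p. cpt (fst p) (snd p))"
    unfolding cpt_def by (intro continuous_intros)
  then show ?thesis using open_vimage[OF open_Om] by (simp add: vimage_def)
qed

lemma real_continuous:
  assumes "hol2 Om H"
  shows "continuous_on {p. cpt (fst p) (snd p) \<in> Om} (\<lambda>p. Re (H (cpt (fst p) (snd p))))"
  by (intro continuous_on_Re continuous_on_compose2[OF hol2_cont[OF assms]])
     (auto simp: cpt_def intro!: continuous_intros)

lemma hol2_W: "hol2 Om (pd2 V)" and hol2_Z: "hol2 Om (pd2 F)"
  by (intro hol2_pd2 hol2_V hol2_F open_Om)+

lemma real_D1:
  assumes "hol2 Om H" "dom x s"
  shows "((\<lambda>x. Re (H (cpt x s))) has_real_derivative Re (pd1 H (cpt x s))) (at x)"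
  using Re_has_real_derivative[OF hol2_D1[OF assms(1) open_Om, of "of_real x" "of_real s"]] assms(2)
  by (simp add: dom_def cpt_def)

lemma real_D2:
  assumes "hol2 Om H" "dom x s"
  shows "((\<lambda>s. Re (H (cpt x s))) has_real_derivative Re (pd2 H (cpt x s))) (at s)"
  using Re_has_real_derivative[OF hol2_D2[OF assms(1) open_Om, of "of_real x" "of_real s"]] assms(2)
  by (simp add: dom_def cpt_def)

lemma dom_eventually:
  assumes "dom x s"
  shows "\<forall>\<^sub>F s' in nhds s. dom x s'"
proof -
  have "open ((\<lambda>s'. (x, s')) -` {p. cpt (fst p) (snd p) \<in> Om})"
    by (intro open_vimage open_real_Om continuous_intros)
  then show ?thesis
    using eventually_nhds_in_open[of "(\<lambda>s'. (x, s')) -` {p. cpt (fst p) (snd p) \<in> Om}" s] assms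
    by (auto simp: dom_def)
qed

lemma of_real_rV: "dom x s \<Longrightarrow> V (cpt x s) = of_real (rV x s)"
  and of_real_rF: "dom x s \<Longrightarrow> F (cpt x s) = of_real (rF x s)"
  using V_F_real by (auto simp: dom_def cpt_def rV_def rF_def of_real_Re)

lemma of_real_rW: "dom x s \<Longrightarrow> pd2 V (cpt x s) = of_real (rW x s)"
  and of_real_rZ: "dom x s \<Longrightarrow> pd2 F (cpt x s) = of_real (rZ x s)"
proof -
  assume d: "dom x s"
  then have m: "(of_real x, of_real s) \<in> Om" by (simp add: dom_def cpt_def)
  have "\<forall>\<^sub>F s' in nhds s. V (of_real x, of_real s') \<in> \<real>" "\<forall>\<^sub>F s' in nhds s. F (of_real x, of_real s') \<in> \<real>"
    using dom_eventually[OF d] by (auto elim!: eventually_mono simp: dom_def cpt_def V_F_real)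
  then have "pd2 V (cpt x s) \<in> \<real>" "pd2 F (cpt x s) \<in> \<real>"
    using real_valued_imp_derivative_real[OF hol2_D2[OF hol2_V open_Om m]]
      real_valued_imp_derivative_real[OF hol2_D2[OF hol2_F open_Om m]] by (auto simp: cpt_def)
  then show "pd2 V (cpt x s) = of_real (rW x s)" "pd2 F (cpt x s) = of_real (rZ x s)"
    by (simp_all add: rW_def rZ_def of_real_Re)
qed

lemma dom_Om: "dom x s \<Longrightarrow> cpt x s \<in> Om" by (simp add: dom_def)

lemma rV_x: "dom x s \<Longrightarrow> ((\<lambda>x. rV x s) has_real_derivative rF x s) (at x)"
  unfolding rV_def rF_def using real_D1[OF hol2_V] pd1_V[OF dom_Om] by simp

lemma rF_x: "dom x s \<Longrightarrow> ((\<lambda>x. rF x s) has_real_derivative rV x s ^ 3 - rV x s + \<zeta> x) (at x)"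
  using real_D1[OF hol2_F, of x s] pd1_F[OF dom_Om, of x s] of_real_rV[of x s] zc_real[of x]
  unfolding rF_def[symmetric] by (simp add: dom_def cpt_def flip: of_real_power of_real_diff of_real_add)

lemma rW_x: "dom x s \<Longrightarrow> ((\<lambda>x. rW x s) has_real_derivative rZ x s) (at x)"
  unfolding rW_def rZ_def using real_D1[OF hol2_W] pd1_pd2_V[OF dom_Om] by simp

lemma rZ_x: "dom x s \<Longrightarrow> ((\<lambda>x. rZ x s) has_real_derivative (3 * rV x s ^ 2 - 1) * rW x s) (at x)"
proof -
  assume d: "dom x s"
  have "(3 * V (cpt x s) ^ 2 - 1) * pd2 V (cpt x s) = of_real ((3 * rV x s ^ 2 - 1) * rW x s)"
    by (simp add: of_real_rV[OF d] of_real_rW[OF d])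
  then have "Re (pd1 (pd2 F) (cpt x s)) = (3 * rV x s ^ 2 - 1) * rW x s"
    using pd1_pd2_F[OF dom_Om[OF d]] by (metis Re_complex_of_real)
  then show ?thesis using real_D1[OF hol2_Z d] unfolding rZ_def[symmetric] by simp
qed

lemma rF_s: "dom x s \<Longrightarrow> ((\<lambda>s. rF x s) has_real_derivative rZ x s) (at s)"
  unfolding rF_def rZ_def by (rule real_D2[OF hol2_F])

lemma r_init: "rV 0 s = c0" "rF 0 s = s" "rW 0 s = 0" "rZ 0 s = 1"
proof -
  show "rV 0 s = c0" "rF 0 s = s" using Om_zero by (simp_all add: rV_def rF_def cpt_def)
  have V0: "(\<lambda>u. V (0,u)) = (\<lambda>u. of_real c0)" and F0: "(\<lambda>u. F (0,u)) = (\<lambda>u. u)"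
    using Om_zero by auto
  have "pd2 V (0, of_real s) = 0" "pd2 F (0, of_real s) = 1"
    unfolding pd2_def fst_conv snd_conv V0 F0 by simp_all
  then show "rW 0 s = 0" "rZ 0 s = 1" by (simp_all add: rW_def rZ_def cpt_def)
qed

section \<open>A priori bounds and compactness of the set of branch points\<close>

text \<open>Beyond modulus 2 the cubic \<open>v^3 - v\<close> exceeds 1 in modulus and so dominates
  the forcing; \<open>\<bar>c0\<bar>\<close> takes care of the initial value.\<close>

definition C0 :: real where "C0 = max \<bar>c0\<bar> 2"

text \<open>With an arbitrary slope the cubic term may cause blow-up. A vanishing velocity at the
  end is the Neumann condition that lets the maximum principle bound \<open>V\<close> and
  \<open>-V\<close>, independently of \<open>L\<close> and \<open>s\<close>.\<close>

lemma rV_bound: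
  assumes d: "dom L s" and "rF L s = 0" and x: "x \<in> {0..L}"
  shows "\<bar>rV x s\<bar> \<le> C0"
proof -
  have L: "0 \<le> L" using x by simp
  have dx: "dom x s" if "x \<in> {0..L}" for x using dom_mono[OF d] that by auto
  have big: "v ^ 3 - v > 1" if "v > 2" for v :: real
  proof -
    have "v * (2 * 2) \<le> v * v * v" using that unfolding mult.assoc by (intro mult_left_mono mult_mono) auto
    then show ?thesis using that unfolding power3_eq_cube by linarith
  qed
  have "rV x s \<le> C0"
  proof (rule max_principle[OF L, where g = "\<lambda>x. rV x s" and g' = "\<lambda>x. rF x s"])
    show "rV x s ^ 3 - rV x s + \<zeta> x > 0" if "x \<in> {0..L}" "rV x s > C0" for x
      using big[of "rV x s"] that zeta_bounds[of x] by (auto simp: C0_def)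
  qed (use dx rV_x rF_x assms r_init in \<open>auto simp: C0_def\<close>)
  moreover have "- rV x s \<le> C0"
  proof (rule max_principle[OF L, where g = "\<lambda>x. - rV x s" and g' = "\<lambda>x. - rF x s" and g'' = "\<lambda>x. - (rV x s ^ 3 - rV x s + \<zeta> x)"])
    show "- (rV x s ^ 3 - rV x s + \<zeta> x) > 0" if "x \<in> {0..L}" "- rV x s > C0" for x
      using big[of "- rV x s"] that zeta_bounds[of x] by (auto simp: C0_def)
    show "((\<lambda>x. - rV x s) has_real_derivative - rF x s) (at x)" if "x \<in> {0..L}" for x
      by (rule DERIV_minus[OF rV_x[OF dx[OF that]]])
    show "((\<lambda>x. - rF x s) has_real_derivative - (rV x s ^ 3 - rV x s + \<zeta> x)) (at x)" if "x \<in> {0..L}" for x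
      by (rule DERIV_minus[OF rF_x[OF dx[OF that]]])
  qed (use assms r_init in \<open>auto simp: C0_def\<close>)
  ultimately show ?thesis by simp
qed

definition K0 :: real where "K0 = C0 ^ 3 + C0 + 1"

lemma C0_ge: "C0 \<ge> 2" by (simp add: C0_def)

lemma K0_pos: "K0 > 0" using C0_ge by (simp add: K0_def add_pos_pos)

lemma rhs_bound:
  assumes "\<bar>v\<bar> \<le> C0" "x \<ge> 0"
  shows "\<bar>v ^ 3 - v + \<zeta> x\<bar> \<le> K0"
proof -
  have "\<bar>v ^ 3\<bar> \<le> C0 ^ 3" unfolding power_abs by (intro power_mono assms) auto
  then show ?thesis using assms zeta_bounds[of x] by (auto simp: K0_def abs_le_iff)
qed

text \<open>Bounds the coefficient \<open>3 * V^2 - 1\<close> of the linearised equation; being at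
  least 1, it bounds the angular speed too.\<close>

definition M0 :: real where "M0 = 3 * C0\<^sup>2 + 1"

lemma M0_pos: "M0 \<ge> 1" by (simp add: M0_def)

lemma h_bound: "\<bar>v\<bar> \<le> C0 \<Longrightarrow> \<bar>3 * v\<^sup>2 - 1\<bar> \<le> M0"
proof -
  assume "\<bar>v\<bar> \<le> C0"
  then have "v\<^sup>2 \<le> C0\<^sup>2" by (simp add: power2_le_iff_abs_le C0_def)
  then show ?thesis unfolding M0_def abs_le_iff using zero_le_power2[of v] zero_le_power2[of C0] by linarith
qed

text \<open>The branch points as pairs of the length and the unscaled initial slope \<open>s = z / L\<close>.\<close>

definition B :: "(real \<times> real) set" where
  "B = {(L,s). L > 0 \<and> dom L s \<and> rF L s = 0 \<and> rZ L s = 0}"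

lemma B_D: "(L,s) \<in> B \<Longrightarrow> L > 0 \<and> dom L s \<and> rF L s = 0 \<and> rZ L s = 0"
  by (simp add: B_def)

lemma B_bound: "(L,s) \<in> B \<Longrightarrow> x \<in> {0..L} \<Longrightarrow> \<bar>rV x s\<bar> \<le> C0"
  using rV_bound B_D by blast

text \<open>The velocity goes from \<open>s\<close> to 0 over the length \<open>L\<close> while the
  acceleration is at most \<open>K0\<close>. Hence the slopes of branch points of bounded length are
  bounded.\<close>

lemma B_slope_bound:
  assumes "(L,s) \<in> B"
  shows "\<bar>s\<bar> \<le> K0 * L"
proof -
  have b: "L > 0" "dom L s" "rF L s = 0" using B_D[OF assms] by auto
  have dx: "dom x s" if "x \<in> {0..L}" for x using dom_mono[OF b(2)] that by auto
  have "\<exists>z. 0 < z \<and> z < L \<and> rF L s - rF 0 s = (L - 0) * (rV z s ^ 3 - rV z s + \<zeta> z)"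
    by (rule MVT2) (use b dx in \<open>auto intro!: rF_x\<close>)
  then obtain z where z: "0 < z" "z < L" "- s = L * (rV z s ^ 3 - rV z s + \<zeta> z)" using b r_init by auto
  have "\<bar>s\<bar> = L * \<bar>rV z s ^ 3 - rV z s + \<zeta> z\<bar>"
    using z b(1) by (metis abs_minus_cancel abs_mult abs_of_pos)
  also have "\<dots> \<le> L * K0" using z b by (intro mult_left_mono rhs_bound B_bound[OF assms]) auto
  finally show ?thesis by (simp add: mult.commute)
qed

text \<open>\<open>(W, Z)\<close> solves a linear system with initial value \<open>(0, 1)\<close>; a
  common zero would propagate back to 0.\<close>

lemma WZ_nonzero:
  assumes "dom L s" "x \<in> {0..L}"
  shows "(rW x s)\<^sup>2 + (rZ x s)\<^sup>2 \<noteq> 0"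
proof
  assume z: "(rW x s)\<^sup>2 + (rZ x s)\<^sup>2 = 0"
  have dx: "dom x s" if "x \<in> {0..L}" for x using dom_mono[OF assms(1)] that by auto
  have "continuous_on {0..L} (\<lambda>x. rV x s)"
    using rV_x[OF dx] DERIV_isCont continuous_at_imp_continuous_on by blast
  then have "continuous_on {0..L} (\<lambda>x. 3 * (rV x s)\<^sup>2 - 1)" by (intro continuous_intros)
  then have "bounded ((\<lambda>x. 3 * (rV x s)\<^sup>2 - 1) ` {0..L})"
    by (intro compact_imp_bounded compact_continuous_image compact_Icc)
  then obtain M where "\<forall>y\<in>(\<lambda>x. 3 * (rV x s)\<^sup>2 - 1) ` {0..L}. norm y \<le> M"
    unfolding bounded_iff by blast
  then have M: "\<bar>3 * (rV x s)\<^sup>2 - 1\<bar> \<le> M" if "x \<in> {0..L}" for x using that by simp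
  have "rZ 0 s = 0"
    by (rule linear_system_unique(2)[of L "\<lambda>x. rW x s" 1 "\<lambda>x. rZ x s" "\<lambda>x. 3 * (rV x s)\<^sup>2 - 1" M x])
       (use z M assms in \<open>auto intro!: has_field_derivative_at_within rW_x rZ_x dx simp: sum_power2_eq_zero_iff\<close>)
  then show False using r_init by simp
qed

lemma B_W_nonzero: "(L,s) \<in> B \<Longrightarrow> rW L s \<noteq> 0"
  using WZ_nonzero[of L s L] B_D[of L s] by auto

definition ang_rate :: "real \<Rightarrow> real \<Rightarrow> real" where
  "ang_rate x s = ((rZ x s)\<^sup>2 - (3 * (rV x s)\<^sup>2 - 1) * (rW x s)\<^sup>2) / ((rW x s)\<^sup>2 + (rZ x s)\<^sup>2)"

text \<open>The total Pruefer angle over \<open>{0..L}\<close>, brought to \<open>{0..1}\<close> so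
  that it is an integral over a fixed interval, continuous in the parameters.\<close>

definition angle :: "real \<Rightarrow> real \<Rightarrow> real" where
  "angle L s = L * integral {0..1} (\<lambda>y. ang_rate (L * y) s)"

lemma cont_x:
  assumes "dom L s"
  shows "continuous_on {0..1} (\<lambda>y. rV (L * y) s)" "continuous_on {0..1} (\<lambda>y. rF (L * y) s)"
    "continuous_on {0..1} (\<lambda>y. rW (L * y) s)" "continuous_on {0..1} (\<lambda>y. rZ (L * y) s)"
    "continuous_on {0..1} (\<lambda>y. ang_rate (L * y) s)"
proof -
  have L: "0 \<le> L" using assms by (simp add: dom_def)
  have dx: "dom (L * y) s" if "y \<in> {0..1}" for y
    using dom_mono[OF assms, of "L * y"] L that by (simp add: mult_left_le)
  have *: "continuous_on {0..1} (\<lambda>y. Re (H (cpt (L * y) s)))" if "hol2 Om H" for H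
  proof -
    have "continuous_on {0..1} (\<lambda>y. (L * y, s))" by (intro continuous_intros)
    then show ?thesis
      using continuous_on_compose2[OF real_continuous[OF that], of "{0..1}" "\<lambda>y. (L * y, s)"] dx
      by (simp add: image_subset_iff dom_def)
  qed
  note c = *[OF hol2_V] *[OF hol2_F] *[OF hol2_W] *[OF hol2_Z]
  show 1: "continuous_on {0..1} (\<lambda>y. rV (L * y) s)" "continuous_on {0..1} (\<lambda>y. rF (L * y) s)"
    "continuous_on {0..1} (\<lambda>y. rW (L * y) s)" "continuous_on {0..1} (\<lambda>y. rZ (L * y) s)"
    using c by (simp_all add: rV_def rF_def rW_def rZ_def)
  show "continuous_on {0..1} (\<lambda>y. ang_rate (L * y) s)"
    unfolding ang_rate_def using WZ_nonzero[OF dx, of _ "L * _"] L by (intro continuous_intros 1) auto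
qed

lemma cos_angle_zero:
  assumes "(L,s) \<in> B"
  shows "cos (angle L s) = 0"
proof -
  have b: "L > 0" "dom L s" "rZ L s = 0" using B_D[OF assms] by auto
  have dx: "dom (L * y) s" if "y \<in> {0..1}" for y
    using dom_mono[OF b(2), of "L * y"] b that by (simp add: mult_left_le)
  have ch: "((\<lambda>y. G (L * y)) has_real_derivative L * G') (at y within {0..1})"
    if "(G has_real_derivative G') (at (L * y))" for G G' y
  proof -
    have "((\<lambda>y. G (L * y)) has_real_derivative G' * (L * 1)) (at y)"
      by (rule DERIV_chain2[where g = "\<lambda>y. L * y", OF that]) (auto intro!: derivative_eq_intros)
    then show ?thesis by (simp add: mult.commute has_field_derivative_at_within)
  qed
  show ?thesis unfolding angle_def ang_rate_def
  proof (rule pruefer_angle)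
    show "((\<lambda>y. rW (L * y) s) has_real_derivative L * rZ (L * y) s) (at y within {0..1})" if "y \<in> {0..1}" for y
      by (rule ch[OF rW_x[OF dx[OF that]]])
    show "((\<lambda>y. rZ (L * y) s) has_real_derivative L * (3 * (rV (L * y) s)\<^sup>2 - 1) * rW (L * y) s) (at y within {0..1})" if "y \<in> {0..1}" for y
      using ch[OF rZ_x[OF dx[OF that]]] by (simp add: mult.assoc)
    show "continuous_on {0..1} (\<lambda>y. 3 * (rV (L * y) s)\<^sup>2 - 1)" by (intro continuous_intros cont_x b)
    show "(rW (L * y) s)\<^sup>2 + (rZ (L * y) s)\<^sup>2 \<noteq> 0" if "y \<in> {0..1}" for y
      using WZ_nonzero[OF dx[OF that], of "L * y"] b that by simp
  qed (use b r_init in auto)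
qed

lemma ang_rate_bound:
  assumes "\<bar>rV x s\<bar> \<le> C0"
  shows "\<bar>ang_rate x s\<bar> \<le> M0"
proof -
  let ?N = "(rW x s)\<^sup>2 + (rZ x s)\<^sup>2"
  have "\<bar>(rZ x s)\<^sup>2 - (3 * (rV x s)\<^sup>2 - 1) * (rW x s)\<^sup>2\<bar> \<le> \<bar>(rZ x s)\<^sup>2\<bar> + \<bar>(3 * (rV x s)\<^sup>2 - 1) * (rW x s)\<^sup>2\<bar>" by linarith
  also have "\<dots> \<le> M0 * (rZ x s)\<^sup>2 + M0 * (rW x s)\<^sup>2"
    unfolding abs_mult using h_bound[OF assms] M0_pos
    by (intro add_mono mult_mono) (auto simp: mult_le_cancel_right1 intro: order_trans[OF _ mult_right_mono[of 1 M0]])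
  finally have "\<bar>(rZ x s)\<^sup>2 - (3 * (rV x s)\<^sup>2 - 1) * (rW x s)\<^sup>2\<bar> \<le> M0 * ?N" by (simp add: algebra_simps)
  then show ?thesis unfolding ang_rate_def abs_divide
    using M0_pos by (cases "?N = 0") (auto simp: divide_le_eq sum_power2_gt_zero_iff sum_power2_eq_zero_iff)
qed

text \<open>The angle starts at 0, must reach modulus \<open>pi / 2\<close> for its cosine to
  vanish, and turns at speed at most \<open>M0\<close>. Limits of branch points thus keep away from
  length 0.\<close>

lemma B_length_bound:
  assumes "(L,s) \<in> B"
  shows "L \<ge> 1 / M0"
proof -
  have b: "L > 0" "dom L s" using B_D[OF assms] by auto
  have "\<bar>integral {0..1} (\<lambda>y. ang_rate (L * y) s)\<bar> \<le> M0 * (1 - 0)"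
    unfolding real_norm_def[symmetric]
  proof (rule integral_bound[OF _ cont_x(5)[OF b(2)]])
    show "norm (ang_rate (L * y) s) \<le> M0" if "y \<in> {0..1}" for y
      using ang_rate_bound[OF B_bound[OF assms, of "L * y"]] b that by (simp add: mult_left_le)
  qed simp
  then have "\<bar>angle L s\<bar> \<le> L * M0" using b by (simp add: angle_def abs_mult)
  moreover have "\<bar>angle L s\<bar> \<ge> pi / 2"
  proof (rule ccontr)
    assume "\<not> ?thesis"
    then have "- (pi/2) < angle L s" "angle L s < pi/2" by linarith+
    then show False using cos_gt_zero_pi cos_angle_zero[OF assms] by fastforce
  qed
  ultimately have "1 \<le> L * M0" using pi_ge_two by linarith
  then show ?thesis using M0_pos by (simp add: divide_le_eq)
qed

text \<open>The domain of existence is only open in general; here the bound \<open>C0\<close> on all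
  trajectories supplies existence at the limit, and \<open>B_length_bound\<close> its positive
  length.\<close>

lemma B_closed:
  assumes "\<And>n::nat. (Ls n, ss n) \<in> B" "Ls \<longlonglongrightarrow> L" "ss \<longlonglongrightarrow> s"
  shows "(L,s) \<in> B"
proof -
  have bn: "Ls n > 0" "dom (Ls n) (ss n)" "rF (Ls n) (ss n) = 0" "rZ (Ls n) (ss n) = 0" for n
    using B_D[OF assms(1)] by auto
  have "1 / M0 \<le> L" using LIMSEQ_le_const[OF assms(2)] B_length_bound[OF assms(1)] by blast
  then have L: "L > 0" using M0_pos by (smt (verit) zero_less_divide_1_iff)
  have "cpt L s \<in> Om" unfolding cpt_def
  proof (rule Om_closure[OF assms(2) _ assms(3)])
    show "norm (V (of_real (Ls n * t), of_real (ss n))) \<le> C0" if t: "t \<in> {0..1}" for n t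
    proof -
      have m: "Ls n * t \<in> {0..Ls n}" using t bn(1)[of n] by (simp add: mult_left_le)
      then have "dom (Ls n * t) (ss n)" using dom_mono[OF bn(2)] by auto
      then show ?thesis using of_real_rV[of "Ls n * t" "ss n"] B_bound[OF assms(1) m] by (simp add: cpt_def)
    qed
  qed (use bn in \<open>auto simp: dom_def cpt_def intro: less_imp_le\<close>)
  then have d: "dom L s" using L by (simp add: dom_def)
  have lim: "(\<lambda>n. Re (H (cpt (Ls n) (ss n)))) \<longlonglongrightarrow> Re (H (cpt L s))" if "hol2 Om H" for H
  proof -
    have "isCont (\<lambda>p. Re (H (cpt (fst p) (snd p)))) (L,s)"
      using real_continuous[OF that] open_real_Om \<open>cpt L s \<in> Om\<close> by (auto simp: continuous_on_eq_continuous_at)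
    then show ?thesis
      using isCont_tendsto_compose[OF _ tendsto_Pair[OF assms(2,3)]] by fastforce
  qed
  have "rF L s = 0" "rZ L s = 0"
    using LIMSEQ_unique[OF lim[OF hol2_F] tendsto_eventually] LIMSEQ_unique[OF lim[OF hol2_Z] tendsto_eventually] bn
    by (auto simp: rF_def rZ_def)
  then show ?thesis using L d by (simp add: B_def)
qed

end

section \<open>The branch points near an accumulation point\<close>

lemma eventually_abs_diff_less:
  fixes a s r :: real
  assumes "\<bar>s - a\<bar> < r"
  shows "\<forall>\<^sub>F t in nhds s. \<bar>t - a\<bar> < r"
proof -
  have "open {t. \<bar>t - a\<bar> < r}" by (intro open_Collect_less continuous_intros)
  from eventually_nhds_in_open[OF this, of s] show ?thesis using assms by simp
qed

context ivp
begin

text \<open>Only neighbours of a different length count: many slopes over one and the same length do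
  no harm to the discreteness of the lengths.\<close>

definition Bs :: "(real \<times> real) set" where
  "Bs = {b \<in> B. \<forall>e>0. \<exists>b'\<in>B. dist b' b < e \<and> fst b' \<noteq> fst b}"

lemma Bs_B: "b \<in> Bs \<Longrightarrow> b \<in> B" by (simp add: Bs_def)

lemma Bs_sequence:
  assumes "(x0,s0) \<in> Bs"
  obtains X Y where "\<And>n::nat. (X n, Y n) \<in> B" "\<And>n. X n \<noteq> x0" "X \<longlonglongrightarrow> x0" "Y \<longlonglongrightarrow> s0"
proof -
  have *: "\<forall>e>0. \<exists>b'\<in>B. dist b' (x0,s0) < e \<and> fst b' \<noteq> x0"
    using assms by (simp add: Bs_def)
  have "\<forall>n. \<exists>b'. b' \<in> B \<and> dist b' (x0,s0) < inverse (real (Suc n)) \<and> fst b' \<noteq> x0"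
  proof
    fix n
    have "inverse (real (Suc n)) > 0" by simp
    then show "\<exists>b'. b' \<in> B \<and> dist b' (x0,s0) < inverse (real (Suc n)) \<and> fst b' \<noteq> x0"
      using * by blast
  qed
  from choice[OF this] obtain b where
    b': "\<forall>n. b n \<in> B \<and> dist (b n) (x0,s0) < inverse (real (Suc n)) \<and> fst (b n) \<noteq> x0" ..
  note b = b'[rule_format, THEN conjunct1] b'[rule_format, THEN conjunct2, THEN conjunct1]
    b'[rule_format, THEN conjunct2, THEN conjunct2]
  have "(\<lambda>n. dist (b n) (x0,s0)) \<longlonglongrightarrow> 0"
  proof (rule Lim_null_comparison[OF always_eventually LIMSEQ_inverse_real_of_nat], rule allI)
    fix n
    show "norm (dist (b n) (x0,s0)) \<le> inverse (real (Suc n))"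
      unfolding real_norm_def abs_of_nonneg[OF zero_le_dist] by (rule less_imp_le[OF b(2)])
  qed
  then have lim: "b \<longlonglongrightarrow> (x0,s0)" using tendsto_dist_iff[of b "(x0,s0)"] by blast
  show ?thesis
    by (rule that[of "\<lambda>n. fst (b n)" "\<lambda>n. snd (b n)"])
       (simp_all add: b tendsto_fst[OF lim, simplified] tendsto_snd[OF lim, simplified])
qed

lemma B_complex:
  assumes "(x,s) \<in> B"
  shows "cpt x s \<in> Om" "F (cpt x s) = 0" "pd2 F (cpt x s) = 0" "pd2 V (cpt x s) \<noteq> 0" "x > 0"
  using B_D[OF assms] B_W_nonzero[OF assms] of_real_rF of_real_rZ of_real_rW dom_Om by auto

lemma complex_B:
  assumes "x > 0" "cpt x s \<in> Om" "F (cpt x s) = 0" "pd2 F (cpt x s) = 0"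
  shows "(x,s) \<in> B"
  using assms by (simp add: B_def dom_def rF_def rZ_def)

text \<open>Other points of the curve serve as the neighbours; the last hypothesis gives some of
  them a different length.\<close>

lemma Bs_curve_point:
  fixes l m :: "real \<Rightarrow> real"
  assumes "\<forall>\<^sub>F t in nhds t0. (l t, m t) \<in> B" "isCont l t0" "isCont m t0"
    and "\<exists>\<^sub>F t in nhds t0. l t \<noteq> l t0"
  shows "(l t0, m t0) \<in> Bs"
proof -
  have "(l t0, m t0) \<in> B" using assms(1) eventually_nhds_x_imp_x by blast
  moreover have "\<exists>b'\<in>B. dist b' (l t0, m t0) < e \<and> fst b' \<noteq> l t0" if "e > 0" for e
  proof -
    have "isCont (\<lambda>t. (l t, m t)) t0" using assms(2,3) by (rule isCont_Pair)
    then have "((\<lambda>t. (l t, m t)) \<longlongrightarrow> (l t0, m t0)) (nhds t0)"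
      using tendsto_at_iff_tendsto_nhds[of "\<lambda>t. (l t, m t)" t0] by (simp add: isCont_def)
    then have "\<forall>\<^sub>F t in nhds t0. dist (l t, m t) (l t0, m t0) < e" using that by (rule tendstoD)
    with assms(1) have "\<forall>\<^sub>F t in nhds t0. (l t, m t) \<in> B \<and> dist (l t, m t) (l t0, m t0) < e"
      by (rule eventually_conj)
    then obtain t where "(l t, m t) \<in> B" "dist (l t, m t) (l t0, m t0) < e" "l t \<noteq> l t0"
      using frequently_ex[OF frequently_eventually_frequently[OF assms(4)]] by blast
    then show ?thesis by (intro bexI[of _ "(l t, m t)"]) auto
  qed
  ultimately show ?thesis by (simp add: Bs_def)
qed

section \<open>Curves of branch points through an accumulation point\<close>

text \<open>A curve of accumulation points as a graph over the slope. In the last clause the end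
  value has the total derivative \<open>rW\<close> alone, because the term with \<open>l'\<close>
  carries the factor \<open>rF = 0\<close>.\<close>

definition s_curve :: "real \<Rightarrow> real \<Rightarrow> bool" where
  "s_curve x0 s0 \<longleftrightarrow> (\<exists>r>0. \<exists>l l'. l s0 = x0 \<and> (\<forall>s. \<bar>s - s0\<bar> < r \<longrightarrow>
     (l s, s) \<in> Bs \<and> (l has_real_derivative l' s) (at s) \<and> (s \<noteq> s0 \<longrightarrow> l s \<noteq> x0) \<and>
     ((\<lambda>s. rV (l s) s) has_real_derivative rW (l s) s) (at s)))"

lemma of_real_in_ball: "complex_of_real s \<in> ball (of_real a) r \<longleftrightarrow> \<bar>s - a\<bar> < r"
  by (simp add: dist_of_real dist_real_def abs_minus_commute)

text \<open>The curve is given in the zero set of \<open>pd2 F\<close> only. That \<open>F\<close>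
  vanishes along it and that it is real both hold on the sequence and spread by the identity
  theorem.\<close>

lemma s_curveI:
  assumes "(x0,s0) \<in> B" "d > 0" and l: "l holomorphic_on ball (of_real s0) d" "l (of_real s0) = of_real x0"
    and XY: "\<And>n::nat. (X n, Y n) \<in> B" "\<And>n. X n \<noteq> x0" "Y \<longlonglongrightarrow> s0"
    and lX: "\<And>n. \<bar>Y n - s0\<bar> < d \<Longrightarrow> of_real (X n) = l (of_real (Y n))"
    and K: "\<And>s. s \<in> ball (of_real s0) d \<Longrightarrow> (l s, s) \<in> Om \<and> pd2 F (l s, s) = 0"
  shows "s_curve x0 s0"
proof -
  let ?D = "ball (complex_of_real s0) d"
  have Yne: "Y n \<noteq> s0" for n using lX[of n] l(2) XY(2)[of n] \<open>d > 0\<close> by auto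
  have Yc: "(\<lambda>n. complex_of_real (Y n)) \<longlonglongrightarrow> of_real s0" by (intro tendsto_of_real XY)
  have Fhol: "(\<lambda>s. F (l s, s)) holomorphic_on ?D"
    by (rule hol2_curve[OF hol2_F]) (use l K in \<open>auto intro: holomorphic_intros\<close>)
  have F0: "F (l s, s) = 0" if "s \<in> ?D" for s
  proof (rule holomorphic_zero_sequence[OF Fhol \<open>d > 0\<close> Yc _ _ that])
    show "F (l (of_real (Y n)), of_real (Y n)) = 0" if "complex_of_real (Y n) \<in> ?D" for n
      using lX[of n] that B_complex(2)[OF XY(1)[of n]] unfolding of_real_in_ball by (simp add: cpt_def)
  qed (use Yne in auto)
  have lreal: "l (of_real s) \<in> \<real>" if "\<bar>s - s0\<bar> < d" for s
  proof (rule holomorphic_real_sequence[OF l(1) \<open>d > 0\<close> XY(3) Yne _ that])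
    show "l (of_real (Y n)) \<in> \<real>" if "complex_of_real (Y n) \<in> ?D" for n
      using lX[of n] that unfolding of_real_in_ball by (metis Reals_of_real)
  qed
  define la where "la s = Re (l (of_real s))" for s
  define la' where "la' s = Re (deriv l (of_real s))" for s
  have lac: "l (of_real s) = of_real (la s)" if "\<bar>s - s0\<bar> < d" for s
    using lreal[OF that] by (simp add: la_def of_real_Re)
  have der: "(la has_real_derivative la' s) (at s)" if "\<bar>s - s0\<bar> < d" for s
    unfolding la_def[abs_def] la'_def
    by (rule Re_has_real_derivative) (use l that in \<open>auto intro!: holomorphic_derivI simp: of_real_in_ball[simplified]\<close>)
  have "\<forall>\<^sub>F n in sequentially. complex_of_real (Y n) \<in> ?D"
    by (rule topological_tendstoD[OF Yc]) (use \<open>d > 0\<close> in auto)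
  then obtain n0 where n0: "complex_of_real (Y n0) \<in> ?D" by (auto simp: eventually_sequentially)
  have l_n0: "l (of_real (Y n0)) \<noteq> of_real x0"
    using lX[of n0] n0 XY(2)[of n0] unfolding of_real_in_ball by (metis of_real_eq_iff)
  have hol_minus: "(\<lambda>s. l s - c) holomorphic_on ?D" for c
    by (intro holomorphic_intros l)
  \<comment> \<open>\<open>l\<close> is not constant, so it returns to the value \<open>x0\<close>
    in isolated points only.\<close>
  have "\<exists>r>0. \<forall>z\<in>ball (of_real s0) r - {of_real s0}. l z - of_real x0 \<noteq> 0"
  proof (rule isolated_zeros[OF hol_minus[of "of_real x0"], of "of_real s0" "of_real (Y n0)"])
    show "\<exists>r>0. \<forall>z\<in>ball (of_real s0) r - {of_real s0}. l z - of_real x0 \<noteq> 0"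
      if "0 < r" "\<And>z. z \<in> ball (of_real s0) r - {of_real s0} \<Longrightarrow> l z - of_real x0 \<noteq> 0" for r
      using that by blast
  qed (use l_n0 l n0 \<open>d > 0\<close> in auto)
  then obtain r1 where r1: "r1 > 0" "\<And>z. z \<in> ball (of_real s0) r1 \<Longrightarrow> z \<noteq> of_real s0 \<Longrightarrow> l z \<noteq> of_real x0"
    by auto
  have x0: "x0 > 0" using B_D[OF assms(1)] by blast
  have la0: "la s0 = x0" using l by (simp add: la_def)
  have "isCont la s0" using der[of s0] \<open>d > 0\<close> DERIV_isCont by auto
  then obtain r2 where r2: "r2 > 0" "\<And>s. dist s s0 < r2 \<Longrightarrow> dist (la s) (la s0) < x0"
    using x0 unfolding continuous_at_eps_delta by metis
  define r where "r = min d (min r1 r2)"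
  have r: "r > 0" "r \<le> d" "r \<le> r1" "r \<le> r2" using r1 r2 \<open>d > 0\<close> by (auto simp: r_def)
  have inB: "(la s, s) \<in> B" if "\<bar>s - s0\<bar> < r" for s
  proof (rule complex_B)
    show "la s > 0" using r2(2)[of s] that r la0 by (simp add: dist_real_def abs_less_iff)
    have s: "\<bar>s - s0\<bar> < d" using that r by simp
    have e: "cpt (la s) s = (l (of_real s), of_real s)" using lac[OF s] by (simp add: cpt_def)
    have m: "complex_of_real s \<in> ?D" using s unfolding of_real_in_ball .
    show "cpt (la s) s \<in> Om" "F (cpt (la s) s) = 0" "pd2 F (cpt (la s) s) = 0"
      unfolding e using K[OF m] F0[OF m] by auto
  qed
  have evr: "\<forall>\<^sub>F t in nhds s. \<bar>t - s0\<bar> < r" if "\<bar>s - s0\<bar> < r" for s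
    using that by (rule eventually_abs_diff_less)
  have inBs: "(la s, s) \<in> Bs" if s: "\<bar>s - s0\<bar> < r" for s
  proof (rule Bs_curve_point[where m = "\<lambda>t. t"])
    show "\<forall>\<^sub>F t in nhds s. (la t, t) \<in> B" using evr[OF s] by eventually_elim (rule inB)
    show "isCont la s" using der[of s] s r DERIV_isCont by auto
    show "\<exists>\<^sub>F t in nhds s. la t \<noteq> la s"
    proof (rule ccontr)
      assume "\<not> ?thesis"
      then have "\<forall>\<^sub>F t in nhds s. la t = la s" by (simp add: not_frequently)
      with evr[OF s] have "\<forall>\<^sub>F t in nhds s. \<bar>t - s0\<bar> < r \<and> la t = la s" by (rule eventually_conj)
      then obtain e where e: "e > 0" "\<And>t. dist t s < e \<Longrightarrow> \<bar>t - s0\<bar> < r \<and> la t = la s"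
        by (auto simp: eventually_nhds_metric)
      \<comment> \<open>If \<open>l\<close> were constant near \<open>s\<close>, these points would
        accumulate at \<open>s\<close> and the identity theorem would make \<open>l\<close> constant
        on the disc, against \<open>l_n0\<close>.\<close>
      define T where "T n = s + e / 2 * inverse (real (Suc n))" for n
      have Tlim: "T \<longlonglongrightarrow> s" unfolding T_def[abs_def]
        using tendsto_add[OF tendsto_const[of s] tendsto_mult[OF tendsto_const[of "e/2"] LIMSEQ_inverse_real_of_nat]] by simp
      have Td: "dist (T n) s < e" for n
      proof -
        have "inverse (real (Suc n)) \<le> 1" by (simp add: inverse_le_1_iff)
        then have "e / 2 * inverse (real (Suc n)) \<le> e / 2 * 1" using e by (intro mult_left_mono) auto
        then show ?thesis using e by (simp add: T_def dist_real_def)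
      qed
      have lc: "l z - of_real (la s) = 0" if "z \<in> ?D" for z
      proof (rule analytic_continuation[OF hol_minus, of "range (\<lambda>n. complex_of_real (T n))" "of_real s"])
        show "range (\<lambda>n. complex_of_real (T n)) \<subseteq> ?D"
          using e(2)[OF Td] r(2) unfolding image_subset_iff of_real_in_ball by (blast intro: less_le_trans)
        show "complex_of_real s \<in> ?D" using s r unfolding of_real_in_ball by simp
        show "complex_of_real s islimpt range (\<lambda>n. complex_of_real (T n))"
          unfolding islimpt_sequential
        proof (intro exI[of _ "\<lambda>n. complex_of_real (T n)"] conjI allI)
          show "complex_of_real (T n) \<in> range (\<lambda>n. complex_of_real (T n)) - {of_real s}" for n
          proof -
            have "T n \<noteq> s" using e(1) by (simp add: T_def)
            then show ?thesis by simp
          qed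
        qed (intro tendsto_of_real Tlim)
        show "l w - of_real (la s) = 0" if w: "w \<in> range (\<lambda>n. complex_of_real (T n))" for w
        proof -
          obtain n where n: "w = of_real (T n)" using w by auto
          have "\<bar>T n - s0\<bar> < d" "la (T n) = la s" using e(2)[OF Td[of n]] r by auto
          then show ?thesis using lac[of "T n"] n by simp
        qed
      qed (use that in auto)
      have "l (of_real (Y n0)) = l (of_real s0)" using lc[OF n0] lc[of "of_real s0"] \<open>d > 0\<close> by simp
      then show False using l_n0 l(2) by simp
    qed
  qed simp
  have pder: "((\<lambda>s. rV (la s) s) has_real_derivative rW (la s) s) (at s)" if s: "\<bar>s - s0\<bar> < r" for s
  proof -
    have sd: "\<bar>s - s0\<bar> < d" using s r by simp
    have m: "complex_of_real s \<in> ?D" using sd unfolding of_real_in_ball .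
    have "((\<lambda>w. V (l w, w)) has_field_derivative pd1 V (l (of_real s), of_real s) * deriv l (of_real s) + pd2 V (l (of_real s), of_real s) * 1) (at (of_real s))"
      by (rule hol2_chain[OF hol2_V open_Om]) (use K[OF m] m l in \<open>auto intro!: holomorphic_derivI derivative_eq_intros\<close>)
    moreover have "pd1 V (l (of_real s), of_real s) = 0" using pd1_V[of "(l (of_real s), of_real s)"] K[OF m] F0[OF m] by simp
    ultimately have "((\<lambda>w. V (l w, w)) has_field_derivative pd2 V (cpt (la s) s)) (at (of_real s))"
      using lac[OF sd] by (simp add: cpt_def)
    from Re_has_real_derivative[OF this]
    have "((\<lambda>t. Re (V (l (of_real t), of_real t))) has_real_derivative rW (la s) s) (at s)" by (simp add: rW_def)
    moreover have "((\<lambda>t. Re (V (l (of_real t), of_real t))) has_real_derivative rW (la s) s) (at s)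
        \<longleftrightarrow> ((\<lambda>t. rV (la t) t) has_real_derivative rW (la s) s) (at s)"
    proof (rule DERIV_cong_ev[OF refl _ refl])
      show "\<forall>\<^sub>F t in nhds s. Re (V (l (of_real t), of_real t)) = rV (la t) t"
        using evr[OF s] by eventually_elim (use lac r in \<open>simp add: rV_def cpt_def\<close>)
    qed
    ultimately show ?thesis by simp
  qed
  have ne: "la s \<noteq> x0" if "\<bar>s - s0\<bar> < r" "s \<noteq> s0" for s
  proof -
    have "complex_of_real s \<in> ball (of_real s0) r1" using that r unfolding of_real_in_ball by simp
    then have "l (of_real s) \<noteq> of_real x0" using r1(2) that(2) by simp
    then show ?thesis using lac[of s] that(1) r by auto
  qed
  show ?thesis unfolding s_curve_def
    by (rule exI[of _ r], intro conjI r, rule exI[of _ la], rule exI[of _ la'])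
       (use la0 inBs der r ne pder in auto)
qed

text \<open>A graph over the length extends to both sides of \<open>x0\<close>; its part to the left
  already consists of accumulation points.\<close>

lemma x_curveI:
  assumes "(x0,s0) \<in> B" "d > 0" and l: "l holomorphic_on ball (of_real x0) d"
    and XY: "\<And>n::nat. (X n, Y n) \<in> B" "\<And>n. X n \<noteq> x0" "X \<longlonglongrightarrow> x0"
    and lX: "\<And>n. \<bar>X n - x0\<bar> < d \<Longrightarrow> of_real (Y n) = l (of_real (X n))"
    and K: "\<And>x. x \<in> ball (of_real x0) d \<Longrightarrow> (x, l x) \<in> Om \<and> pd2 F (x, l x) = 0"
  shows "\<exists>(x,s)\<in>Bs. x < x0"
proof -
  let ?D = "ball (complex_of_real x0) d"
  have Xc: "(\<lambda>n. complex_of_real (X n)) \<longlonglongrightarrow> of_real x0" by (intro tendsto_of_real XY)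
  have Fhol: "(\<lambda>x. F (x, l x)) holomorphic_on ?D"
    by (rule hol2_curve[OF hol2_F]) (use l K in \<open>auto intro: holomorphic_intros\<close>)
  have F0: "F (x, l x) = 0" if "x \<in> ?D" for x
  proof (rule holomorphic_zero_sequence[OF Fhol \<open>d > 0\<close> Xc _ _ that])
    show "F (of_real (X n), l (of_real (X n))) = 0" if "complex_of_real (X n) \<in> ?D" for n
      using lX[of n] that B_complex(2)[OF XY(1)[of n]] unfolding of_real_in_ball by (simp add: cpt_def)
  qed (use XY in auto)
  have lreal: "l (of_real x) \<in> \<real>" if "\<bar>x - x0\<bar> < d" for x
  proof (rule holomorphic_real_sequence[OF l(1) \<open>d > 0\<close> XY(3) XY(2) _ that])
    show "l (of_real (X n)) \<in> \<real>" if "complex_of_real (X n) \<in> ?D" for n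
      using lX[of n] that unfolding of_real_in_ball by (metis Reals_of_real)
  qed
  define m where "m x = Re (l (of_real x))" for x
  have mc: "l (of_real x) = of_real (m x)" if "\<bar>x - x0\<bar> < d" for x
    using lreal[OF that] by (simp add: m_def of_real_Re)
  have x0: "x0 > 0" using B_D[OF assms(1)] by blast
  define r where "r = min d x0"
  have r: "r > 0" "r \<le> d" "r \<le> x0" using x0 \<open>d > 0\<close> by (auto simp: r_def)
  have inB: "(x, m x) \<in> B" if "\<bar>x - x0\<bar> < r" for x
  proof (rule complex_B)
    show "x > 0" using that r by (simp add: abs_less_iff)
    have s: "\<bar>x - x0\<bar> < d" using that r by simp
    have e: "cpt x (m x) = (of_real x, l (of_real x))" using mc[OF s] by (simp add: cpt_def)
    have m: "complex_of_real x \<in> ?D" using s unfolding of_real_in_ball .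
    show "cpt x (m x) \<in> Om" "F (cpt x (m x)) = 0" "pd2 F (cpt x (m x)) = 0"
      unfolding e using K[OF m] F0[OF m] by auto
  qed
  define x1 where "x1 = x0 - r / 2"
  have x1: "\<bar>x1 - x0\<bar> < r" using r by (simp add: x1_def)
  have "(x1, m x1) \<in> Bs"
  proof (rule Bs_curve_point[where l = "\<lambda>t. t"])
    have "\<forall>\<^sub>F t in nhds x1. \<bar>t - x0\<bar> < r"
      using x1 by (rule eventually_abs_diff_less)
    then show "\<forall>\<^sub>F t in nhds x1. (t, m t) \<in> B" by eventually_elim (rule inB)
    have "complex_of_real x1 \<in> ?D" using x1 r unfolding of_real_in_ball by simp
    then have "(m has_real_derivative Re (deriv l (of_real x1))) (at x1)"
      unfolding m_def[abs_def] by (intro Re_has_real_derivative holomorphic_derivI[OF l]) auto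
    then show "isCont m x1" by (rule DERIV_isCont)
    show "\<exists>\<^sub>F t in nhds x1. t \<noteq> x1"
    proof (rule ccontr)
      assume "\<not> ?thesis"
      then obtain \<delta> where \<delta>: "\<delta> > 0" "\<And>t. dist t x1 < \<delta> \<Longrightarrow> t = x1"
        by (auto simp: not_frequently eventually_nhds_metric)
      have "dist (x1 + \<delta> / 2) x1 < \<delta>" using \<delta>(1) by (simp add: dist_real_def)
      then show False using \<delta> by fastforce
    qed
  qed simp
  then show ?thesis using r by (intro bexI[of _ "(x1, m x1)"]) (auto simp: x1_def)
qed


text \<open>\<open>pd1 (pd2 F) = (3 * V^2 - 1) * pd2 V\<close>, whose first factor vanishes here
  together with its derivative \<open>6 * V * F\<close> in the length. One diagonal entry of the
  Hessian of \<open>pd2 F\<close> is then 0, and the mixed entry alone decides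
  nondegeneracy.\<close>

lemma pd_pd1_pd2_F_fold:
  assumes "q \<in> Om" "F q = 0" "3 * V q ^ 2 = 1"
  shows "pd1 (pd1 (pd2 F)) q = 0" "pd2 (pd1 (pd2 F)) q = 6 * V q * (pd2 V q)\<^sup>2"
proof -
  let ?h = "\<lambda>q. 3 * V q ^ 2 - 1"
  have h: "hol2 Om ?h" by (intro hol2_diff hol2_mult hol2_const hol2_power hol2_V)
  have V2: "hol2 Om (\<lambda>q. V q * V q)" by (intro hol2_mult hol2_V)
  have c: "hol2 Om (\<lambda>q. 3)" and o: "hol2 Om (\<lambda>q. 1)" by (rule hol2_const)+
  have cV: "hol2 Om (\<lambda>q. 3 * (V q * V q))" by (intro hol2_mult hol2_V hol2_const)
  have z: "pd1 (\<lambda>q. c) q = 0" "pd2 (\<lambda>q. c) q = 0" for c by (simp_all add: pd1_def pd2_def)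
  have h1: "pd1 ?h q = 6 * V q * pd1 V q" "pd2 ?h q = 6 * V q * pd2 V q"
    unfolding power2_eq_square
    using pd1_diff[OF cV o open_Om assms(1)] pd1_mult[OF c V2 open_Om assms(1)] pd1_mult[OF hol2_V hol2_V open_Om assms(1)]
      pd2_diff[OF cV o open_Om assms(1)] pd2_mult[OF c V2 open_Om assms(1)] pd2_mult[OF hol2_V hol2_V open_Om assms(1)]
    by (simp_all add: z)
  have "pd1 (pd1 (pd2 F)) q = pd1 (\<lambda>q. ?h q * pd2 V q) q"
    by (rule pd1_cong[OF open_Om assms(1)]) (rule pd1_pd2_F)
  also have "\<dots> = 0"
    using pd1_mult[OF h hol2_W open_Om assms(1)] h1 pd1_V[OF assms(1)] assms(2,3) by simp
  finally show "pd1 (pd1 (pd2 F)) q = 0" .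
  have "pd2 (pd1 (pd2 F)) q = pd2 (\<lambda>q. ?h q * pd2 V q) q"
    by (rule pd2_cong[OF open_Om assms(1)]) (rule pd1_pd2_F)
  also have "\<dots> = 6 * V q * (pd2 V q)\<^sup>2"
    using pd2_mult[OF h hol2_W open_Om assms(1)] h1 assms(3) by (simp add: power2_eq_square)
  finally show "pd2 (pd1 (pd2 F)) q = 6 * V q * (pd2 V q)\<^sup>2" .
qed

text \<open>Otherwise \<open>F = 0\<close> is locally a graph \<open>x = l s\<close>. Since
  \<open>pd2 F\<close> vanishes on a sequence in it, it vanishes throughout, and differentiating
  \<open>F (l s, s) = 0\<close> leaves \<open>pd1 F * l' = 0\<close>. So \<open>l\<close> is
  constant, while the sequence has lengths different from \<open>x0\<close>.\<close>

lemma Bs_acceleration_zero: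
  assumes Bs: "(x0,s0) \<in> Bs"
  shows "rV x0 s0 ^ 3 - rV x0 s0 + \<zeta> x0 = 0"
proof (rule ccontr)
  assume A: "rV x0 s0 ^ 3 - rV x0 s0 + \<zeta> x0 \<noteq> 0"
  obtain X Y where XY: "\<And>n::nat. (X n, Y n) \<in> B" "\<And>n. X n \<noteq> x0" "X \<longlonglongrightarrow> x0" "Y \<longlonglongrightarrow> s0"
    using Bs_sequence[OF Bs] by blast
  have b: "(x0,s0) \<in> B" using Bs_B[OF Bs] .
  have d0: "dom x0 s0" "x0 > 0" using B_D[OF b] by auto
  have "pd1 F (cpt x0 s0) = of_real (rV x0 s0 ^ 3 - rV x0 s0 + \<zeta> x0)"
    using pd1_F[OF dom_Om[OF d0(1)]] of_real_rV[OF d0(1)] zc_real[of x0] d0 by (simp add: cpt_def)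
  then have p1: "pd1 F (cpt x0 s0) \<noteq> 0" using A by (metis of_real_eq_0_iff)
  obtain d e l where l: "d > 0" "e > 0" "l holomorphic_on ball (of_real s0) d" "l (of_real s0) = of_real x0"
    "\<forall>s\<in>ball (of_real s0) d. l s \<in> ball (of_real x0) e" "ball (of_real x0) e \<times> ball (of_real s0) d \<subseteq> Om"
    "\<forall>s\<in>ball (of_real s0) d. \<forall>x\<in>ball (of_real x0) e. F (x,s) = 0 \<longleftrightarrow> x = l s"
  proof (rule hol2_implicit1[OF hol2_F open_Om, of "of_real x0" "of_real s0"])
    show "(of_real x0, of_real s0) \<in> Om" "F (of_real x0, of_real s0) = 0" "pd1 F (of_real x0, of_real s0) \<noteq> 0"
      using B_complex[OF b] p1 by (auto simp: cpt_def)
  qed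
  let ?D = "ball (complex_of_real s0) d"
  have F0: "F (l s, s) = 0" and inOm: "(l s, s) \<in> Om" if "s \<in> ?D" for s
    using l(5-7) that by blast+
  have xc: "(\<lambda>n. complex_of_real (X n)) \<longlonglongrightarrow> of_real x0" and Yc: "(\<lambda>n. complex_of_real (Y n)) \<longlonglongrightarrow> of_real s0"
    by (intro tendsto_of_real XY)+
  have "\<forall>\<^sub>F n in sequentially. complex_of_real (X n) \<in> ball (of_real x0) e \<and> complex_of_real (Y n) \<in> ?D"
    by (intro eventually_conj topological_tendstoD[OF xc] topological_tendstoD[OF Yc]) (use l in auto)
  then obtain n0 where n0: "\<And>n. n \<ge> n0 \<Longrightarrow> complex_of_real (X n) \<in> ball (of_real x0) e \<and> complex_of_real (Y n) \<in> ?D"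
    by (auto simp: eventually_sequentially)
  have lX: "of_real (X n) = l (of_real (Y n))" if "n \<ge> n0" for n
    using l(7) n0[OF that] B_complex(2)[OF XY(1)[of n]] by (simp only: cpt_def)
  have Yne: "Y n \<noteq> s0" if "n \<ge> n0" for n
    using lX[OF that] l(4) XY(2)[of n] by auto
  have Khol: "(\<lambda>s. pd2 F (l s, s)) holomorphic_on ?D"
    by (rule hol2_curve[OF hol2_Z]) (use l inOm in \<open>auto intro: holomorphic_intros\<close>)
  have K0: "pd2 F (l s, s) = 0" if "s \<in> ?D" for s
  proof (rule holomorphic_zero_sequence[OF Khol l(1) _ _ _ that])
    show "(\<lambda>n. complex_of_real (Y (n + n0))) \<longlonglongrightarrow> of_real s0"
      using Yc by (rule LIMSEQ_ignore_initial_segment)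
    show "complex_of_real (Y (n + n0)) \<noteq> of_real s0" for n using Yne[of "n + n0"] by simp
    show "pd2 F (l (of_real (Y (n + n0))), of_real (Y (n + n0))) = 0" for n
      using lX[of "n + n0"] B_complex(3)[OF XY(1)[of "n + n0"]] by (simp add: cpt_def)
  qed
  have cont: "continuous_on ?D (\<lambda>s. pd1 F (l s, s))"
    by (rule holomorphic_on_imp_continuous_on[OF hol2_curve[OF hol2_pd1[OF hol2_F open_Om]]])
       (use l inOm in \<open>auto intro: holomorphic_intros\<close>)
  have "isCont (\<lambda>s. pd1 F (l s, s)) (of_real s0)"
    using cont l(1) by (simp add: continuous_on_eq_continuous_at)
  then have "\<forall>\<^sub>F s in nhds (of_real s0). pd1 F (l s, s) \<noteq> 0"
    using p1 l(4) tendsto_at_iff_tendsto_nhds[of "\<lambda>s. pd1 F (l s, s)" "of_real s0"]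
    by (intro tendsto_imp_eventually_ne[where c = "pd1 F (cpt x0 s0)"]) (auto simp: isCont_def cpt_def)
  then obtain d1 where d1: "d1 > 0" "\<And>s. dist s (of_real s0) < d1 \<Longrightarrow> pd1 F (l s, s) \<noteq> 0"
    by (auto simp: eventually_nhds_metric)
  define d2 where "d2 = min d d1"
  have d2: "d2 > 0" "d2 \<le> d" "d2 \<le> d1" using d1 l by (auto simp: d2_def)
  have l0: "(l has_field_derivative 0) (at s within ball (of_real s0) d2)" if s: "s \<in> ball (of_real s0) d2" for s
  proof -
    have sD: "s \<in> ?D" using s d2 by auto
    have dl: "(l has_field_derivative deriv l s) (at s)" by (rule holomorphic_derivI[OF l(3)]) (use sD in auto)
    have "((\<lambda>s. F (l s, s)) has_field_derivative pd1 F (l s, s) * deriv l s + pd2 F (l s, s) * 1) (at s)"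
      by (rule hol2_chain[OF hol2_F open_Om]) (use inOm[OF sD] dl in auto)
    moreover have "((\<lambda>s. F (l s, s)) has_field_derivative pd1 F (l s, s) * deriv l s + pd2 F (l s, s) * 1) (at s)
        \<longleftrightarrow> ((\<lambda>s. 0) has_field_derivative pd1 F (l s, s) * deriv l s + pd2 F (l s, s) * 1) (at s)"
    proof (rule DERIV_cong_ev[OF refl _ refl])
      show "\<forall>\<^sub>F s in nhds s. F (l s, s) = 0"
        using eventually_nhds_in_open[OF open_ball sD] by eventually_elim (rule F0)
    qed
    ultimately have "pd1 F (l s, s) * deriv l s + pd2 F (l s, s) * 1 = 0"
      using DERIV_unique[OF _ DERIV_const] by blast
    then have "deriv l s = 0" using K0[OF sD] d1(2)[of s] s d2 by (simp add: dist_commute)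
    then show ?thesis using dl has_field_derivative_at_within by metis
  qed
  have "\<forall>\<^sub>F n in sequentially. complex_of_real (Y n) \<in> ball (of_real s0) d2"
    by (rule topological_tendstoD[OF Yc]) (use d2 in auto)
  then obtain n1 where n1: "\<And>n. n \<ge> n1 \<Longrightarrow> complex_of_real (Y n) \<in> ball (of_real s0) d2"
    by (auto simp: eventually_sequentially)
  obtain c where c: "\<And>s. s \<in> ball (of_real s0) d2 \<Longrightarrow> l s = c"
    using has_field_derivative_zero_constant[OF convex_ball l0] by metis
  have "l (of_real (Y (max n0 n1))) = l (of_real s0)"
    using c[OF n1[of "max n0 n1"]] c[of "of_real s0"] d2 by simp
  then show False using lX[of "max n0 n1"] l(4) XY(2)[of "max n0 n1"] by simp
qed

lemma s_curveI_eventually: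
  assumes b: "(x0,s0) \<in> B" and l: "d > 0" "l holomorphic_on ball (of_real s0) d" "l (of_real s0) = of_real x0"
    and XY: "\<And>n::nat. (X n, Y n) \<in> B" "\<And>n. X n \<noteq> x0" "Y \<longlonglongrightarrow> s0"
    and lX: "\<forall>\<^sub>F n in sequentially. of_real (X n) = l (of_real (Y n))"
    and K: "\<forall>s\<in>ball (of_real s0) d. (l s, s) \<in> Om \<and> pd2 F (l s, s) = 0"
  shows "s_curve x0 s0"
proof -
  obtain n0 where n0: "\<And>n. n \<ge> n0 \<Longrightarrow> of_real (X n) = l (of_real (Y n))"
    using lX by (auto simp: eventually_sequentially)
  show ?thesis
    by (rule s_curveI[OF b l, of "\<lambda>n. X (n + n0)" "\<lambda>n. Y (n + n0)"])
       (use XY n0 K LIMSEQ_ignore_initial_segment[OF XY(3), of n0] in auto)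
qed

lemma x_curveI_eventually:
  assumes b: "(x0,s0) \<in> B" and l: "d > 0" "l holomorphic_on ball (of_real x0) d"
    and XY: "\<And>n::nat. (X n, Y n) \<in> B" "\<And>n. X n \<noteq> x0" "X \<longlonglongrightarrow> x0"
    and lX: "\<forall>\<^sub>F n in sequentially. of_real (Y n) = l (of_real (X n))"
    and K: "\<forall>x\<in>ball (of_real x0) d. (x, l x) \<in> Om \<and> pd2 F (x, l x) = 0"
  shows "\<exists>(x,s)\<in>Bs. x < x0"
proof -
  obtain n0 where n0: "\<And>n. n \<ge> n0 \<Longrightarrow> of_real (Y n) = l (of_real (X n))"
    using lX by (auto simp: eventually_sequentially)
  show ?thesis
    by (rule x_curveI[OF b l, of "\<lambda>n. X (n + n0)" "\<lambda>n. Y (n + n0)"])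
       (use XY n0 K LIMSEQ_ignore_initial_segment[OF XY(3), of n0] in auto)
qed

text \<open>The zero set of \<open>pd2 F\<close> near an accumulation point of branch points: where the implicit function theorem
  fails, the Hessian of \<open>pd2 F\<close> is nondegenerate, so the zero set is a node.\<close>

lemma Bs_local:
  assumes Bs: "(x0,s0) \<in> Bs"
  shows "s_curve x0 s0 \<or> (3 * (rV x0 s0)\<^sup>2 = 1 \<and> (\<exists>(x,s)\<in>Bs. x < x0))"
proof -
  obtain X Y where XY: "\<And>n::nat. (X n, Y n) \<in> B" "\<And>n. X n \<noteq> x0" "X \<longlonglongrightarrow> x0" "Y \<longlonglongrightarrow> s0"
    using Bs_sequence[OF Bs] by blast
  have b: "(x0,s0) \<in> B" using Bs_B[OF Bs] .
  have d0: "dom x0 s0" "x0 > 0" using B_D[OF b] by auto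
  let ?x0 = "complex_of_real x0" and ?s0 = "complex_of_real s0"
  let ?q = "(?x0, ?s0)"
  have q: "?q \<in> Om" "F ?q = 0" "pd2 F ?q = 0" "pd2 V ?q \<noteq> 0" using B_complex[OF b] by (auto simp: cpt_def)
  have Vq: "V ?q = of_real (rV x0 s0)" using of_real_rV[OF d0(1)] by (simp add: cpt_def)
  have xc: "(\<lambda>n. complex_of_real (X n)) \<longlonglongrightarrow> ?x0" and Yc: "(\<lambda>n. complex_of_real (Y n)) \<longlonglongrightarrow> ?s0"
    by (intro tendsto_of_real XY)+
  have Kn: "pd2 F (of_real (X n), of_real (Y n)) = 0" for n
    using B_complex(3)[OF XY(1)[of n]] by (simp add: cpt_def)
  have evb: "\<forall>\<^sub>F n in sequentially. complex_of_real (X n) \<in> ball ?x0 e \<and> complex_of_real (Y n) \<in> ball ?s0 d"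
    if "d > 0" "e > 0" for d e
    by (intro eventually_conj topological_tendstoD[OF xc] topological_tendstoD[OF Yc]) (use that in auto)
  have p1: "pd1 (pd2 F) ?q = (3 * V ?q ^ 2 - 1) * pd2 V ?q" by (rule pd1_pd2_F[OF q(1)])
  show ?thesis
  proof (cases "3 * (rV x0 s0)\<^sup>2 = 1")
    case False
    have "3 * V ?q ^ 2 - 1 = of_real (3 * (rV x0 s0)\<^sup>2 - 1)" unfolding Vq by simp
    then have "3 * V ?q ^ 2 - 1 \<noteq> 0" using False by (simp only: of_real_eq_0_iff)
    then have "pd1 (pd2 F) ?q \<noteq> 0" using p1 q(4) by simp
    then obtain d e l where l: "d > 0" "e > 0" "l holomorphic_on ball ?s0 d" "l ?s0 = ?x0"
      "\<forall>s\<in>ball ?s0 d. l s \<in> ball ?x0 e" "ball ?x0 e \<times> ball ?s0 d \<subseteq> Om"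
      "\<forall>s\<in>ball ?s0 d. \<forall>x\<in>ball ?x0 e. pd2 F (x,s) = 0 \<longleftrightarrow> x = l s"
      by (rule hol2_implicit1[OF hol2_Z open_Om q(1,3)])
    have "s_curve x0 s0"
    proof (rule s_curveI_eventually[OF b l(1,3,4) XY(1,2,4)])
      show "\<forall>\<^sub>F n in sequentially. of_real (X n) = l (of_real (Y n))"
        using evb[OF l(1,2)] by eventually_elim (use l(7) Kn in blast)
      show "\<forall>s\<in>ball ?s0 d. (l s, s) \<in> Om \<and> pd2 F (l s, s) = 0" using l(5-7) by blast
    qed
    then show ?thesis ..
  next
    case True
    have V1: "3 * V ?q ^ 2 = 1" 
    proof -
      have "3 * V ?q ^ 2 = of_real (3 * (rV x0 s0)\<^sup>2)" unfolding Vq by simp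
      then show ?thesis using True by simp
    qed
    then have p1z: "pd1 (pd2 F) ?q = 0" using p1 by simp
    show ?thesis
    \<comment> \<open>As \<open>pd1 (pd2 F)\<close> vanishes, the zero set of \<open>pd2 F\<close>
      is a graph over the length, unless \<open>pd2 (pd2 F)\<close> vanishes as well.\<close>
    proof (cases "pd2 (pd2 F) ?q = 0")
      case False
      then obtain d e l where l: "d > 0" "e > 0" "l holomorphic_on ball ?x0 d" "l ?x0 = ?s0"
        "\<forall>x\<in>ball ?x0 d. l x \<in> ball ?s0 e" "ball ?x0 d \<times> ball ?s0 e \<subseteq> Om"
        "\<forall>x\<in>ball ?x0 d. \<forall>s\<in>ball ?s0 e. pd2 F (x,s) = 0 \<longleftrightarrow> s = l x"
        by (rule hol2_implicit2[OF hol2_Z open_Om q(1,3)])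
      have "\<exists>(x,s)\<in>Bs. x < x0"
      proof (rule x_curveI_eventually[OF b l(1,3) XY(1-3)])
        show "\<forall>\<^sub>F n in sequentially. of_real (Y n) = l (of_real (X n))"
          using evb[OF l(2,1)] by eventually_elim (use l(7) Kn in blast)
        show "\<forall>x\<in>ball ?x0 d. (x, l x) \<in> Om \<and> pd2 F (x, l x) = 0" using l(5-7) by blast
      qed
      then show ?thesis using True by blast
    next
      case p2z: True
      note pp = pd_pd1_pd2_F_fold[OF q(1,2) V1]
      have "V ?q \<noteq> 0" using V1 by auto
      then have p12: "pd2 (pd1 (pd2 F)) ?q \<noteq> 0" using pp(2) q(4) by simp
      have p21: "pd1 (pd2 (pd2 F)) ?q \<noteq> 0" using pd_commute[OF hol2_Z open_Om q(1)] p12 by simp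
      \<comment> \<open>The indices at which the slope moves at least as much as the length. Either
        they or the others are infinitely many, and the blow-up is taken in the chart whose
        parameter is the faster coordinate, which bounds the chord slopes by 1.\<close>
      define N where "N = {n. norm (complex_of_real (X n) - ?x0) \<le> norm (complex_of_real (Y n) - ?s0)}"
      show ?thesis
      proof (cases "infinite N")
        case True
        then obtain k where k: "strict_mono (k :: nat \<Rightarrow> nat)" "\<forall>n. k n \<in> N" using infinite_enumerate by blast
        have Yne: "complex_of_real (Y (k n)) \<noteq> ?s0" for n
        proof
          assume "complex_of_real (Y (k n)) = ?s0"
          moreover have "norm (complex_of_real (X (k n)) - ?x0) \<le> norm (complex_of_real (Y (k n)) - ?s0)"
            using k(2) by (simp add: N_def)
          ultimately have "norm (complex_of_real (X (k n)) - ?x0) \<le> 0" by simp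
          then show False using XY(2)[of "k n"] by simp
        qed
        have disc: "(pd1 (pd2 (pd2 F)) ?q)\<^sup>2 \<noteq> pd1 (pd1 (pd2 F)) ?q * pd2 (pd2 (pd2 F)) ?q"
          using p21 pp(1) by simp
        have le: "norm (complex_of_real (X (k n)) - ?x0) \<le> norm (complex_of_real (Y (k n)) - ?s0)" for n
          using k(2) by (simp add: N_def)
        obtain r l k2 where l: "r > 0" "l holomorphic_on ball ?s0 r" "l ?s0 = ?x0" "strict_mono (k2 :: nat \<Rightarrow> nat)"
          "\<forall>n. complex_of_real (Y (k (k2 n))) \<in> ball ?s0 r \<and> complex_of_real (X (k (k2 n))) = l (complex_of_real (Y (k (k2 n))))"
          "\<forall>s\<in>ball ?s0 r. (l s, s) \<in> Om \<and> pd2 F (l s, s) = 0"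
          by (rule hol2_node[OF hol2_Z open_Om q(1,3) p1z p2z disc
                LIMSEQ_subseq_LIMSEQ[OF xc k(1), unfolded o_def] LIMSEQ_subseq_LIMSEQ[OF Yc k(1), unfolded o_def] Yne le Kn])
        have sm: "strict_mono (k \<circ> k2)" using k(1) l(4) by (rule strict_mono_o)
        have "s_curve x0 s0"
        proof (rule s_curveI_eventually[OF b l(1-3), of "\<lambda>n. X (k (k2 n))" "\<lambda>n. Y (k (k2 n))"])
          show "(\<lambda>n. Y (k (k2 n))) \<longlonglongrightarrow> s0"
            using LIMSEQ_subseq_LIMSEQ[OF XY(4) sm] by (simp add: o_def)
          show "\<forall>\<^sub>F n in sequentially. complex_of_real (X (k (k2 n))) = l (complex_of_real (Y (k (k2 n))))"
            using l(5) by (intro always_eventually) blast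
        qed (use XY l(6) in auto)
        then show ?thesis ..
      next
        case False
        have "infinite (- N)" using False infinite_UNIV_nat
          by (metis Compl_partition finite_UnI)
        then obtain k where k: "strict_mono (k :: nat \<Rightarrow> nat)" "\<forall>n. k n \<in> - N" using infinite_enumerate by blast
        let ?K = "\<lambda>q. pd2 F (snd q, fst q)"
        have Xne: "complex_of_real (X (k n)) \<noteq> ?x0" for n using XY(2)[of "k n"] by simp
        have le: "norm (complex_of_real (Y (k n)) - ?s0) \<le> norm (complex_of_real (X (k n)) - ?x0)" for n
          using k(2)[rule_format, of n] by (simp add: N_def)
        have disc: "(pd1 (pd2 ?K) (?s0,?x0))\<^sup>2 \<noteq> pd1 (pd1 ?K) (?s0,?x0) * pd2 (pd2 ?K) (?s0,?x0)"
          unfolding pd_swap using p12 pp(1) by simp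
        obtain r l k2 where l: "r > 0" "l holomorphic_on ball ?x0 r" "l ?x0 = ?s0" "strict_mono (k2 :: nat \<Rightarrow> nat)"
          "\<forall>n. complex_of_real (X (k (k2 n))) \<in> ball ?x0 r \<and> complex_of_real (Y (k (k2 n))) = l (complex_of_real (X (k (k2 n))))"
          "\<forall>x\<in>ball ?x0 r. (l x, x) \<in> prod.swap -` Om \<and> ?K (l x, x) = 0"
        proof (rule hol2_node[OF hol2_swap[OF hol2_Z] open_swap_vimage[OF open_Om] _ _ _ _ disc
                LIMSEQ_subseq_LIMSEQ[OF Yc k(1), unfolded o_def] LIMSEQ_subseq_LIMSEQ[OF xc k(1), unfolded o_def] Xne le])
          show "pd1 ?K (?s0, ?x0) = 0" "pd2 ?K (?s0, ?x0) = 0"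
            unfolding pd_swap using p1z p2z by simp_all
        qed (use q Kn in auto)
        have sm: "strict_mono (k \<circ> k2)" using k(1) l(4) by (rule strict_mono_o)
        have "\<exists>(x,s)\<in>Bs. x < x0"
        proof (rule x_curveI_eventually[OF b l(1,2), of "\<lambda>n. X (k (k2 n))" "\<lambda>n. Y (k (k2 n))"])
          show "(\<lambda>n. X (k (k2 n))) \<longlonglongrightarrow> x0"
            using LIMSEQ_subseq_LIMSEQ[OF XY(3) sm] by (simp add: o_def)
          show "\<forall>\<^sub>F n in sequentially. complex_of_real (Y (k (k2 n))) = l (complex_of_real (X (k (k2 n))))"
            using l(5) by (intro always_eventually) blast
        qed (use XY l(6) in auto)
        then show ?thesis using \<open>3 * (rV x0 s0)\<^sup>2 = 1\<close> by blast
      qed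
    qed
  qed
qed

end

section \<open>Accumulation points do not exist\<close>

context ivp
begin

text \<open>A term of the sequence near the limit serves as a neighbour if its length differs from
  \<open>L\<close>; otherwise one of its own neighbours does.\<close>

lemma Bs_closed:
  assumes "\<And>n::nat. (Ls n, ss n) \<in> Bs" "Ls \<longlonglongrightarrow> L" "ss \<longlonglongrightarrow> s"
  shows "(L,s) \<in> Bs"
proof -
  have "(L,s) \<in> B" by (rule B_closed[OF Bs_B[OF assms(1)] assms(2,3)])
  moreover have "\<exists>b'\<in>B. dist b' (L,s) < e \<and> fst b' \<noteq> L" if "e > 0" for e
  proof -
    have "\<forall>\<^sub>F n in sequentially. dist (Ls n, ss n) (L,s) < e / 2"
      by (rule tendstoD[OF tendsto_Pair[OF assms(2,3)]]) (use that in simp)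
    then obtain n where n: "dist (Ls n, ss n) (L,s) < e / 2" by (auto simp: eventually_sequentially)
    show ?thesis
    proof (cases "Ls n = L")
      case True
      have "\<forall>e>0. \<exists>b'\<in>B. dist b' (Ls n, ss n) < e \<and> fst b' \<noteq> Ls n"
        using assms(1)[of n] by (simp add: Bs_def)
      from this[rule_format, OF half_gt_zero[OF that]] obtain b' where
        b': "b' \<in> B" "dist b' (Ls n, ss n) < e / 2" "fst b' \<noteq> L"
        unfolding True by (rule bexE) (elim conjE)
      have "dist b' (L,s) < e" using dist_triangle[of b' "(L,s)" "(Ls n, ss n)"] b'(2) n by linarith
      then show ?thesis using b' by blast
    next
      case False
      then show ?thesis using n that Bs_B[OF assms(1)] by (intro bexI[of _ "(Ls n, ss n)"]) auto
    qed
  qed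
  ultimately show ?thesis by (simp add: Bs_def)
qed

lemma B_subsequence:
  assumes "\<And>n::nat. (Ls n, ss n) \<in> B" "Ls \<longlonglongrightarrow> L"
  obtains k s where "strict_mono (k :: nat \<Rightarrow> nat)" "(\<lambda>n. ss (k n)) \<longlonglongrightarrow> s" "(\<lambda>n. Ls (k n)) \<longlonglongrightarrow> L"
proof -
  obtain M where M: "\<And>n. \<bar>Ls n\<bar> \<le> M"
    using assms(2) convergent_imp_Bseq[of Ls] by (auto simp: convergent_def Bseq_def)
  have "ss n \<in> {- (K0 * M)..K0 * M}" for n
  proof -
    have "\<bar>ss n\<bar> \<le> K0 * Ls n" by (rule B_slope_bound[OF assms(1)])
    also have "\<dots> \<le> K0 * M" using M[of n] K0_pos by (intro mult_left_mono) auto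
    finally show ?thesis by (simp add: abs_le_iff)
  qed
  then obtain s k where "strict_mono (k :: nat \<Rightarrow> nat)" "(ss \<circ> k) \<longlonglongrightarrow> s"
    using compact_imp_seq_compact[OF compact_Icc, of "- (K0 * M)" "K0 * M"] unfolding seq_compact_def by metis
  then show ?thesis using that LIMSEQ_subseq_LIMSEQ[OF assms(2)] by (simp add: o_def)
qed

lemma Bs_least:
  assumes "Bs \<noteq> {}"
  obtains a s where "(a,s) \<in> Bs" "\<And>x s. (x,s) \<in> Bs \<Longrightarrow> a \<le> x"
proof -
  let ?X = "fst ` Bs"
  have bdd: "bdd_below ?X"
    using B_length_bound[OF Bs_B] by (intro bdd_belowI[of _ "1 / M0"]) fastforce
  define a where "a = Inf ?X"
  have "\<exists>p. p \<in> Bs \<and> fst p < a + inverse (real (Suc n))" for n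
    using cInf_less_iff[of ?X "a + inverse (real (Suc n))"] bdd assms by (auto simp: a_def)
  then obtain b where b: "\<And>n. b n \<in> Bs" "\<And>n. fst (b n) < a + inverse (real (Suc n))" by metis
  have le: "a \<le> x" if "(x,s) \<in> Bs" for x s
    unfolding a_def by (rule cInf_lower[OF _ bdd]) (use that in force)
  have lim: "(\<lambda>n. fst (b n)) \<longlonglongrightarrow> a"
  proof (rule tendsto_sandwich[OF always_eventually always_eventually])
    show "\<forall>n. a \<le> fst (b n)" using le[of "fst (b n)" "snd (b n)" for n] b(1) by simp
    show "\<forall>n. fst (b n) \<le> a + inverse (real (Suc n))" using b(2) less_imp_le by blast
    show "(\<lambda>n. a + inverse (real (Suc n))) \<longlonglongrightarrow> a"
      using tendsto_add[OF tendsto_const LIMSEQ_inverse_real_of_nat, of a] by simp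
  qed simp
  have bp: "(fst (b n), snd (b n)) \<in> Bs" for n using b(1) by simp
  obtain k s where k: "strict_mono (k :: nat \<Rightarrow> nat)" "(\<lambda>n. snd (b (k n))) \<longlonglongrightarrow> s" "(\<lambda>n. fst (b (k n))) \<longlonglongrightarrow> a"
    using B_subsequence[OF Bs_B[OF bp] lim] by metis
  have "(a,s) \<in> Bs" by (rule Bs_closed[OF bp k(3,2)])
  then show ?thesis using that le by blast
qed

text \<open>The derivative of \<zeta>, read off from the extension, so that its continuity is
  inherited from a holomorphic function.\<close>

definition dz :: "real \<Rightarrow> real" where "dz x = Re (deriv zc (of_real x))"

lemma zeta_deriv: "x > 0 \<Longrightarrow> (\<zeta> has_real_derivative dz x) (at x)"
proof -
  assume x: "x > 0"
  have "(zc has_field_derivative deriv zc (of_real x)) (at (of_real x))"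
    by (rule holomorphic_derivI[OF zc_hol open_N]) (use zc_real[of x] x in auto)
  from Re_has_real_derivative[OF this]
  have "((\<lambda>t. Re (zc (of_real t))) has_real_derivative dz x) (at x)" by (simp add: dz_def)
  moreover have "\<forall>\<^sub>F t in nhds x. Re (zc (of_real t)) = \<zeta> t"
    using eventually_nhds_in_open[of "{0<..}" x] x by (auto elim!: eventually_mono simp: zc_real)
  from DERIV_cong_ev[OF refl this refl]
  have "((\<lambda>t. Re (zc (of_real t))) has_real_derivative dz x) (at x) \<longleftrightarrow> (\<zeta> has_real_derivative dz x) (at x)" .
  ultimately show ?thesis by simp
qed

lemma dz_continuous: "continuous_on {0<..} dz"
proof -
  have "continuous_on {0<..} (\<lambda>x. deriv zc (complex_of_real x))"
    by (rule continuous_on_compose2[OF holomorphic_on_imp_continuous_on[OF holomorphic_deriv[OF zc_hol open_N]]])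
       (use zc_real in \<open>auto intro!: continuous_intros\<close>)
  then show ?thesis unfolding dz_def[abs_def] by (intro continuous_on_Re)
qed

section \<open>The branch that starts at the fold\<close>

text \<open>The equation of \<open>Bs_acceleration_zero\<close> differentiated along the curve.
  Since \<open>rW \<noteq> 0\<close>, a stationary length forces \<open>3 * p^2 = 1\<close>, and
  conversely \<open>3 * p^2 \<noteq> 1\<close> forces both \<open>dz\<close> and \<open>l'\<close>
  to be nonzero.\<close>

lemma s_curve_relation:
  assumes l: "\<And>s. \<bar>s - s0\<bar> < r \<Longrightarrow> (l s, s) \<in> Bs"
    and "\<bar>s - s0\<bar> < r" "(l has_real_derivative l') (at s)"
    and p: "((\<lambda>s. rV (l s) s) has_real_derivative rW (l s) s) (at s)"
  shows "(3 * (rV (l s) s)\<^sup>2 - 1) * rW (l s) s + dz (l s) * l' = 0"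
proof -
  have "l s > 0" using Bs_B[OF l[OF assms(2)]] B_D by blast
  have "((\<lambda>s. \<zeta> (l s)) has_real_derivative dz (l s) * l') (at s)"
    by (rule DERIV_chain2[OF zeta_deriv[OF \<open>l s > 0\<close>] assms(3)])
  then have "((\<lambda>s. rV (l s) s ^ 3 - rV (l s) s + \<zeta> (l s)) has_real_derivative
      ((3 * (rV (l s) s)\<^sup>2 - 1) * rW (l s) s + dz (l s) * l')) (at s)"
    by (auto intro!: derivative_eq_intros p simp: algebra_simps)
  moreover have "\<forall>\<^sub>F s in nhds s. rV (l s) s ^ 3 - rV (l s) s + \<zeta> (l s) = 0"
    using eventually_abs_diff_less[OF assms(2)] by eventually_elim (rule Bs_acceleration_zero[OF l])
  from DERIV_cong_ev[OF refl this refl]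
  have "((\<lambda>s. rV (l s) s ^ 3 - rV (l s) s + \<zeta> (l s)) has_real_derivative
      ((3 * (rV (l s) s)\<^sup>2 - 1) * rW (l s) s + dz (l s) * l')) (at s) \<longleftrightarrow>
      ((\<lambda>s. 0) has_real_derivative ((3 * (rV (l s) s)\<^sup>2 - 1) * rW (l s) s + dz (l s) * l')) (at s)" .
  ultimately have "((\<lambda>s. 0) has_real_derivative ((3 * (rV (l s) s)\<^sup>2 - 1) * rW (l s) s + dz (l s) * l')) (at s)"
    by simp
  then show ?thesis using DERIV_unique[OF _ DERIV_const] by blast
qed

text \<open>The local maximiser of \<open>p^3 - p\<close>, where the two negative roots
  merge.\<close>

definition q0 :: real where "q0 = - sqrt (1/3)"

lemma q0: "q0 < 0" "3 * q0\<^sup>2 = 1" "-1 < q0"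
proof -
  show "q0 < 0" by (simp add: q0_def)
  show "3 * q0\<^sup>2 = 1" by (simp add: q0_def)
  have "sqrt (1/3) < sqrt 1" by (rule real_sqrt_less_mono) simp
  then show "-1 < q0" by (simp add: q0_def)
qed

lemma q0_sq_less:
  assumes "q0 < p" "p < 0"
  shows "3 * p\<^sup>2 < 1"
proof -
  have "p\<^sup>2 < q0\<^sup>2" using power_strict_mono[of "- p" "- q0" 2] assms by simp
  then show ?thesis using q0 by linarith
qed

lemma cubic_antimono:
  assumes "q0 \<le> p" "p < p'" "p' \<le> 0"
  shows "p' ^ 3 - p' < p ^ 3 - p"
proof -
  have e: "(p ^ 3 - p) - (p' ^ 3 - p') = (p' - p) * (1 - (p\<^sup>2 + p * p' + p'\<^sup>2))"
    by (simp add: algebra_simps power2_eq_square power3_eq_cube)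
  have "p\<^sup>2 \<le> q0\<^sup>2" using power_mono[of "- p" "- q0" 2] assms by simp
  moreover have "p * p' \<le> p * p" using assms by (intro mult_left_mono_neg) auto
  moreover have "p'\<^sup>2 < p\<^sup>2" using power_strict_mono[of "- p'" "- p" 2] assms by simp
  ultimately have "p\<^sup>2 + p * p' + p'\<^sup>2 < 1" using q0(2) unfolding power2_eq_square by linarith
  then have "0 < (p' - p) * (1 - (p\<^sup>2 + p * p' + p'\<^sup>2))" using assms by (intro mult_pos_pos) auto
  then show ?thesis using e by linarith
qed

text \<open>The lengths over which the inner negative root is attained at an accumulation point. The
  cubic is injective on \<open>{q0..0}\<close>, so such a point is determined by its length.\<close>

definition S :: "real set" where
  "S = {L. \<exists>s. (L,s) \<in> Bs \<and> q0 < rV L s \<and> rV L s < 0}"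

lemma cos_zero_separated:
  assumes "cos x = 0" "cos y = 0" "x \<noteq> (y::real)"
  shows "pi \<le> \<bar>x - y\<bar>"
proof -
  have "sin (x - y) = 0" using assms by (simp add: sin_diff)
  then obtain i :: int where i: "x - y = of_int i * pi" using sin_zero_iff_int2 by blast
  then have "i \<noteq> 0" using assms by auto
  then have "1 * pi \<le> \<bar>of_int i\<bar> * pi" by (intro mult_right_mono) auto
  then show ?thesis using i by (simp add: abs_mult)
qed

text \<open>Along the curve the angle is continuous and takes values among the zeros of the cosine,
  which are at distance at least pi from each other.\<close>

lemma angle_curve_const:
  assumes l: "continuous_on {u..v} l" and B: "\<And>s. s \<in> {u..v} \<Longrightarrow> (l s, s) \<in> B" and s: "s \<in> {u..v}" "s' \<in> {u..v}"
  shows "angle (l s) s = angle (l s') s'"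
proof -
  have b: "l s > 0" "dom (l s) s" if "s \<in> {u..v}" for s using B_D[OF B[OF that]] by auto
  have d: "dom (l s * y) s" if "s \<in> {u..v}" "y \<in> {0..1}" for s y
    using dom_mono[OF b(2)[OF that(1)], of "l s * y"] b(1)[OF that(1)] that(2) by (simp add: mult_left_le)
  have pc: "continuous_on ({u..v} \<times> {0..1}) (\<lambda>p. (l (fst p) * snd p, fst p))"
    by (intro continuous_intros continuous_on_compose2[OF l]) auto
  have *: "continuous_on ({u..v} \<times> {0..1}) (\<lambda>p. Re (H (cpt (l (fst p) * snd p) (fst p))))" if "hol2 Om H" for H
  proof -
    have "(\<lambda>p. (l (fst p) * snd p, fst p)) ` ({u..v} \<times> {0..1}) \<subseteq> {p. cpt (fst p) (snd p) \<in> Om}"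
      using d by (auto simp: dom_def)
    from continuous_on_compose2[OF real_continuous[OF that] pc this] show ?thesis by simp
  qed
  note c = *[OF hol2_V, folded rV_def] *[OF hol2_W, folded rW_def] *[OF hol2_Z, folded rZ_def]
  have nz: "(rW (l s * y) s)\<^sup>2 + (rZ (l s * y) s)\<^sup>2 \<noteq> 0" if "s \<in> {u..v}" "y \<in> {0..1}" for s y
    by (rule WZ_nonzero[OF d[OF that]]) (use b(1)[OF that(1)] that(2) in auto)
  have "continuous_on ({u..v} \<times> {0..1}) (\<lambda>p. ang_rate (l (fst p) * snd p) (fst p))"
    unfolding ang_rate_def by (intro continuous_intros c) (use nz in auto)
  then have "continuous_on {u..v} (\<lambda>s. integral {0..1} (\<lambda>y. ang_rate (l s * y) s))"
    using integral_continuous_on_param[of "{u..v}" 0 "1::real" "\<lambda>s y. ang_rate (l s * y) s"] by (simp add: split_beta)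
  then have ca: "continuous_on {u..v} (\<lambda>s. angle (l s) s)"
    unfolding angle_def by (intro continuous_intros l)
  have "(\<lambda>s. angle (l s) s) constant_on {u..v}"
  proof (rule continuous_discrete_range_constant[OF _ ca])
    fix x assume x: "x \<in> {u..v}"
    show "\<exists>e>0. \<forall>y. y \<in> {u..v} \<and> angle (l y) y \<noteq> angle (l x) x \<longrightarrow> e \<le> norm (angle (l y) y - angle (l x) x)"
      using cos_zero_separated cos_angle_zero[OF B] x by (intro exI[of _ pi]) auto
  qed simp
  then show ?thesis using s unfolding constant_on_def by metis
qed

text \<open>Off the fold \<open>l'\<close> is nonzero, so the length takes values on both sides of
  \<open>L\<close> along the curve and, by the intermediate value theorem, all values near
  \<open>L\<close>; the angle does not change on the way.\<close>

lemma S_neighbourhood: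
  assumes "(L,s) \<in> Bs" "q0 < rV L s" "rV L s < 0"
  shows "dz L \<noteq> 0"
    and "\<exists>e>0. \<forall>L'. \<bar>L' - L\<bar> < e \<longrightarrow> (\<exists>s'. (L',s') \<in> Bs \<and> q0 < rV L' s' \<and> rV L' s' < 0 \<and> angle L' s' = angle L s)"
proof -
  have ne: "3 * (rV L s)\<^sup>2 - 1 \<noteq> 0" using q0_sq_less[OF assms(2,3)] by simp
  then have "s_curve L s" using Bs_local[OF assms(1)] by auto
  then obtain r l l' where r: "r > 0" and l0: "l s = L"
    and l: "\<And>t. \<bar>t - s\<bar> < r \<Longrightarrow> (l t, t) \<in> Bs \<and> (l has_real_derivative l' t) (at t) \<and>
       ((\<lambda>s. rV (l s) s) has_real_derivative rW (l t) t) (at t)"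
    unfolding s_curve_def by blast
  have rel: "(3 * (rV (l s) s)\<^sup>2 - 1) * rW (l s) s + dz (l s) * l' s = 0"
    by (rule s_curve_relation[of s r l]) (use l r in auto)
  have "rW (l s) s \<noteq> 0" using B_W_nonzero Bs_B[OF assms(1)] l0 by simp
  then have "dz L * l' s \<noteq> 0" using rel ne l0 by (auto simp: add_eq_0_iff)
  then have dzL: "dz L \<noteq> 0" and l'0: "l' s \<noteq> 0" by auto
  show "dz L \<noteq> 0" by (rule dzL)
  have "isCont (\<lambda>s. rV (l s) s) s" using l[of s] r DERIV_isCont by auto
  then have pl: "((\<lambda>t. rV (l t) t) \<longlongrightarrow> rV (l s) s) (nhds s)"
    using tendsto_at_iff_tendsto_nhds[of "\<lambda>t. rV (l t) t" s] by (simp add: isCont_def)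
  have "\<forall>\<^sub>F t in nhds s. q0 < rV (l t) t \<and> rV (l t) t < 0"
    by (intro eventually_conj order_tendstoD[OF pl]) (use assms l0 in auto)
  then obtain d where d: "d > 0" "\<And>t. dist t s < d \<Longrightarrow> q0 < rV (l t) t \<and> rV (l t) t < 0"
    by (auto simp: eventually_nhds_metric)
  have ls: "(l has_real_derivative l' s) (at s)" using l[of s] r by auto
  have "\<exists>h>0. h < min r d \<and> (l (s - h) < L \<and> L < l (s + h) \<or> l (s + h) < L \<and> L < l (s - h))"
  proof (cases "l' s > 0")
    case True
    obtain d1 d2 where d12: "d1 > 0" "\<And>h. 0 < h \<Longrightarrow> h < d1 \<Longrightarrow> l s < l (s + h)"
      "d2 > 0" "\<And>h. 0 < h \<Longrightarrow> h < d2 \<Longrightarrow> l (s - h) < l s"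
      using DERIV_pos_inc_right[OF ls True] DERIV_pos_inc_left[OF ls True] by blast
    define h where "h = min (min d1 d2) (min r d) / 2"
    have "0 < h" "h < d1" "h < d2" "h < min r d" using d12 r d by (auto simp: h_def)
    then show ?thesis using d12 l0 by blast
  next
    case False
    then have neg: "l' s < 0" using l'0 by simp
    obtain d1 d2 where d12: "d1 > 0" "\<And>h. 0 < h \<Longrightarrow> h < d1 \<Longrightarrow> l s > l (s + h)"
      "d2 > 0" "\<And>h. 0 < h \<Longrightarrow> h < d2 \<Longrightarrow> l (s - h) > l s"
      using DERIV_neg_dec_right[OF ls neg] DERIV_neg_dec_left[OF ls neg] by blast
    define h where "h = min (min d1 d2) (min r d) / 2"
    have "0 < h" "h < d1" "h < d2" "h < min r d" using d12 r d by (auto simp: h_def)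
    then show ?thesis using d12 l0 by blast
  qed
  then obtain h where h: "h > 0" "h < min r d" "l (s - h) < L \<and> L < l (s + h) \<or> l (s + h) < L \<and> L < l (s - h)" by blast
  let ?I = "{s - h..s + h}"
  have Ir: "\<bar>t - s\<bar> < r" and Id: "dist t s < d" if "t \<in> ?I" for t
    using that h by (auto simp: dist_real_def)
  have lc: "continuous_on ?I l"
    using l[OF Ir] DERIV_isCont continuous_at_imp_continuous_on by blast
  define e where "e = min \<bar>L - l (s - h)\<bar> \<bar>l (s + h) - L\<bar>"
  have "e > 0" using h(3) by (auto simp: e_def)
  moreover have "\<exists>s'. (L',s') \<in> Bs \<and> q0 < rV L' s' \<and> rV L' s' < 0 \<and> angle L' s' = angle L s" if L': "\<bar>L' - L\<bar> < e" for L'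
  proof -
    have "\<exists>t\<in>?I. l t = L'"
      using h(3)
    proof
      assume *: "l (s - h) < L \<and> L < l (s + h)"
      then have "l (s - h) \<le> L'" "L' \<le> l (s + h)" using L' unfolding e_def by linarith+
      from IVT'[OF this _ lc] show ?thesis using h(1) by auto
    next
      assume *: "l (s + h) < L \<and> L < l (s - h)"
      then have "l (s + h) \<le> L'" "L' \<le> l (s - h)" using L' unfolding e_def by linarith+
      from IVT2'[OF this _ lc] show ?thesis using h(1) by auto
    qed
    then obtain t where t: "t \<in> ?I" "l t = L'" by blast
    have "angle (l t) t = angle (l s) s"
      by (rule angle_curve_const[OF lc]) (use t h Bs_B l[OF Ir] in auto)
    then show ?thesis using t l[OF Ir[OF t(1)]] d(2)[OF Id[OF t(1)]] l0 by auto
  qed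
  ultimately show "\<exists>e>0. \<forall>L'. \<bar>L' - L\<bar> < e \<longrightarrow> (\<exists>s'. (L',s') \<in> Bs \<and> q0 < rV L' s' \<and> rV L' s' < 0 \<and> angle L' s' = angle L s)"
    by blast
qed

text \<open>Minimality acts three times: it discards the second alternative of
  \<open>Bs_local\<close>, makes the length stationary, and sends the curve towards larger lengths.
  With \<open>3 * p^2 = 1\<close> the root equation reads \<open>(2/3) * p = \<zeta> a\<close>, so
  \<open>\<zeta> < 0\<close> selects the negative root.\<close>

lemma least_fold:
  assumes a: "(a,sa) \<in> Bs" and least: "\<And>x s. (x,s) \<in> Bs \<Longrightarrow> a \<le> x"
  shows "\<zeta> a = - (q0 ^ 3 - q0)" and "\<exists>b>a. {a<..<b} \<subseteq> S"
proof -
  have "\<not> (\<exists>(x,s)\<in>Bs. x < a)" using least by fastforce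
  then have "s_curve a sa" using Bs_local[OF a] by blast
  then obtain r l l' where r: "r > 0" and l0: "l sa = a"
    and l: "\<And>t. \<bar>t - sa\<bar> < r \<Longrightarrow> (l t, t) \<in> Bs \<and> (l has_real_derivative l' t) (at t) \<and> (t \<noteq> sa \<longrightarrow> l t \<noteq> a) \<and>
       ((\<lambda>s. rV (l s) s) has_real_derivative rW (l t) t) (at t)"
    unfolding s_curve_def by blast
  have ge: "a \<le> l t" if "\<bar>t - sa\<bar> < r" for t using least l[OF that] by blast
  have "l' sa = 0"
  proof (rule DERIV_local_min[OF _ r])
    show "(l has_real_derivative l' sa) (at sa)" using l[of sa] r by auto
    show "\<forall>y. \<bar>sa - y\<bar> < r \<longrightarrow> l sa \<le> l y" using ge l0 by (simp add: abs_minus_commute)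
  qed
  moreover have "(3 * (rV (l sa) sa)\<^sup>2 - 1) * rW (l sa) sa + dz (l sa) * l' sa = 0"
    by (rule s_curve_relation[of sa r l]) (use l r in auto)
  moreover have W: "rW a sa \<noteq> 0" using B_W_nonzero Bs_B[OF a] by simp
  ultimately have p: "3 * (rV a sa)\<^sup>2 = 1" using l0 by simp
  have a0: "a > 0" using B_D Bs_B[OF a] by blast
  have acc: "rV a sa ^ 3 - rV a sa + \<zeta> a = 0" by (rule Bs_acceleration_zero[OF a])
  have "rV a sa ^ 3 - rV a sa = - (2/3) * rV a sa"
    using p by (simp add: power3_eq_cube power2_eq_square algebra_simps)
  then have neg: "rV a sa < 0" using acc zeta_bounds[of a] a0 by simp
  have "(rV a sa)\<^sup>2 = q0\<^sup>2" using p q0 by simp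
  then have pq: "rV a sa = q0" using neg q0(1) by (auto simp: power2_eq_iff)
  then show "\<zeta> a = - (q0 ^ 3 - q0)" using acc by simp
  have p': "((\<lambda>s. rV (l s) s) has_real_derivative rW a sa) (at sa)" using l[of sa] r l0 by auto
  have "isCont (\<lambda>s. rV (l s) s) sa" using p' DERIV_isCont by blast
  then have pl: "((\<lambda>t. rV (l t) t) \<longlongrightarrow> rV (l sa) sa) (nhds sa)"
    using tendsto_at_iff_tendsto_nhds[of "\<lambda>t. rV (l t) t" sa] by (simp add: isCont_def)
  have "\<forall>\<^sub>F t in nhds sa. rV (l t) t < 0"
    by (rule order_tendstoD[OF pl]) (use neg l0 in auto)
  then obtain d where d: "d > 0" "\<And>t. dist t sa < d \<Longrightarrow> rV (l t) t < 0"
    by (auto simp: eventually_nhds_metric)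
  \<comment> \<open>The sign \<open>c\<close> is the direction of the slope in which the end value
    moves from \<open>q0\<close> into the inner interval; it is the sign of
    \<open>rW\<close>.\<close>
  have "\<exists>c. \<bar>c\<bar> = 1 \<and> (\<exists>d>0. \<forall>h. 0 < h \<longrightarrow> h < d \<longrightarrow> q0 < rV (l (sa + c * h)) (sa + c * h))"
  proof (cases "rW a sa > 0")
    case True
    then show ?thesis using DERIV_pos_inc_right[OF p' True] l0 pq by (intro exI[of _ 1]) auto
  next
    case False
    then have "rW a sa < 0" using W by simp
    then show ?thesis using DERIV_neg_dec_left[OF p'] l0 pq by (intro exI[of _ "-1"]) auto
  qed
  then obtain c d1 where c: "\<bar>c\<bar> = 1" "d1 > 0" "\<And>h. 0 < h \<Longrightarrow> h < d1 \<Longrightarrow> q0 < rV (l (sa + c * h)) (sa + c * h)" by blast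
  define h0 where "h0 = min (min d d1) r / 2"
  have h0: "h0 > 0" "h0 < d" "h0 < d1" "h0 < r" using d c r by (auto simp: h0_def)
  have near: "\<bar>sa + c * h - sa\<bar> = h" if "h \<in> {0..h0}" for h using c(1) that by (simp add: abs_mult)
  have lc: "continuous_on {0..h0} (\<lambda>h. l (sa + c * h))"
  proof (rule continuous_at_imp_continuous_on, rule ballI)
    fix h assume h: "h \<in> {0..h0}"
    have "isCont l (sa + c * h)" using l[of "sa + c * h"] near[OF h] h h0 DERIV_isCont by auto
    then show "isCont (\<lambda>h. l (sa + c * h)) h"
      by (intro isCont_o2[where g = l and f = "\<lambda>h. sa + c * h"]) (auto intro!: continuous_intros)
  qed
  define b where "b = l (sa + c * h0)"
  have "sa + c * h0 \<noteq> sa" using c(1) h0 by auto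
  \<comment> \<open>Minimality gives \<open>l \<ge> a\<close>, and \<open>s_curve\<close> excludes
    equality away from \<open>sa\<close>.\<close>
  then have "b > a" using ge[of "sa + c * h0"] l[of "sa + c * h0"] near[of h0] h0 by (force simp: b_def)
  moreover have "L \<in> S" if L: "L \<in> {a<..<b}" for L
  proof -
    have "\<exists>h\<ge>0. h \<le> h0 \<and> l (sa + c * h) = L"
      by (rule IVT') (use L l0 h0 lc in \<open>auto simp: b_def\<close>)
    then obtain h where h: "h \<in> {0..h0}" "l (sa + c * h) = L" by auto
    have "h \<noteq> 0" using h(2) L l0 by auto
    then have hp: "0 < h" "h < d1" "h < d" "h < r" using h(1) h0 by auto
    have "q0 < rV L (sa + c * h)" using c(3)[OF hp(1,2)] h(2) by simp
    moreover have "rV L (sa + c * h) < 0"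
      using d(2)[of "sa + c * h"] near[OF h(1)] hp(3) h(2) by (simp add: dist_real_def)
    moreover have "(L, sa + c * h) \<in> Bs" using l[of "sa + c * h"] near[OF h(1)] hp(4) h(2) by auto
    ultimately show ?thesis by (auto simp: S_def)
  qed
  ultimately show "\<exists>b>a. {a<..<b} \<subseteq> S" by blast
qed


lemma S_dz: "L \<in> S \<Longrightarrow> dz L \<noteq> 0"
  using S_neighbourhood(1) by (auto simp: S_def)

lemma S_zeta: "L \<in> S \<Longrightarrow> - (q0 ^ 3 - q0) < \<zeta> L"
proof -
  assume "L \<in> S"
  then obtain s where s: "(L,s) \<in> Bs" "q0 < rV L s" "rV L s < 0" by (auto simp: S_def)
  then show ?thesis using Bs_acceleration_zero[OF s(1)] cubic_antimono[of q0 "rV L s"] by simp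
qed

lemma open_S: "L \<in> S \<Longrightarrow> \<exists>e>0. \<forall>L'. \<bar>L' - L\<bar> < e \<longrightarrow> L' \<in> S"
proof -
  assume "L \<in> S"
  then obtain s where s: "(L,s) \<in> Bs" "q0 < rV L s" "rV L s < 0" by (auto simp: S_def)
  show ?thesis using S_neighbourhood(2)[OF s] unfolding S_def by blast
qed

lemma zeta_mvt:
  assumes "0 < x" "x < y"
  shows "\<exists>z. x < z \<and> z < y \<and> \<zeta> y - \<zeta> x = (y - x) * dz z"
  by (rule MVT2) (use assms zeta_deriv in auto)

text \<open>\<open>dz\<close> has no zero on \<open>S\<close>, and \<zeta> lies above
  \<open>\<zeta> a\<close> there, so \<open>dz\<close> is positive somewhere between
  \<open>a\<close> and \<open>y\<close>; a sign change would produce a zero.\<close>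

lemma dz_pos:
  assumes "a > 0" "\<zeta> a = - (q0 ^ 3 - q0)" "{a<..<b} \<subseteq> S" "y \<in> {a<..<b}"
  shows "dz y > 0"
proof (rule ccontr)
  assume "\<not> dz y > 0"
  obtain z where z: "a < z" "z < y" "\<zeta> y - \<zeta> a = (y - a) * dz z"
    using zeta_mvt[of a y] assms by auto
  have "0 < (y - a) * dz z" using S_zeta[of y] z(3) assms by auto
  then have "dz z > 0" using z by (simp add: zero_less_mult_iff)
  then have "\<exists>x\<ge>z. x \<le> y \<and> dz x = 0"
    using \<open>\<not> dz y > 0\<close> z assms(1)
    by (intro IVT2') (auto intro: continuous_on_subset[OF dz_continuous])
  then obtain x where x: "z \<le> x" "x \<le> y" "dz x = 0" by blast
  then have "x \<in> S" using z assms(3,4) by (intro subsetD[OF assms(3)]) auto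
  then show False using S_dz x(3) by blast
qed

text \<open>At a finite end \<open>b\<close> compactness yields an accumulation point with root in
  \<open>{q0..0}\<close>. The root \<open>q0\<close> is excluded since \<zeta> has increased beyond
  \<open>\<zeta> a\<close>, the root 0 since \<open>\<zeta> b < 0\<close>; so \<open>b\<close> lies
  in \<open>S\<close>, which is open.\<close>

lemma S_unbounded:
  assumes a: "a > 0" "\<zeta> a = - (q0 ^ 3 - q0)" and ex: "\<exists>b>a. {a<..<b} \<subseteq> S"
  shows "{a<..} \<subseteq> S"
proof (rule ccontr)
  assume "\<not> {a<..} \<subseteq> S"
  then obtain L1 where L1: "L1 > a" "L1 \<notin> S" by auto
  define T where "T = {b. a < b \<and> {a<..<b} \<subseteq> S}"
  have bdd: "bdd_above T"
    using L1 by (intro bdd_aboveI[of _ L1]) (force simp: T_def not_le[symmetric])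
  have ne: "T \<noteq> {}" using ex by (auto simp: T_def)
  define b where "b = Sup T"
  have up: "\<beta> \<le> b" if "\<beta> \<in> T" for \<beta> using cSup_upper[OF that bdd] by (simp add: b_def)
  have ab: "a < b" using up ne by (force simp: T_def)
  have sub: "{a<..<b} \<subseteq> S"
  proof
    fix x assume x: "x \<in> {a<..<b}"
    then obtain \<beta> where "\<beta> \<in> T" "x < \<beta>" using less_cSup_iff[OF ne bdd] by (auto simp: b_def)
    then show "x \<in> S" using x by (auto simp: T_def)
  qed
  have b0: "b > 0" using a(1) ab by simp
  obtain z where z: "a < z" "z < b" "\<zeta> b - \<zeta> a = (b - a) * dz z" using zeta_mvt[OF a(1) ab] by blast
  have "dz z > 0" by (rule dz_pos[OF a sub]) (use z in auto)
  then have "0 < (b - a) * dz z" using ab by simp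
  then have \<zeta>b: "- \<zeta> b < q0 ^ 3 - q0" using z(3) a(2) by linarith
  define Ls where "Ls n = b - (b - a) / 2 * inverse (real (Suc n))" for n
  have LS: "Ls n \<in> S" for n
  proof -
    have "0 < inverse (real (Suc n))" "inverse (real (Suc n)) \<le> 1" by (simp_all add: inverse_le_1_iff)
    then have "0 < (b - a) / 2 * inverse (real (Suc n))" "(b - a) / 2 * inverse (real (Suc n)) \<le> (b - a) / 2 * 1"
      using ab by (auto intro!: mult_left_mono mult_pos_pos simp del: of_nat_Suc)
    then show ?thesis using ab by (intro subsetD[OF sub]) (simp add: Ls_def field_simps del: of_nat_Suc)
  qed
  have Llim: "Ls \<longlonglongrightarrow> b"
    unfolding Ls_def[abs_def]
    using tendsto_diff[OF tendsto_const[of b] tendsto_mult[OF tendsto_const[of "(b - a) / 2"] LIMSEQ_inverse_real_of_nat]] by simp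
  have "\<forall>n. \<exists>s. (Ls n, s) \<in> Bs \<and> q0 < rV (Ls n) s \<and> rV (Ls n) s < 0" using LS by (simp add: S_def)
  then obtain ss where ss: "\<And>n. (Ls n, ss n) \<in> Bs" "\<And>n. q0 < rV (Ls n) (ss n)" "\<And>n. rV (Ls n) (ss n) < 0" by metis
  obtain k s where k: "strict_mono (k :: nat \<Rightarrow> nat)" "(\<lambda>n. ss (k n)) \<longlonglongrightarrow> s" "(\<lambda>n. Ls (k n)) \<longlonglongrightarrow> b"
    using B_subsequence[OF Bs_B[OF ss(1)] Llim] by metis
  have bs: "(b,s) \<in> Bs" by (rule Bs_closed[OF ss(1) k(3,2)])
  have "cpt b s \<in> Om" using B_complex(1)[OF Bs_B[OF bs]] .
  then have "isCont (\<lambda>p. rV (fst p) (snd p)) (b,s)"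
    using real_continuous[OF hol2_V] open_real_Om unfolding rV_def by (auto simp: continuous_on_eq_continuous_at)
  then have lim: "(\<lambda>n. rV (Ls (k n)) (ss (k n))) \<longlonglongrightarrow> rV b s"
    using isCont_tendsto_compose[OF _ tendsto_Pair[OF k(3,2)]] by fastforce
  have "q0 \<le> rV b s" using LIMSEQ_le_const[OF lim] ss(2) less_imp_le by blast
  moreover have "rV b s \<le> 0" using LIMSEQ_le_const2[OF lim] ss(3) less_imp_le by blast
  moreover have acc: "rV b s ^ 3 - rV b s = - \<zeta> b" using Bs_acceleration_zero[OF bs] by simp
  then have "rV b s \<noteq> 0" using zeta_bounds[of b] b0 by auto
  moreover have "rV b s \<noteq> q0" using acc \<zeta>b by auto
  ultimately have "b \<in> S" using bs unfolding S_def by force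
  then obtain e where e: "e > 0" "\<And>L'. \<bar>L' - b\<bar> < e \<Longrightarrow> L' \<in> S" using open_S by blast
  have "{a<..<b + e} \<subseteq> S"
  proof
    fix x assume x: "x \<in> {a<..<b + e}"
    show "x \<in> S"
    proof (cases "x < b")
      case True then show ?thesis using sub x by auto
    next
      case False then show ?thesis using e x by auto
    qed
  qed
  then have "b + e \<in> T" using ab e by (simp add: T_def)
  then show False using up e by force
qed

section \<open>Uniqueness along the branch and the growth of the angle\<close>

text \<open>Both velocities vanish at \<open>L\<close>, so the two trajectories share their terminal
  data. Their difference solves a linear system with bounded coefficient, along which zero
  propagates back to the initial slope.\<close>

lemma terminal_data_unique:
  assumes b: "(L,s) \<in> B" "(L,s') \<in> B" and eq: "rV L s = rV L s'"
  shows "s = s'"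
proof -
  have bb: "L > 0" "dom L s" "dom L s'" "rF L s = 0" "rF L s' = 0" using B_D[OF b(1)] B_D[OF b(2)] by auto
  have dx: "dom x s" "dom x s'" if "x \<in> {0..L}" for x using dom_mono bb that by auto
  let ?h = "\<lambda>x. (rV x s)\<^sup>2 + rV x s * rV x s' + (rV x s')\<^sup>2 - 1"
  have "rF 0 s - rF 0 s' = 0"
  proof (rule linear_system_unique(2)[of L "\<lambda>x. rV x s - rV x s'" 1 "\<lambda>x. rF x s - rF x s'" ?h "3 * C0\<^sup>2 + 1" L])
    fix x assume x: "x \<in> {0..L}"
    show "((\<lambda>x. rV x s - rV x s') has_real_derivative 1 * (rF x s - rF x s')) (at x within {0..L})"
      using DERIV_diff[OF rV_x[OF dx(1)[OF x]] rV_x[OF dx(2)[OF x]]] by (simp add: has_field_derivative_at_within)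
    have "((\<lambda>x. rF x s - rF x s') has_real_derivative (rV x s ^ 3 - rV x s + \<zeta> x) - (rV x s' ^ 3 - rV x s' + \<zeta> x)) (at x)"
      by (rule DERIV_diff[OF rF_x[OF dx(1)[OF x]] rF_x[OF dx(2)[OF x]]])
    moreover have "(rV x s ^ 3 - rV x s + \<zeta> x) - (rV x s' ^ 3 - rV x s' + \<zeta> x) = 1 * ?h x * (rV x s - rV x s')"
      by (simp add: algebra_simps power2_eq_square power3_eq_cube)
    ultimately show "((\<lambda>x. rF x s - rF x s') has_real_derivative 1 * ?h x * (rV x s - rV x s')) (at x within {0..L})"
      by (simp only: has_field_derivative_at_within)
    have V: "\<bar>rV x s\<bar> \<le> C0" "\<bar>rV x s'\<bar> \<le> C0" using B_bound b x by auto
    have "\<bar>rV x s * rV x s'\<bar> \<le> C0 * C0" unfolding abs_mult using V by (intro mult_mono) auto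
    moreover have "(rV x s)\<^sup>2 \<le> C0\<^sup>2" "(rV x s')\<^sup>2 \<le> C0\<^sup>2" using V by (simp_all add: power2_le_iff_abs_le)
    ultimately show "\<bar>?h x\<bar> \<le> 3 * C0\<^sup>2 + 1"
      using zero_le_power2[of "rV x s"] zero_le_power2[of "rV x s'"] zero_le_power2[of C0]
      unfolding power2_eq_square[of C0] abs_le_iff by linarith
  qed (use bb eq in auto)
  then show ?thesis using r_init by simp
qed

lemma S_unique:
  assumes "(L,s) \<in> Bs" "q0 < rV L s" "rV L s < 0" "(L,s') \<in> Bs" "q0 < rV L s'" "rV L s' < 0"
  shows "s = s'"
proof (rule terminal_data_unique)
  have "rV L s ^ 3 - rV L s = rV L s' ^ 3 - rV L s'"
    using Bs_acceleration_zero[OF assms(1)] Bs_acceleration_zero[OF assms(4)] by simp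
  then show "rV L s = rV L s'"
    using cubic_antimono[of "rV L s" "rV L s'"] cubic_antimono[of "rV L s'" "rV L s"] assms
    by (cases "rV L s" "rV L s'" rule: linorder_cases) auto
qed (use assms Bs_B in auto)

text \<open>The potential of the equation frozen at the forcing \<open>-(p^3 - p)\<close> is
  \<open>-v^4/4 + v^2/2 + (p^3 - p) * v\<close>, with second derivative
  \<open>1 - 3 * p^2 \<ge> \<kappa>\<close> at \<open>p\<close>. For
  \<open>r = \<kappa> / 16\<close> the higher order terms cost at most \<open>5 * r / 4\<close> of
  the leading \<open>\<kappa> / 2\<close>, so the wall at distance \<open>r\<close> is higher than
  \<open>\<kappa> * r^2 / 4\<close>.\<close>

lemma quartic_well:
  assumes "d\<^sup>2 = r\<^sup>2" "r > 0" "r = \<kappa> / 16" "\<kappa> \<le> 1 - 3 * p\<^sup>2" "\<kappa> \<le> 1" "\<bar>p\<bar> \<le> (1::real)"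
  shows "\<kappa> * r\<^sup>2 / 4 < (- ((p + d) ^ 4) / 4 + (p + d)\<^sup>2 / 2 + (p ^ 3 - p) * (p + d)) - (- (p ^ 4) / 4 + p\<^sup>2 / 2 + (p ^ 3 - p) * p)"
proof -
  have e: "(- ((p + d) ^ 4) / 4 + (p + d)\<^sup>2 / 2 + (p ^ 3 - p) * (p + d)) - (- (p ^ 4) / 4 + p\<^sup>2 / 2 + (p ^ 3 - p) * p)
      = d\<^sup>2 * (1 / 2 * (1 - 3 * p\<^sup>2) - p * d - d\<^sup>2 / 4)"
    by (simp add: field_simps power2_eq_square power3_eq_cube power4_eq_xxxx)
  have dr: "\<bar>d\<bar> = r" using assms(1,2) by (metis abs_of_pos power2_eq_iff abs_minus_cancel)
  have r1: "r \<le> 1" using assms by simp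
  have "\<bar>p * d\<bar> \<le> 1 * r" unfolding abs_mult dr using assms by (intro mult_right_mono) auto
  moreover have "d\<^sup>2 \<le> 1 * r" unfolding assms(1) unfolding power2_eq_square using r1 assms(2) by (intro mult_right_mono) auto
  ultimately have "p * d \<le> r" "d\<^sup>2 \<le> r" by auto
  then have "\<kappa> / 4 < 1 / 2 * (1 - 3 * p\<^sup>2) - p * d - d\<^sup>2 / 4" using assms(2-4) by (simp add: field_simps)
  then have "r\<^sup>2 * (\<kappa> / 4) < d\<^sup>2 * (1 / 2 * (1 - 3 * p\<^sup>2) - p * d - d\<^sup>2 / 4)"
    unfolding assms(1) using assms(2) by (intro mult_strict_left_mono) auto
  then show ?thesis unfolding e by (simp add: mult.commute)
qed

text \<open>Far out on the branch \<open>-1 / sqrt 3 < V < 0\<close> the forcing varies little and \<open>V (L)\<close> is a centre of the frozen equation,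
  so the energy keeps \<open>V\<close> near \<open>V (L)\<close> and the angle keeps turning.\<close>

lemma Bs_empty: "Bs = {}"
proof (rule ccontr)
  assume "Bs \<noteq> {}"
  then obtain a sa where a: "(a,sa) \<in> Bs" "\<And>x s. (x,s) \<in> Bs \<Longrightarrow> a \<le> x"
    using Bs_least by metis
  have a0: "a > 0" using B_D Bs_B[OF a(1)] by blast
  note fold = least_fold[OF a]
  have aS: "{a<..} \<subseteq> S" by (rule S_unbounded[OF a0 fold])
  define \<sigma> where "\<sigma> L = (SOME s. (L,s) \<in> Bs \<and> q0 < rV L s \<and> rV L s < 0)" for L
  have \<sigma>: "(L, \<sigma> L) \<in> Bs \<and> q0 < rV L (\<sigma> L) \<and> rV L (\<sigma> L) < 0" if "a < L" for L
  proof -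
    have "\<exists>s. (L,s) \<in> Bs \<and> q0 < rV L s \<and> rV L s < 0" using aS that by (auto simp: S_def)
    then show ?thesis unfolding \<sigma>_def by (rule someI_ex)
  qed
  have dzp: "dz y > 0" if "y > a" for y
    by (rule dz_pos[OF a0 fold(1), where b = "y + 1"]) (use aS that in auto)
  have mono: "\<zeta> x < \<zeta> y" if xy: "a < x" "x < y" for x y
  proof -
    obtain z where z: "x < z" "z < y" "\<zeta> y - \<zeta> x = (y - x) * dz z" using zeta_mvt[of x y] a0 xy by auto
    then have "0 < (y - x) * dz z" using dzp[of z] xy by simp
    then show ?thesis using z by simp
  qed
  define A where "A = angle (a + 1) (\<sigma> (a + 1))"
  \<comment> \<open>No continuity of the choice \<sigma> is needed: near each length
    \<open>S_neighbourhood\<close> supplies points with the same angle, and \<open>S_unique\<close>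
    identifies them with those chosen by \<sigma>.\<close>
  have Ac: "angle L (\<sigma> L) = A" if "a < L" for L
    unfolding A_def
  proof (rule connected_local_const[where A = "{a<..}" and f = "\<lambda>L. angle L (\<sigma> L)"])
    show "\<forall>x\<in>{a<..}. \<forall>\<^sub>F y in at x within {a<..}. angle x (\<sigma> x) = angle y (\<sigma> y)"
    proof
      fix x assume x: "x \<in> {a<..}"
      then have sx: "(x, \<sigma> x) \<in> Bs" "q0 < rV x (\<sigma> x)" "rV x (\<sigma> x) < 0" using \<sigma> by auto
      obtain e where e: "e > 0" "\<And>L'. \<bar>L' - x\<bar> < e \<Longrightarrow>
          \<exists>s'. (L',s') \<in> Bs \<and> q0 < rV L' s' \<and> rV L' s' < 0 \<and> angle L' s' = angle x (\<sigma> x)"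
        using S_neighbourhood(2)[OF sx] by blast
      have "angle x (\<sigma> x) = angle y (\<sigma> y)" if "y > a" "\<bar>y - x\<bar> < e" for y
        using e(2)[OF that(2)] S_unique \<sigma>[OF that(1)] by metis
      then show "\<forall>\<^sub>F y in at x within {a<..}. angle x (\<sigma> x) = angle y (\<sigma> y)"
        unfolding eventually_at using e(1) by (auto simp: dist_real_def)
    qed
  qed (use that in auto)
  define p1 where "p1 = rV (a + 1) (\<sigma> (a + 1))"
  have p1: "q0 < p1" "p1 < 0" "p1 ^ 3 - p1 = - \<zeta> (a + 1)"
    using \<sigma>[of "a + 1"] Bs_acceleration_zero[of "a + 1" "\<sigma> (a + 1)"] by (auto simp: p1_def)
  \<comment> \<open>A stiffness valid for all larger lengths: as \<zeta> increases, the root moves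
    from \<open>p1\<close> towards 0, and \<open>1 - 3 * p^2\<close> only grows.\<close>
  define \<kappa> where "\<kappa> = 1 - 3 * p1\<^sup>2"
  have \<kappa>: "\<kappa> > 0" "\<kappa> \<le> 1" using q0_sq_less[OF p1(1,2)] by (auto simp: \<kappa>_def)
  define r where "r = \<kappa> / 16"
  have r: "r > 0" "r \<le> 1/16" using \<kappa> by (auto simp: r_def)
  \<comment> \<open>Chosen so that the energy \<open>2 * C0 * \<eta>\<close>, the most that the
    variation of the forcing can contribute, equals the height in
    \<open>quartic_well\<close>.\<close>
  define \<eta> where "\<eta> = \<kappa> * r\<^sup>2 / (8 * C0)"
  have \<eta>: "\<eta> > 0" "2 * C0 * \<eta> = \<kappa> * r\<^sup>2 / 4" using \<kappa> r C0_ge by (auto simp: \<eta>_def)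
  have zbdd: "bdd_above (\<zeta> ` {a + 1..})" using zeta_bounds a0 by (intro bdd_aboveI2[of _ _ 0]) (auto intro: less_imp_le)
  \<comment> \<open>\<zeta> is increasing and bounded, so from some \<open>x0\<close> on its
    remaining increase is at most \<eta>. This \<open>x0\<close> does not depend on the length
    \<open>L\<close> considered later.\<close>
  obtain x0 where x0: "x0 \<ge> a + 1" "Sup (\<zeta> ` {a + 1..}) - \<eta> < \<zeta> x0"
    using less_cSup_iff[of "\<zeta> ` {a + 1..}" "Sup (\<zeta> ` {a + 1..}) - \<eta>"] zbdd \<eta>(1) by auto
  have osc: "\<zeta> L - \<zeta> x \<le> \<eta>" if "x0 \<le> x" "x \<le> L" for x L
  proof -
    have "\<zeta> L \<le> Sup (\<zeta> ` {a + 1..})" by (rule cSup_upper[OF _ zbdd]) (use that x0 in auto)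
    moreover have "\<zeta> x0 \<le> \<zeta> x" using mono[of x0 x] that x0 by (cases "x = x0") auto
    ultimately show ?thesis using x0(2) by linarith
  qed
  have rate: "\<kappa> / 4 \<le> ang_rate x (\<sigma> L)" if L: "x0 \<le> L" and x: "x \<in> {x0..L}" for x L
  proof -
    define s where "s = \<sigma> L"
    have La: "a < L" using L x0 by simp
    have Bs: "(L,s) \<in> Bs" "q0 < rV L s" "rV L s < 0" using \<sigma>[OF La] by (auto simp: s_def)
    have b: "(L,s) \<in> B" "dom L s" "rF L s = 0" using Bs_B[OF Bs(1)] B_D by auto
    have dx: "dom y s" if "y \<in> {0..L}" for y using dom_mono[OF b(2)] that by auto
    define p where "p = rV L s"
    have p3: "p ^ 3 - p = - \<zeta> L" using Bs_acceleration_zero[OF Bs(1)] by (simp add: p_def)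
    have pge: "p1 \<le> p"
    proof (rule ccontr)
      assume "\<not> p1 \<le> p"
      then have "p1 ^ 3 - p1 < p ^ 3 - p" using cubic_antimono[of p p1] Bs p1 by (simp add: p_def)
      moreover have "\<zeta> (a + 1) \<le> \<zeta> L" using mono[of "a + 1" L] L x0 by (cases "L = a + 1") auto
      ultimately show False using p3 p1(3) by simp
    qed
    have pabs: "\<bar>p\<bar> \<le> 1" using Bs q0 by (simp add: p_def)
    have "p\<^sup>2 \<le> p1\<^sup>2" using power_mono[of "- p" "- p1" 2] pge Bs(3) by (simp add: p_def)
    then have \<kappa>p: "\<kappa> \<le> 1 - 3 * p\<^sup>2" by (simp add: \<kappa>_def)
    have near: "\<bar>rV x s - p\<bar> < r" if x: "x \<in> {x0..L}" for x
    proof (rule ccontr)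
      assume "\<not> \<bar>rV x s - p\<bar> < r"
      have cV: "continuous_on {x..L} (\<lambda>y. rV y s)"
      proof (rule continuous_at_imp_continuous_on, rule ballI)
        fix y assume "y \<in> {x..L}"
        then have "dom y s" using x x0 a0 by (intro dx) auto
        then show "isCont (\<lambda>y. rV y s) y" using rV_x DERIV_isCont by blast
      qed
      \<comment> \<open>The deviation from \<open>p\<close> is 0 at \<open>L\<close>, so on the way
        it equals \<open>r\<close> exactly.\<close>
      have "\<exists>y\<ge>x. y \<le> L \<and> \<bar>rV y s - p\<bar> = r"
        by (rule IVT2') (use \<open>\<not> \<bar>rV x s - p\<bar> < r\<close> x r in \<open>auto simp: p_def intro!: continuous_intros cV\<close>)
      then obtain y where y: "x \<le> y" "y \<le> L" "\<bar>rV y s - p\<bar> = r" by blast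
      have ya: "a < y" using y x x0 by simp
      \<comment> \<open>The energy alone has derivative \<open>- dz t * V\<close>, of unknown sign;
        adding \<open>C0 * \<zeta>\<close> gives \<open>dz t * (C0 - V) \<ge> 0\<close>.\<close>
      define G where "G t = (rF t s)\<^sup>2 / 2 - rV t s ^ 4 / 4 + (rV t s)\<^sup>2 / 2 - \<zeta> t * rV t s + C0 * \<zeta> t" for t
      have "G y \<le> G L"
      proof (rule DERIV_nonneg_imp_nondecreasing[OF y(2)])
        fix t assume t: "y \<le> t" "t \<le> L"
        then have t0: "t > 0" "t \<in> {0..L}" "a < t" using ya a0 by auto
        have "(G has_real_derivative dz t * (C0 - rV t s)) (at t)"
          unfolding G_def[abs_def]
          by (auto intro!: derivative_eq_intros rV_x[OF dx[OF t0(2)]] rF_x[OF dx[OF t0(2)]] zeta_deriv[OF t0(1)]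
              simp: field_simps power2_eq_square power3_eq_cube)
        moreover have "0 \<le> dz t * (C0 - rV t s)"
          using dzp[OF t0(3)] B_bound[OF b(1) t0(2)] by (intro mult_nonneg_nonneg) auto
        ultimately show "\<exists>d. (G has_real_derivative d) (at t) \<and> 0 \<le> d" by blast
      qed
      then have "(rF y s)\<^sup>2 / 2 + (- (rV y s ^ 4) / 4 + (rV y s)\<^sup>2 / 2 + (p ^ 3 - p) * rV y s) - (- (p ^ 4) / 4 + p\<^sup>2 / 2 + (p ^ 3 - p) * p)
          \<le> (\<zeta> L - \<zeta> y) * (C0 - rV y s)"
        unfolding G_def p3 using b(3) by (simp add: p_def algebra_simps)
      moreover have "(\<zeta> L - \<zeta> y) * (C0 - rV y s) \<le> \<eta> * (2 * C0)"
      proof (rule mult_mono)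
        show "\<zeta> L - \<zeta> y \<le> \<eta>" using osc y x by simp
        have "\<bar>rV y s\<bar> \<le> C0" using B_bound[OF b(1), of y] y ya a0 by simp
        then show "C0 - rV y s \<le> 2 * C0" "0 \<le> C0 - rV y s" by auto
      qed (use \<eta> in auto)
      moreover have "\<kappa> * r\<^sup>2 / 4 < (- ((p + (rV y s - p)) ^ 4) / 4 + (p + (rV y s - p))\<^sup>2 / 2 + (p ^ 3 - p) * (p + (rV y s - p)))
          - (- (p ^ 4) / 4 + p\<^sup>2 / 2 + (p ^ 3 - p) * p)"
        by (rule quartic_well) (use y(3) r \<kappa> \<kappa>p pabs in \<open>auto simp: r_def power2_eq_iff abs_if split: if_splits\<close>)
      ultimately show False using \<eta>(2) zero_le_power2[of "rF y s"] by (simp add: mult.commute)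
    qed
    define d where "d = rV x s - p"
    have d: "\<bar>d\<bar> < r" using near[OF x] by (simp add: d_def)
    have "\<bar>p * d\<bar> \<le> 1 * r" unfolding abs_mult using d pabs by (intro mult_mono) auto
    moreover have "\<bar>d * d\<bar> \<le> 1 * r" unfolding abs_mult using d r by (intro mult_mono) auto
    moreover have "3 * (rV x s)\<^sup>2 - 1 = - (1 - 3 * p\<^sup>2) + 6 * (p * d) + 3 * (d * d)"
      by (simp add: d_def algebra_simps power2_eq_square)
    \<comment> \<open>The two corrections amount to at most \<open>9 * r = 9/16 * \<kappa>\<close>,
      which leaves more than a quarter of \<kappa>.\<close>
    ultimately have h: "\<kappa> / 4 \<le> - (3 * (rV x s)\<^sup>2 - 1)" using \<kappa>p \<kappa> by (simp add: r_def abs_le_iff)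
    have N: "(rW x s)\<^sup>2 + (rZ x s)\<^sup>2 > 0"
      using WZ_nonzero[OF b(2), of x] x x0 a0 by (simp add: sum_power2_gt_zero_iff sum_power2_eq_zero_iff)
    have "\<kappa> / 4 * (rW x s)\<^sup>2 \<le> - (3 * (rV x s)\<^sup>2 - 1) * (rW x s)\<^sup>2" using h by (intro mult_right_mono) auto
    moreover have "\<kappa> / 4 * (rZ x s)\<^sup>2 \<le> 1 * (rZ x s)\<^sup>2" using \<kappa> by (intro mult_right_mono) auto
    ultimately have "\<kappa> / 4 * ((rW x s)\<^sup>2 + (rZ x s)\<^sup>2) \<le> (rZ x s)\<^sup>2 - (3 * (rV x s)\<^sup>2 - 1) * (rW x s)\<^sup>2"
      by (simp add: algebra_simps)
    then have "\<kappa> / 4 \<le> ang_rate x s" unfolding ang_rate_def using N by (simp add: pos_le_divide_eq)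
    then show ?thesis by (simp add: s_def)
  qed
  have x00: "x0 > 0" using x0 a0 by simp
  \<comment> \<open>Up to \<open>x0\<close> the angle may turn back at speed at most
    \<open>M0\<close>; from there to \<open>L\<close> it advances at speed at least
    \<open>\<kappa> / 4\<close>.\<close>
  have lower: "- M0 * x0 + \<kappa> / 4 * (L - x0) \<le> A" if L: "x0 \<le> L" for L
  proof -
    have La: "a < L" and L0: "L > 0" using L x0 a0 by auto
    have b: "(L, \<sigma> L) \<in> B" "dom L (\<sigma> L)" using Bs_B \<sigma>[OF La] B_D by blast+
    define c where "c = x0 / L"
    have c: "0 < c" "c \<le> 1" using x00 L by (auto simp: c_def)
    let ?g = "\<lambda>y. ang_rate (L * y) (\<sigma> L)"
    have cg: "continuous_on {0..1} ?g" by (rule cont_x(5)[OF b(2)])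
    have gi: "?g integrable_on {0..1}" by (rule integrable_continuous_interval[OF cg])
    have "integral {0..1} ?g = integral {0..c} ?g + integral {c..1} ?g"
      using Henstock_Kurzweil_Integration.integral_combine[OF less_imp_le[OF c(1)] c(2) gi] by simp
    moreover have "integral {0..c} (\<lambda>y. - M0) \<le> integral {0..c} ?g"
    proof (rule integral_le)
      show "?g integrable_on {0..c}"
        by (rule integrable_continuous_interval[OF continuous_on_subset[OF cg]]) (use c in auto)
      show "- M0 \<le> ?g y" if "y \<in> {0..c}" for y
        using ang_rate_bound[OF B_bound[OF b(1), of "L * y"]] that c L0 by (simp add: mult_left_le abs_le_iff)
    qed auto
    moreover have "integral {c..1} (\<lambda>y. \<kappa> / 4) \<le> integral {c..1} ?g"
    proof (rule integral_le)
      show "?g integrable_on {c..1}"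
        by (rule integrable_continuous_interval[OF continuous_on_subset[OF cg]]) (use c in auto)
      show "\<kappa> / 4 \<le> ?g y" if y: "y \<in> {c..1}" for y
      proof (rule rate[OF L])
        have "x0 \<le> L * y" using y L0 by (simp add: c_def field_simps)
        then show "L * y \<in> {x0..L}" using y L0 by (simp add: mult_left_le)
      qed
    qed auto
    ultimately have "- M0 * c + \<kappa> / 4 * (1 - c) \<le> integral {0..1} ?g" using c by (simp add: mult.commute)
    then have "L * (- M0 * c + \<kappa> / 4 * (1 - c)) \<le> L * integral {0..1} ?g" using L0 by (intro mult_left_mono) auto
    moreover have "L * (- M0 * c + \<kappa> / 4 * (1 - c)) = - M0 * x0 + \<kappa> / 4 * (L - x0)"
      using L0 by (simp add: c_def field_simps)
    ultimately show ?thesis using Ac[OF La] by (simp add: angle_def)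
  qed
  \<comment> \<open>The length at which the lower bound has grown to
    \<open>\<bar>A\<bar> + 1\<close>.\<close>
  define L where "L = x0 + 4 / \<kappa> * (\<bar>A\<bar> + M0 * x0 + 1)"
  have "0 \<le> 4 / \<kappa> * (\<bar>A\<bar> + M0 * x0 + 1)" using \<kappa> M0_pos x00 by (intro mult_nonneg_nonneg add_nonneg_nonneg) auto
  then have "- M0 * x0 + \<kappa> / 4 * (L - x0) \<le> A" by (intro lower) (simp add: L_def)
  moreover have "\<kappa> / 4 * (L - x0) = \<bar>A\<bar> + M0 * x0 + 1" using \<kappa> by (simp add: L_def)
  ultimately show False by linarith
qed

end

section \<open>The set of branch lengths\<close>

context ivp
begin

lemma has_integral_complex_of_real:
  "(f has_integral y) A \<Longrightarrow> ((\<lambda>x. complex_of_real (f x)) has_integral of_real y) A"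
  using has_integral_linear[OF _ bounded_linear_of_real, of f y A] by (simp add: o_def)

text \<open>Integrating the two derivatives shows that \<open>v\<close> solves the integral equation
  with the slope \<open>z / L\<close> and velocity \<open>u / L\<close>.\<close>

lemma ivp_solution_imp_dom:
  assumes L: "L > 0" and iv: "ivp_solution_pair c0 \<zeta> L z v u"
  shows "dom L (z / L)" "u 1 = L * rF L (z / L)"
proof -
  have v': "(v has_real_derivative u y) (at y within {0..1})" if "y \<in> {0..1}" for y
    using iv that by (simp add: ivp_solution_pair_def)
  have uc: "continuous_on {0..1} u" and v0: "v 0 = c0" and u0: "u 0 = z"
    using iv by (auto simp: ivp_solution_pair_def)
  define g where "g t = v t ^ 3 - v t + \<zeta> (L * t)" for t
  have u': "(u has_real_derivative L\<^sup>2 * g y) (at y)" if "y \<in> {0<..<1}" for y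
  proof -
    obtain w where "(u has_real_derivative w) (at y)" "- w + L\<^sup>2 * g y = 0"
      using iv \<open>y \<in> {0<..<1}\<close> unfolding ivp_solution_pair_def g_def by blast
    then show ?thesis by (simp add: add_eq_0_iff)
  qed
  have vc: "continuous_on {0..1} v" by (rule DERIV_continuous_on[OF v'])
  have rhs_eq: "rhs (of_real L) (\<lambda>y. of_real (v y)) t = of_real (g t)" if "t \<in> {0..1}" for t
    using zc_real[of "L * t"] L that by (simp add: rhs_def g_def)
  have vel_eq: "vel (of_real L) (of_real (z / L)) (\<lambda>y. of_real (v y)) y = of_real (u y / L)" if y: "y \<in> {0..1}" for y
  proof -
    have "((\<lambda>t. L\<^sup>2 * g t) has_integral u y - u 0) {0..y}"
    \<comment> \<open>The second derivative is given in the open interval only; at the end points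
      the continuity of \<open>u\<close> suffices.\<close>
    proof (rule fundamental_theorem_of_calculus_interior)
      show "continuous_on {0..y} u" by (rule continuous_on_subset[OF uc]) (use y in auto)
      show "(u has_vector_derivative L\<^sup>2 * g t) (at t)" if "t \<in> {0<..<y}" for t
        using u'[of t] that y by (auto simp: has_real_derivative_iff_has_vector_derivative)
    qed (use y in auto)
    from has_integral_mult_right[OF this, of "1 / L\<^sup>2"]
    have "(g has_integral (u y - z) / L\<^sup>2) {0..y}" using L u0 by simp
    then have "((\<lambda>t. complex_of_real (g t)) has_integral of_real ((u y - z) / L\<^sup>2)) {0..y}"
      by (rule has_integral_complex_of_real)
    then have "(rhs (of_real L) (\<lambda>y. of_real (v y)) has_integral of_real ((u y - z) / L\<^sup>2)) {0..y}"
      by (rule has_integral_eq[rotated]) (use rhs_eq y in auto)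
    then have "integral {0..y} (rhs (of_real L) (\<lambda>y. of_real (v y))) = of_real ((u y - z) / L\<^sup>2)"
      by (rule integral_unique)
    then have "vel (of_real L) (of_real (z / L)) (\<lambda>y. of_real (v y)) y = of_real (z / L + L * ((u y - z) / L\<^sup>2))"
      by (simp add: vel_def)
    also have "z / L + L * ((u y - z) / L\<^sup>2) = u y / L" using L by (simp add: field_simps power2_eq_square)
    finally show ?thesis .
  qed
  have pos_eq: "pos (of_real L) (of_real (z / L)) (\<lambda>y. of_real (v y)) y = of_real (v y)" if y: "y \<in> {0..1}" for y
  proof -
    have "(u has_integral v y - v 0) {0..y}"
    proof (rule fundamental_theorem_of_calculus)
      show "(v has_vector_derivative u t) (at t within {0..y})" if "t \<in> {0..y}" for t
        using has_field_derivative_subset[OF v'[of t], of "{0..y}"] that y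
        by (auto simp: has_real_derivative_iff_has_vector_derivative)
    qed (use y in auto)
    from has_integral_mult_right[OF this, of "1 / L"]
    have "((\<lambda>t. u t / L) has_integral (v y - c0) / L) {0..y}" using v0 by simp
    then have "((\<lambda>t. complex_of_real (u t / L)) has_integral of_real ((v y - c0) / L)) {0..y}"
      by (rule has_integral_complex_of_real)
    then have "(vel (of_real L) (of_real (z / L)) (\<lambda>y. of_real (v y)) has_integral of_real ((v y - c0) / L)) {0..y}"
      by (rule has_integral_eq[rotated]) (use vel_eq y in auto)
    then have "integral {0..y} (vel (of_real L) (of_real (z / L)) (\<lambda>y. of_real (v y))) = of_real ((v y - c0) / L)"
      by (rule integral_unique)
    then have "pos (of_real L) (of_real (z / L)) (\<lambda>y. of_real (v y)) y = of_real (c0 + L * ((v y - c0) / L))"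
      by (simp add: pos_def)
    then show ?thesis using L by simp
  qed
  have "seg (of_real L)" using zc_real L by (auto simp: seg_def simp flip: of_real_mult)
  then have s: "sol (of_real L) (of_real (z / L)) (\<lambda>y. of_real (v y))"
    unfolding sol_def using vc pos_eq by (auto intro!: continuous_intros)
  show "dom L (z / L)" using sol_imp(1)[OF s] L by (simp add: dom_def cpt_def)
  have "F (cpt L (z / L)) = of_real (u 1 / L)" using sol_imp(3)[OF s] vel_eq[of 1] by (simp add: cpt_def)
  then show "u 1 = L * rF L (z / L)" using L by (simp add: rF_def)
qed

lemma dom_imp_ivp_solution:
  assumes L: "L > 0" and d: "dom L s"
  shows "ivp_solution_pair c0 \<zeta> L (L * s) (\<lambda>y. rV (L * y) s) (\<lambda>y. L * rF (L * y) s)"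
proof -
  have dx: "dom (L * y) s" if "y \<in> {0..1}" for y
    using dom_mono[OF d, of "L * y"] L that by (simp add: mult_left_le)
  have ch: "((\<lambda>y. G (L * y)) has_real_derivative L * G') (at y)"
    if "(G has_real_derivative G') (at (L * y))" for G G' y
  proof -
    have "((\<lambda>y. G (L * y)) has_real_derivative G' * (L * 1)) (at y)"
      by (rule DERIV_chain2[where g = "\<lambda>y. L * y", OF that]) (auto intro!: derivative_eq_intros)
    then show ?thesis by (simp add: mult.commute)
  qed
  have "((\<lambda>y. rV (L * y) s) has_real_derivative L * rF (L * y) s) (at y within {0..1})" if "y \<in> {0..1}" for y
    using ch[OF rV_x[OF dx[OF that]]] by (rule has_field_derivative_at_within)
  moreover have "continuous_on {0..1} (\<lambda>y. L * rF (L * y) s)" by (intro continuous_intros cont_x d)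
  moreover have "\<exists>w. ((\<lambda>y. L * rF (L * y) s) has_real_derivative w) (at y) \<and>
      - w + L\<^sup>2 * (rV (L * y) s ^ 3 - rV (L * y) s + \<zeta> (L * y)) = 0" if "y \<in> {0<..<1}" for y
  proof (intro exI conjI)
    show "((\<lambda>y. L * rF (L * y) s) has_real_derivative L * (L * (rV (L * y) s ^ 3 - rV (L * y) s + \<zeta> (L * y)))) (at y)"
      by (rule DERIV_cmult[OF ch[OF rF_x[OF dx]]]) (use that in auto)
  qed (simp add: power2_eq_square algebra_simps)
  ultimately show ?thesis using r_init by (simp add: ivp_solution_pair_def)
qed

lemma shoot_eq:
  assumes "L > 0" "dom L (z / L)"
  shows "shoot c0 \<zeta> L z = L * rF L (z / L)"
  unfolding shoot_def
proof (rule the_equality)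
  show "\<exists>v u. ivp_solution_pair c0 \<zeta> L z v u \<and> L * rF L (z / L) = u 1"
    using dom_imp_ivp_solution[OF assms] assms(1)
    by (intro exI[of _ "\<lambda>y. rV (L * y) (z / L)"] exI[of _ "\<lambda>y. L * rF (L * y) (z / L)"]) simp
  show "m = L * rF L (z / L)" if "\<exists>v u. ivp_solution_pair c0 \<zeta> L z v u \<and> m = u 1" for m
    using that ivp_solution_imp_dom(2)[OF assms(1)] by blast
qed

text \<open>\<open>f (L, z) = L * F (L, z / L)\<close>, and on differentiating in \<open>z\<close>
  the outer factor \<open>L\<close> cancels the inner \<open>1 / L\<close>. The identity holds for
  all slopes near \<open>z\<close>, which the derivative of \<open>shoot\<close> requires.\<close>

lemma branch_point_B:
  assumes L: "L > 0" and bp: "branch_point c0 \<zeta> L z"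
  shows "(L, z / L) \<in> B"
proof -
  obtain v u where "ivp_solution_pair c0 \<zeta> L z v u"
    using bp by (auto simp: branch_point_def shoot_defined_def)
  then have d: "dom L (z / L)" by (rule ivp_solution_imp_dom(1)[OF L])
  have F0: "rF L (z / L) = 0" using bp shoot_eq[OF L d] L by (simp add: branch_point_def)
  have "((\<lambda>z'. L * rF L (z' / L)) has_real_derivative L * (rZ L (z / L) * (1 / L))) (at z)"
    by (rule DERIV_cmult, rule DERIV_chain2[where g = "\<lambda>z. z / L", OF rF_s[OF d]]) (use L in \<open>auto intro!: derivative_eq_intros\<close>)
  then have D: "((\<lambda>z'. L * rF L (z' / L)) has_real_derivative rZ L (z / L)) (at z)" using L by simp
  have "\<forall>\<^sub>F z' in nhds z. dom L (z' / L)"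
  proof -
    have "isCont (\<lambda>z. z / L) z" by (intro continuous_intros) (use L in auto)
    then have "filterlim (\<lambda>z. z / L) (nhds (z / L)) (nhds z)"
      using tendsto_at_iff_tendsto_nhds[of "\<lambda>z. z / L" z] by (simp add: isCont_def)
    then show ?thesis using dom_eventually[OF d] unfolding filterlim_iff by blast
  qed
  then have "\<forall>\<^sub>F z' in nhds z. shoot c0 \<zeta> L z' = L * rF L (z' / L)"
    by eventually_elim (rule shoot_eq[OF L])
  from DERIV_cong_ev[OF refl this refl]
  have "((\<lambda>z'. shoot c0 \<zeta> L z') has_real_derivative 0) (at z) \<longleftrightarrow> ((\<lambda>z'. L * rF L (z' / L)) has_real_derivative 0) (at z)" .
  then have "((\<lambda>z'. L * rF L (z' / L)) has_real_derivative 0) (at z)" using bp by (simp add: branch_point_def)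
  then have "rZ L (z / L) = 0" using D DERIV_unique by blast
  then show ?thesis using L d F0 by (simp add: B_def)
qed

text \<open>Slopes over bounded lengths are bounded, so accumulating lengths lift to accumulating
  branch points, whose limit would lie in \<open>Bs\<close>.\<close>

lemma not_islimpt_B_lengths: "\<not> L islimpt fst ` B"
proof
  assume "L islimpt fst ` B"
  then obtain Ls where Ls: "\<And>n::nat. Ls n \<in> fst ` B - {L}" "Ls \<longlonglongrightarrow> L"
    unfolding islimpt_sequential by blast
  then have "\<forall>n. \<exists>s. (Ls n, s) \<in> B" by force
  then obtain ss where ss: "\<And>n. (Ls n, ss n) \<in> B" by metis
  obtain k s where k: "strict_mono (k :: nat \<Rightarrow> nat)" "(\<lambda>n. ss (k n)) \<longlonglongrightarrow> s" "(\<lambda>n. Ls (k n)) \<longlonglongrightarrow> L"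
    using B_subsequence[OF ss Ls(2)] by metis
  have "(L,s) \<in> B" by (rule B_closed[OF ss k(3,2)])
  moreover have "\<exists>b'\<in>B. dist b' (L,s) < e \<and> fst b' \<noteq> L" if "e > 0" for e
  proof -
    have "\<forall>\<^sub>F n in sequentially. dist (Ls (k n), ss (k n)) (L,s) < e"
      by (rule tendstoD[OF tendsto_Pair[OF k(3,2)] that])
    then obtain n where "dist (Ls (k n), ss (k n)) (L,s) < e" by (auto simp: eventually_sequentially)
    then show ?thesis using ss[of "k n"] Ls(1)[of "k n"] by (intro bexI[of _ "(Ls (k n), ss (k n))"]) auto
  qed
  ultimately have "(L,s) \<in> Bs" by (simp add: Bs_def)
  then show False by (simp add: Bs_empty)
qed

text \<open>There is no limit point anywhere on the line, inside the set or outside. So the set is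
  finite in each compact interval, hence countable and null.\<close>

lemma branch_lengths_discrete_null:
  "discrete (branch_lengths c0 \<zeta>) \<and> branch_lengths c0 \<zeta> \<in> null_sets lebesgue"
proof
  have sub: "branch_lengths c0 \<zeta> \<subseteq> fst ` B"
    using branch_point_B by (force simp: branch_lengths_def)
  have nl: "\<not> x islimpt branch_lengths c0 \<zeta>" for x
    using not_islimpt_B_lengths islimpt_subset[OF _ sub] by blast
  then show "discrete (branch_lengths c0 \<zeta>)"
    by (auto simp: discrete_def isolated_in_islimpt_iff)
  have "finite ({- real n..real n} \<inter> branch_lengths c0 \<zeta>)" for n
    by (rule finite_not_islimpt_in_compact) (use nl in auto)
  then have "countable (\<Union>n. {- real n..real n} \<inter> branch_lengths c0 \<zeta>)"
    by (intro countable_UN[OF countableI_type]) (rule countable_finite)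
  moreover have "branch_lengths c0 \<zeta> \<subseteq> (\<Union>n. {- real n..real n} \<inter> branch_lengths c0 \<zeta>)"
  proof
    fix x assume x: "x \<in> branch_lengths c0 \<zeta>"
    obtain n where "\<bar>x\<bar> \<le> real n" using real_arch_simple by blast
    then show "x \<in> (\<Union>n. {- real n..real n} \<inter> branch_lengths c0 \<zeta>)" using x by (auto simp: abs_le_iff intro!: exI[of _ n])
  qed
  ultimately have "countable (branch_lengths c0 \<zeta>)" using countable_subset by blast
  then show "branch_lengths c0 \<zeta> \<in> null_sets lebesgue"
    by (intro null_sets_completionI countable_imp_null_set_lborel)
qed

end

theorem theorem2p10:
  fixes c0 :: real and \<zeta> :: "real \<Rightarrow> real" and I :: "real set"
  assumes "open I" and "is_interval I" and "{0..} \<subseteq> I"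
    and "real_analytic_on \<zeta> I"
    and "\<And>x. x \<in> I \<Longrightarrow> -1 < \<zeta> x \<and> \<zeta> x < 0"
  shows "discrete (branch_lengths c0 \<zeta>) \<and> branch_lengths c0 \<zeta> \<in> null_sets lebesgue"
proof -
  obtain N zc where "open N" "zc holomorphic_on N" "\<forall>x\<in>I. complex_of_real x \<in> N \<and> zc (of_real x) = of_real (\<zeta> x)"
    using real_analytic_on_holomorphic_extension[OF assms(4)] by blast
  then interpret ivp c0 \<zeta> N zc
    using assms(3,5) by unfold_locales auto
  show ?thesis by (rule branch_lengths_discrete_null)
qed

end
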